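(* Let $k$ be a field, $\mathfrak{g}$ a Lie algebra over $k$, $\mathfrak{h}$ an ideal of $\mathfrak{g}$ and $M$ a $\mathfrak{g}$-module. Then the sequence $$0\to H^1(\mathfrak{g}/\mathfrak{h},M^{\mathfrak{h}})\xrightarrow{\ \inf\ }H^1(\mathfrak{g},M)\xrightarrow{\ \mathrm{res}\ }H^1(\mathfrak{h},M)^{\mathfrak{g}/\mathfrak{h}}\xrightarrow{\ \mathrm{tr}\ }H^2(\mathfrak{g}/\mathfrak{h},M^{\mathfrak{h}})$$ is exact, where $\mathrm{tr}$ is the map described in the context.
   Context: Derivations and $H^1$: for a Lie algebra $\mathfrak{a}$ over $k$ and an $\mathfrak{a}$-module $N$, $\mathrm{Der}(\mathfrak{a},N)$ is the space of $k$-linear maps $d:\mathfrak{a}\to N$ with $d[x,y]=x\cdot d(y)-y\cdot d(x)$; $\delta(n)$ denotes the inner derivation $x\mapsto x\cdot n$; $\mathrm{Inn}(\mathfrak{a},N)=\{\delta(n)\}$ and $H^1(\mathfrak{a},N)=\mathrm{Der}(\mathfrak{a},N)/\mathrm{Inn}(\mathfrak{a},N)$. $M^{\mathfrak{h}}=\{m\in M: z\cdot m=0\ \forall z\in\mathfrak{h}\}$, a $\mathfrak{g}/\mathfrak{h}$-module. $\mathfrak{g}$ acts on $\mathrm{Der}(\mathfrak{h},M)$ by $({}^xd)(z)=x\cdot d(z)-d[x,z]$; this induces an action of $\mathfrak{g}/\mathfrak{h}$ on $H^1(\mathfrak{h},M)$, and $H^1(\mathfrak{h},M)^{\mathfrak{g}/\mathfrak{h}}$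 is the subspace of elements annihilated by $\mathfrak{g}/\mathfrak{h}$. $\mathrm{Der}(\mathfrak{h},M)^{\mathfrak{g}/\mathfrak{h}}$ denotes the preimage of $H^1(\mathfrak{h},M)^{\mathfrak{g}/\mathfrak{h}}$ in $\mathrm{Der}(\mathfrak{h},M)$. $H^2$: $H^2(\mathfrak{a},N)$ is identified with equivalence classes of Lie algebra extensions $0\to N\xrightarrow{i}\mathfrak{e}\to\mathfrak{a}\to0$ ($N$ abelian) whose induced action $i(x\cdot n)=[\tilde x,i(n)]$ ($\tilde x$ a lift of $x$) is the given module structure; the class of an extension corresponds to that of the 2-cocycle $f(x,y)=[s(x),s(y)]-s[x,y]$ for a linear section $s$. Maps: $\inf$ is induced by $\mathfrak{g}\to\mathfrak{g}/\mathfrak{h}$ and $M^{\mathfrak{h}}\hookrightarrow M$; $\mathrm{res}$ is restriction of derivations to $\mathfrak{h}$. The map $\mathrm{tr}$: $M\rtimes\mathfrak{g}$ has bracket $[(m,x),(m',x')]=(x\cdot m'-x'\cdot m,[x,x'])$. For $d\in\mathrm{Der}(\mathfrak{h},M)^{\mathfrak{g}/\mathfrak{h}}$ let $s_d:\mathfrak{h}\to M\rtimes\mathfrak{g}$, $s_d(z)=(d(z),z)$, a Lie algebra homomorphism, and $I=\{y\in M\rtimes\mathfrak{g}:[y,s_d(\mathfrak{h})]\subset s_d(\mathfrak{h})\}$. Then $s_d(\mathfrak{h})$ is an ideal in $I$ and $0\to M^{\mathfrak{h}}\to I/s_d(\mathfrak{h})\to\mathfrak{g}/\mathfrak{h}\to0$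 (maps induced by $m\mapsto(m,0)$ and $(m,x)\mapsto x$) is an extension; $\widehat{\mathrm{tr}}(d)\in H^2(\mathfrak{g}/\mathfrak{h},M^{\mathfrak{h}})$ is its class. The map $\widehat{\mathrm{tr}}$ depends only on $[d]\in H^1(\mathfrak{h},M)$ and $\mathrm{tr}[d]:=\widehat{\mathrm{tr}}(d)$. *)

theory Defs
  imports "HOL-Algebra.QuotRing" "HOL-Algebra.Module" "HOL-Library.FuncSet"
begin

text \<open>
  Vector spaces over a field \<open>K\<close> are HOL-Algebra modules \<open>Module.module K V\<close>. A Lie algebra is
  carried by the same record, its bracket being the field \<open>mult\<close>: \<open>x \<otimes>\<^bsub>L\<^esub> y\<close> is \<open>[x, y]\<close>.
  The field \<open>one\<close> is never used, and \<open>mult\<close> is never used for records that only serve as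
  vector spaces.
\<close>

locale linear_map = V?: Module.module K V + W?: Module.module K W for K and V and W +
  fixes f :: "'b \<Rightarrow> 'c"
  assumes linear_closed: "x \<in> carrier V \<Longrightarrow> f x \<in> carrier W"
    and linear_add: "\<lbrakk>x \<in> carrier V; y \<in> carrier V\<rbrakk> \<Longrightarrow> f (x \<oplus>\<^bsub>V\<^esub> y) = f x \<oplus>\<^bsub>W\<^esub> f y"
    and linear_smult: "\<lbrakk>a \<in> carrier K; x \<in> carrier V\<rbrakk> \<Longrightarrow> f (a \<odot>\<^bsub>V\<^esub> x) = a \<odot>\<^bsub>W\<^esub> f x"

locale lie_algebra = K?: Ring.field K + L?: Module.module K L for K and L +
  assumes bracket_linear_right: "x \<in> carrier L \<Longrightarrow> linear_map K L L (\<lambda>y. x \<otimes>\<^bsub>L\<^esub> y)"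
    and bracket_linear_left: "y \<in> carrier L \<Longrightarrow> linear_map K L L (\<lambda>x. x \<otimes>\<^bsub>L\<^esub> y)"
    and bracket_alternating: "x \<in> carrier L \<Longrightarrow> x \<otimes>\<^bsub>L\<^esub> x = \<zero>\<^bsub>L\<^esub>"
    and jacobi: "\<lbrakk>x \<in> carrier L; y \<in> carrier L; z \<in> carrier L\<rbrakk> \<Longrightarrow>
      x \<otimes>\<^bsub>L\<^esub> (y \<otimes>\<^bsub>L\<^esub> z) \<oplus>\<^bsub>L\<^esub> y \<otimes>\<^bsub>L\<^esub> (z \<otimes>\<^bsub>L\<^esub> x) \<oplus>\<^bsub>L\<^esub> z \<otimes>\<^bsub>L\<^esub> (x \<otimes>\<^bsub>L\<^esub> y) = \<zero>\<^bsub>L\<^esub>"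

locale lie_ideal = L?: lie_algebra K L + submodule H K L for K and L and H +
  assumes bracket_in_ideal: "\<lbrakk>x \<in> carrier L; z \<in> H\<rbrakk> \<Longrightarrow> x \<otimes>\<^bsub>L\<^esub> z \<in> H"

locale lie_module = L?: lie_algebra K L + N?: Module.module K N for K and L and N +
  fixes act :: "'b \<Rightarrow> 'c \<Rightarrow> 'c"
  assumes act_linear_right: "x \<in> carrier L \<Longrightarrow> linear_map K N N (\<lambda>n. act x n)"
    and act_linear_left: "n \<in> carrier N \<Longrightarrow> linear_map K L N (\<lambda>x. act x n)"
    and act_bracket: "\<lbrakk>x \<in> carrier L; y \<in> carrier L; n \<in> carrier N\<rbrakk> \<Longrightarrow>
      act (x \<otimes>\<^bsub>L\<^esub> y) n = act x (act y n) \<ominus>\<^bsub>N\<^esub> act y (act x n)"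

text \<open>
  Operations on cosets are unions over representatives, as in \<^const>\<open>FactRing\<close>; the clause for
  \<open>mult\<close> is the quotient bracket when \<open>U\<close> is a Lie ideal.
\<close>

definition quot :: "('k, 'v) module \<Rightarrow> 'v set \<Rightarrow> ('k, 'v set) module" where
  "quot V U = \<lparr>carrier = a_rcosets\<^bsub>V\<^esub> U, mult = rcoset_mult V U, one = U, zero = U,
     add = set_add V, smult = (\<lambda>c X. \<Union>x\<in>X. U +>\<^bsub>V\<^esub> (c \<odot>\<^bsub>V\<^esub> x))\<rparr>"

text \<open>The vector space of all functions \<open>A \<rightarrow> V\<close>, made extensional so that a function is
  determined by its values on \<open>A\<close>.\<close>

definition fun_space :: "'a set \<Rightarrow> ('k, 'v) module \<Rightarrow> ('k, 'a \<Rightarrow> 'v) module" where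
  "fun_space A V = \<lparr>carrier = A \<rightarrow>\<^sub>E carrier V,
     mult = (\<lambda>f g. \<lambda>x\<in>A. \<zero>\<^bsub>V\<^esub>), one = (\<lambda>x\<in>A. \<zero>\<^bsub>V\<^esub>), zero = (\<lambda>x\<in>A. \<zero>\<^bsub>V\<^esub>),
     add = (\<lambda>f g. \<lambda>x\<in>A. f x \<oplus>\<^bsub>V\<^esub> g x), smult = (\<lambda>c f. \<lambda>x\<in>A. c \<odot>\<^bsub>V\<^esub> f x)\<rparr>"

text \<open>The set \<open>A\<close> of acting elements is a parameter, so that this gives both the invariants under
  an ideal and those under a whole Lie algebra.\<close>

definition invariants ::
    "'l set \<Rightarrow> ('k, 'n) module \<Rightarrow> ('l \<Rightarrow> 'n \<Rightarrow> 'n) \<Rightarrow> ('k, 'n) module" where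
  "invariants A N act = N\<lparr>carrier := {n \<in> carrier N. \<forall>x\<in>A. act x n = \<zero>\<^bsub>N\<^esub>}\<rparr>"

text \<open>Here and below, \<open>the_elem (f ` X)\<close> is the common value of \<open>f\<close> on the elements of the coset
  \<open>X\<close>. In particular, \<open>quot_act\<close> is the action of \<open>L/H\<close> on the \<open>H\<close>-invariants.\<close>

definition quot_act :: "('l \<Rightarrow> 'n \<Rightarrow> 'n) \<Rightarrow> 'l set \<Rightarrow> 'n \<Rightarrow> 'n" where
  "quot_act act X n = the_elem ((\<lambda>x. act x n) ` X)"


definition Der :: "('k, 'r) ring_scheme \<Rightarrow> ('k, 'l) module \<Rightarrow> ('k, 'n) module \<Rightarrow>
    ('l \<Rightarrow> 'n \<Rightarrow> 'n) \<Rightarrow> ('k, 'l \<Rightarrow> 'n) module" where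
  "Der K L N act = (fun_space (carrier L) N)\<lparr>carrier :=
     {d \<in> carrier L \<rightarrow>\<^sub>E carrier N. linear_map K L N d \<and>
        (\<forall>x\<in>carrier L. \<forall>y\<in>carrier L. d (x \<otimes>\<^bsub>L\<^esub> y) = act x (d y) \<ominus>\<^bsub>N\<^esub> act y (d x))}\<rparr>"

definition Inn :: "('k, 'l) module \<Rightarrow> ('k, 'n) module \<Rightarrow> ('l \<Rightarrow> 'n \<Rightarrow> 'n) \<Rightarrow> ('l \<Rightarrow> 'n) set" where
  "Inn L N act = (\<lambda>n. \<lambda>x\<in>carrier L. act x n) ` carrier N"

definition H1 :: "('k, 'r) ring_scheme \<Rightarrow> ('k, 'l) module \<Rightarrow> ('k, 'n) module \<Rightarrow>
    ('l \<Rightarrow> 'n \<Rightarrow> 'n) \<Rightarrow> ('k, ('l \<Rightarrow> 'n) set) module" where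
  "H1 K L N act = quot (Der K L N act) (Inn L N act)"

definition H1_class :: "('k, 'r) ring_scheme \<Rightarrow> ('k, 'l) module \<Rightarrow> ('k, 'n) module \<Rightarrow>
    ('l \<Rightarrow> 'n \<Rightarrow> 'n) \<Rightarrow> ('l \<Rightarrow> 'n) \<Rightarrow> ('l \<Rightarrow> 'n) set" where
  "H1_class K L N act d = Inn L N act +>\<^bsub>Der K L N act\<^esub> d"


definition cocycles2 :: "('k, 'r) ring_scheme \<Rightarrow> ('k, 'l) module \<Rightarrow> ('k, 'n) module \<Rightarrow>
    ('l \<Rightarrow> 'n \<Rightarrow> 'n) \<Rightarrow> ('k, 'l \<times> 'l \<Rightarrow> 'n) module" where
  "cocycles2 K L N act = (fun_space (carrier L \<times> carrier L) N)\<lparr>carrier :=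
     {f \<in> carrier L \<times> carrier L \<rightarrow>\<^sub>E carrier N.
        (\<forall>x\<in>carrier L. linear_map K L N (\<lambda>y. f (x, y))) \<and>
        (\<forall>y\<in>carrier L. linear_map K L N (\<lambda>x. f (x, y))) \<and>
        (\<forall>x\<in>carrier L. f (x, x) = \<zero>\<^bsub>N\<^esub>) \<and>
        (\<forall>x\<in>carrier L. \<forall>y\<in>carrier L. \<forall>z\<in>carrier L.
           act x (f (y, z)) \<oplus>\<^bsub>N\<^esub> act y (f (z, x)) \<oplus>\<^bsub>N\<^esub> act z (f (x, y)) =
           f (x \<otimes>\<^bsub>L\<^esub> y, z) \<oplus>\<^bsub>N\<^esub> f (y \<otimes>\<^bsub>L\<^esub> z, x) \<oplus>\<^bsub>N\<^esub> f (z \<otimes>\<^bsub>L\<^esub> x, y))}\<rparr>"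

definition coboundaries2 :: "('k, 'r) ring_scheme \<Rightarrow> ('k, 'l) module \<Rightarrow> ('k, 'n) module \<Rightarrow>
    ('l \<Rightarrow> 'n \<Rightarrow> 'n) \<Rightarrow> ('l \<times> 'l \<Rightarrow> 'n) set" where
  "coboundaries2 K L N act =
     (\<lambda>b. \<lambda>(x, y)\<in>carrier L \<times> carrier L.
        act x (b y) \<ominus>\<^bsub>N\<^esub> act y (b x) \<ominus>\<^bsub>N\<^esub> b (x \<otimes>\<^bsub>L\<^esub> y)) ` {b. linear_map K L N b}"

definition H2 :: "('k, 'r) ring_scheme \<Rightarrow> ('k, 'l) module \<Rightarrow> ('k, 'n) module \<Rightarrow>
    ('l \<Rightarrow> 'n \<Rightarrow> 'n) \<Rightarrow> ('k, ('l \<times> 'l \<Rightarrow> 'n) set) module" where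
  "H2 K L N act = quot (cocycles2 K L N act) (coboundaries2 K L N act)"

text \<open>The class in \<^const>\<open>H2\<close> of a Lie algebra extension \<open>0 \<rightarrow> N \<rightarrow> E \<rightarrow> L \<rightarrow> 0\<close> with maps \<open>i\<close>
  and \<open>p\<close> is that of the cocycle \<open>[s x, s y] - s [x, y]\<close>, pulled back along \<open>i\<close>, for any linear
  section \<open>s\<close> of \<open>p\<close>.\<close>

definition extension_cocycle :: "('k, 'l) module \<Rightarrow> ('k, 'n) module \<Rightarrow> ('k, 'e) module \<Rightarrow>
    ('n \<Rightarrow> 'e) \<Rightarrow> ('l \<Rightarrow> 'e) \<Rightarrow> ('l \<times> 'l \<Rightarrow> 'n)" where
  "extension_cocycle L N E i s = (\<lambda>(x, y)\<in>carrier L \<times> carrier L.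
     inv_into (carrier N) i (s x \<otimes>\<^bsub>E\<^esub> s y \<ominus>\<^bsub>E\<^esub> s (x \<otimes>\<^bsub>L\<^esub> y)))"

definition extension_class :: "('k, 'r) ring_scheme \<Rightarrow> ('k, 'l) module \<Rightarrow> ('k, 'n) module \<Rightarrow>
    ('l \<Rightarrow> 'n \<Rightarrow> 'n) \<Rightarrow> ('k, 'e) module \<Rightarrow> ('n \<Rightarrow> 'e) \<Rightarrow> ('e \<Rightarrow> 'l) \<Rightarrow> ('l \<times> 'l \<Rightarrow> 'n) set" where
  "extension_class K L N act E i p = the_elem
     ((\<lambda>s. coboundaries2 K L N act +>\<^bsub>cocycles2 K L N act\<^esub> extension_cocycle L N E i s)
        ` {s. linear_map K L E s \<and> (\<forall>x\<in>carrier L. p (s x) = x)})"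


definition infl :: "('k, 'r) ring_scheme \<Rightarrow> ('k, 'l) module \<Rightarrow> 'l set \<Rightarrow> ('k, 'm) module \<Rightarrow>
    ('l \<Rightarrow> 'm \<Rightarrow> 'm) \<Rightarrow> ('l set \<Rightarrow> 'm) set \<Rightarrow> ('l \<Rightarrow> 'm) set" where
  "infl K L H M act c =
     the_elem ((\<lambda>d. H1_class K L M act (\<lambda>x\<in>carrier L. d (H +>\<^bsub>L\<^esub> x))) ` c)"

definition res :: "('k, 'r) ring_scheme \<Rightarrow> ('k, 'l) module \<Rightarrow> 'l set \<Rightarrow> ('k, 'm) module \<Rightarrow>
    ('l \<Rightarrow> 'm \<Rightarrow> 'm) \<Rightarrow> ('l \<Rightarrow> 'm) set \<Rightarrow> ('l \<Rightarrow> 'm) set" where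
  "res K L H M act c =
     the_elem ((\<lambda>d. H1_class K (L\<lparr>carrier := H\<rparr>) M act (restrict d H)) ` c)"

definition der_act :: "('k, 'l) module \<Rightarrow> 'l set \<Rightarrow> ('k, 'm) module \<Rightarrow>
    ('l \<Rightarrow> 'm \<Rightarrow> 'm) \<Rightarrow> 'l \<Rightarrow> ('l \<Rightarrow> 'm) \<Rightarrow> ('l \<Rightarrow> 'm)" where
  "der_act L H M act x d = (\<lambda>z\<in>H. act x (d z) \<ominus>\<^bsub>M\<^esub> d (x \<otimes>\<^bsub>L\<^esub> z))"

definition H1_act :: "('k, 'r) ring_scheme \<Rightarrow> ('k, 'l) module \<Rightarrow> 'l set \<Rightarrow> ('k, 'm) module \<Rightarrow>
    ('l \<Rightarrow> 'm \<Rightarrow> 'm) \<Rightarrow> 'l set \<Rightarrow> ('l \<Rightarrow> 'm) set \<Rightarrow> ('l \<Rightarrow> 'm) set" where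
  "H1_act K L H M act X c = the_elem
     ((\<lambda>(x, d). H1_class K (L\<lparr>carrier := H\<rparr>) M act (der_act L H M act x d)) ` (X \<times> c))"

definition H1_invariants :: "('k, 'r) ring_scheme \<Rightarrow> ('k, 'l) module \<Rightarrow> 'l set \<Rightarrow>
    ('k, 'm) module \<Rightarrow> ('l \<Rightarrow> 'm \<Rightarrow> 'm) \<Rightarrow> ('k, ('l \<Rightarrow> 'm) set) module" where
  "H1_invariants K L H M act =
     invariants (carrier (quot L H)) (H1 K (L\<lparr>carrier := H\<rparr>) M act) (H1_act K L H M act)"


definition semidirect :: "('k, 'l) module \<Rightarrow> ('k, 'm) module \<Rightarrow> ('l \<Rightarrow> 'm \<Rightarrow> 'm) \<Rightarrow>
    ('k, 'm \<times> 'l) module" where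
  "semidirect L M act = \<lparr>carrier = carrier M \<times> carrier L,
     mult = (\<lambda>(m, x) (m', x'). (act x m' \<ominus>\<^bsub>M\<^esub> act x' m, x \<otimes>\<^bsub>L\<^esub> x')),
     one = (\<zero>\<^bsub>M\<^esub>, \<zero>\<^bsub>L\<^esub>), zero = (\<zero>\<^bsub>M\<^esub>, \<zero>\<^bsub>L\<^esub>),
     add = (\<lambda>(m, x) (m', x'). (m \<oplus>\<^bsub>M\<^esub> m', x \<oplus>\<^bsub>L\<^esub> x')),
     smult = (\<lambda>c (m, x). (c \<odot>\<^bsub>M\<^esub> m, c \<odot>\<^bsub>L\<^esub> x))\<rparr>"

definition der_graph :: "'l set \<Rightarrow> ('l \<Rightarrow> 'm) \<Rightarrow> ('m \<times> 'l) set" where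
  "der_graph H d = (\<lambda>z. (d z, z)) ` H"

definition graph_idealizer :: "('k, 'l) module \<Rightarrow> 'l set \<Rightarrow> ('k, 'm) module \<Rightarrow>
    ('l \<Rightarrow> 'm \<Rightarrow> 'm) \<Rightarrow> ('l \<Rightarrow> 'm) \<Rightarrow> ('k, 'm \<times> 'l) module" where
  "graph_idealizer L H M act d = (semidirect L M act)\<lparr>carrier :=
     {y \<in> carrier (semidirect L M act).
        \<forall>w\<in>der_graph H d. y \<otimes>\<^bsub>semidirect L M act\<^esub> w \<in> der_graph H d}\<rparr>"

definition tr_hat :: "('k, 'r) ring_scheme \<Rightarrow> ('k, 'l) module \<Rightarrow> 'l set \<Rightarrow> ('k, 'm) module \<Rightarrow>
    ('l \<Rightarrow> 'm \<Rightarrow> 'm) \<Rightarrow> ('l \<Rightarrow> 'm) \<Rightarrow> ('l set \<times> 'l set \<Rightarrow> 'm) set" where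
  "tr_hat K L H M act d =
     extension_class K (quot L H) (invariants H M act) (quot_act act)
       (quot (graph_idealizer L H M act d) (der_graph H d))
       (\<lambda>m. der_graph H d +>\<^bsub>graph_idealizer L H M act d\<^esub> (m, \<zero>\<^bsub>L\<^esub>))
       (\<lambda>Y. the_elem ((\<lambda>(m, x). H +>\<^bsub>L\<^esub> x) ` Y))"

definition tr :: "('k, 'r) ring_scheme \<Rightarrow> ('k, 'l) module \<Rightarrow> 'l set \<Rightarrow> ('k, 'm) module \<Rightarrow>
    ('l \<Rightarrow> 'm \<Rightarrow> 'm) \<Rightarrow> ('l \<Rightarrow> 'm) set \<Rightarrow> ('l set \<times> 'l set \<Rightarrow> 'm) set" where
  "tr K L H M act c = the_elem (tr_hat K L H M act ` c)"

end

theory Submission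
  imports Defs
begin

text \<open>
  Fix a linear section \<open>t\<close> of \<open>L \<rightarrow> L/H\<close>. For an invariant derivation \<open>d\<close>, a linear section of
  \<open>I/s\<^sub>d(H) \<rightarrow> L/H\<close> is the same thing as a linear map \<open>\<mu>: L/H \<rightarrow> M\<close> with \<open>(\<mu> X, t X) \<in> I\<close> for all
  \<open>X\<close>, and its cocycle is
  \<open>t X \<cdot> \<mu> Y - t Y \<cdot> \<mu> X - \<mu> [X, Y] - d ([t X, t Y] - t [X, Y])\<close>.
  This is linear in \<open>(d, \<mu>)\<close>, so \<open>tr\<close> is linear; changing \<open>\<mu>\<close> changes it by a coboundary; and it
  vanishes for \<open>\<mu> = D \<circ> t\<close> if \<open>d\<close> is the restriction of a derivation \<open>D\<close> of \<open>L\<close>. Conversely, if the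
  class is trivial then \<open>\<mu>\<close> can be corrected to make the cocycle vanish, which says exactly that
  \<open>x \<mapsto> \<mu> X + d (x - t X)\<close>, with \<open>X\<close> the class of \<open>x\<close>, is a derivation extending \<open>d\<close>.
\<close>

section \<open>Linear algebra\<close>

text \<open>Each map of the sequence is \<open>the_elem\<close> of an image over a coset, so nothing
  can be said about it until that image is known to be a singleton. For quotients by a subspace this
  is done once: a linear map that vanishes on the subspace induces a linear map on the quotient. To
  bring \<open>H1_invariants\<close> under that scheme it is identified with a quotient of
  \<open>invariant_ders\<close>. The map \<open>tr\<close> needs more, because \<open>tr_hat\<close>
  is itself \<open>the_elem\<close> over all linear sections: sections must exist, which in
  arbitrary dimension calls for Zorn's lemma, and all of them must give the same class. Fixing one
  section of L -> L/H uses up the freedom of moving a representative by s_d(H), so that only a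
  function into M is left; two such functions differ by one with values in M^H, that is, by a
  1-cochain of L/H. That \<open>tr_hat\<close> vanishes on inner derivations of H is a special case
  of its vanishing on restrictions, since they extend to inner derivations of L.\<close>

context abelian_group
begin

lemma add_diff_right:
  "\<lbrakk>x \<in> carrier G; y \<in> carrier G; z \<in> carrier G\<rbrakk> \<Longrightarrow> x \<oplus> (y \<ominus> z) = x \<oplus> y \<ominus> z"
  by (simp add: a_minus_def a_assoc)

lemma add_diff_left:
  "\<lbrakk>x \<in> carrier G; y \<in> carrier G; z \<in> carrier G\<rbrakk> \<Longrightarrow> x \<ominus> z \<oplus> y = x \<oplus> y \<ominus> z"
  by (simp add: a_minus_def a_ac)

lemma diff_diff_right:
  "\<lbrakk>x \<in> carrier G; y \<in> carrier G; z \<in> carrier G\<rbrakk> \<Longrightarrow> x \<ominus> (y \<ominus> z) = x \<oplus> z \<ominus> y"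
  by (simp add: a_minus_def minus_add a_ac)

lemma diff_diff_left:
  "\<lbrakk>x \<in> carrier G; y \<in> carrier G; z \<in> carrier G\<rbrakk> \<Longrightarrow> x \<ominus> y \<ominus> z = x \<ominus> (y \<oplus> z)"
  by (simp add: a_minus_def minus_add a_ac)

lemma diff_eq_iff:
  "\<lbrakk>x \<in> carrier G; y \<in> carrier G; z \<in> carrier G\<rbrakk> \<Longrightarrow> x \<ominus> y = z \<longleftrightarrow> x = z \<oplus> y"
  using add.inv_solve_right[of z x y] by (auto simp: a_minus_def)

lemma eq_diff_iff:
  "\<lbrakk>x \<in> carrier G; y \<in> carrier G; z \<in> carrier G\<rbrakk> \<Longrightarrow> z = x \<ominus> y \<longleftrightarrow> z \<oplus> y = x"
  using diff_eq_iff[of x y z] by metis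

lemma neg_eq_diff: "x \<in> carrier G \<Longrightarrow> \<ominus> x = \<zero> \<ominus> x"
  by (simp add: a_minus_def)

text \<open>As rewrite rules these pull every subtraction to the outside and then across the
  equation, so that an identity in the group becomes an equality of two sums, which
  \<open>a_ac\<close> decides.\<close>

lemmas diff_simps = add_diff_right add_diff_left diff_diff_right diff_diff_left diff_eq_iff
  eq_diff_iff neg_eq_diff

lemma diff_self: "x \<in> carrier G \<Longrightarrow> x \<ominus> x = \<zero>"
  by (simp add: a_minus_def r_neg)

lemma diff_zero: "x \<in> carrier G \<Longrightarrow> x \<ominus> \<zero> = x"
  by (simp add: a_minus_def)

end

context linear_map
begin

lemma map_zero: "f \<zero>\<^bsub>V\<^esub> = \<zero>\<^bsub>W\<^esub>"
  using linear_smult[of "\<zero>\<^bsub>K\<^esub>" "\<zero>\<^bsub>V\<^esub>"] by (simp add: linear_closed)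

lemma map_neg: "x \<in> carrier V \<Longrightarrow> f (\<ominus>\<^bsub>V\<^esub> x) = \<ominus>\<^bsub>W\<^esub> f x"
  using linear_add[of "\<ominus>\<^bsub>V\<^esub> x" x]
  by (intro W.M.minus_equality[symmetric]) (simp_all add: V.M.l_neg linear_closed map_zero)

lemma map_diff:
  "\<lbrakk>x \<in> carrier V; y \<in> carrier V\<rbrakk> \<Longrightarrow> f (x \<ominus>\<^bsub>V\<^esub> y) = f x \<ominus>\<^bsub>W\<^esub> f y"
  by (simp add: a_minus_def linear_add map_neg)

lemmas linear_simps = linear_closed linear_add linear_smult map_zero map_neg map_diff

end

lemma linear_mapI:
  assumes "Module.module K V" "Module.module K W"
    and "\<And>x. x \<in> carrier V \<Longrightarrow> f x \<in> carrier W"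
    and "\<And>x y. \<lbrakk>x \<in> carrier V; y \<in> carrier V\<rbrakk> \<Longrightarrow> f (x \<oplus>\<^bsub>V\<^esub> y) = f x \<oplus>\<^bsub>W\<^esub> f y"
    and "\<And>a x. \<lbrakk>a \<in> carrier K; x \<in> carrier V\<rbrakk> \<Longrightarrow> f (a \<odot>\<^bsub>V\<^esub> x) = a \<odot>\<^bsub>W\<^esub> f x"
  shows "linear_map K V W f"
  using assms by (auto simp: linear_map_def linear_map_axioms_def)

text \<open>Cochains are stored as functions restricted to the carrier, while linearity only sees
  the values there; this rule passes between the two.\<close>

lemma linear_map_cong:
  assumes "linear_map K V W f" "\<And>x. x \<in> carrier V \<Longrightarrow> g x = f x"
  shows "linear_map K V W g"
proof -
  interpret linear_map K V W f by fact
  show ?thesis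
    by (rule linear_mapI) (simp_all add: assms(2) linear_simps V.module_axioms W.module_axioms)
qed

lemma linear_map_comp:
  assumes "linear_map K V W f" "linear_map K W X g"
  shows "linear_map K V X (\<lambda>x. g (f x))"
proof -
  interpret f: linear_map K V W f by fact
  interpret g: linear_map K W X g by fact
  show ?thesis
    by (rule linear_mapI)
      (simp_all add: f.linear_simps g.linear_simps f.V.module_axioms g.W.module_axioms)
qed

lemma linear_map_add:
  assumes "linear_map K V W f" "linear_map K V W g"
  shows "linear_map K V W (\<lambda>x. f x \<oplus>\<^bsub>W\<^esub> g x)"
proof -
  interpret f: linear_map K V W f by fact
  interpret g: linear_map K V W g by fact
  show ?thesis
    by (rule linear_mapI)
      (simp_all add: f.linear_simps g.linear_simps f.W.M.a_ac f.V.module_axioms f.W.module_axioms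
        f.W.smult_r_distr)
qed

lemma linear_map_smult:
  assumes "linear_map K V W f" "a \<in> carrier K"
  shows "linear_map K V W (\<lambda>x. a \<odot>\<^bsub>W\<^esub> f x)"
proof -
  interpret f: linear_map K V W f by fact
  show ?thesis
    using assms(2)
    by (intro linear_mapI)
      (simp_all add: f.linear_simps f.V.module_axioms f.W.module_axioms f.W.smult_r_distr
        f.W.smult_assoc1[symmetric] f.V.R.m_comm)
qed

text \<open>Reduces linearity of a difference of maps to that of sums and scalar multiples.\<close>

lemma (in Module.module) diff_eq_smult:
  "\<lbrakk>x \<in> carrier M; y \<in> carrier M\<rbrakk> \<Longrightarrow> x \<ominus>\<^bsub>M\<^esub> y = x \<oplus>\<^bsub>M\<^esub> (\<ominus> \<one>) \<odot>\<^bsub>M\<^esub> y"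
  by (simp add: a_minus_def smult_l_minus)

lemma (in Module.module) smult_diff:
  "\<lbrakk>a \<in> carrier R; x \<in> carrier M; y \<in> carrier M\<rbrakk> \<Longrightarrow>
    a \<odot>\<^bsub>M\<^esub> (x \<ominus>\<^bsub>M\<^esub> y) = a \<odot>\<^bsub>M\<^esub> x \<ominus>\<^bsub>M\<^esub> a \<odot>\<^bsub>M\<^esub> y"
  by (simp add: a_minus_def smult_r_distr smult_r_minus)

lemma linear_map_diff:
  assumes "linear_map K V W f" "linear_map K V W g"
  shows "linear_map K V W (\<lambda>x. f x \<ominus>\<^bsub>W\<^esub> g x)"
proof -
  interpret f: linear_map K V W f by fact
  interpret g: linear_map K V W g by fact
  have "linear_map K V W (\<lambda>x. f x \<oplus>\<^bsub>W\<^esub> (\<ominus>\<^bsub>K\<^esub> \<one>\<^bsub>K\<^esub>) \<odot>\<^bsub>W\<^esub> g x)"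
    using assms by (intro linear_map_add linear_map_smult) auto
  then show ?thesis
    by (rule linear_map_cong) (simp add: f.W.diff_eq_smult f.linear_simps g.linear_simps)
qed

text \<open>Negation is multiplication by -1, so closure under it follows from closure under
  scalars.\<close>

lemma (in Module.module) submodule_smultI:
  assumes "H \<subseteq> carrier M" "\<zero>\<^bsub>M\<^esub> \<in> H"
    and "\<And>a b. \<lbrakk>a \<in> H; b \<in> H\<rbrakk> \<Longrightarrow> a \<oplus>\<^bsub>M\<^esub> b \<in> H"
    and "\<And>a x. \<lbrakk>a \<in> carrier R; x \<in> H\<rbrakk> \<Longrightarrow> a \<odot>\<^bsub>M\<^esub> x \<in> H"
  shows "submodule H R M"
proof (rule submoduleI)
  fix x assume "x \<in> H"
  then have "\<ominus>\<^bsub>M\<^esub> x = (\<ominus> \<one>) \<odot>\<^bsub>M\<^esub> x"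
    using assms(1) by (auto simp: smult_l_minus subset_iff)
  then show "\<ominus>\<^bsub>M\<^esub> x \<in> H" using \<open>x \<in> H\<close> assms(4) by simp
qed (use assms in auto)

lemma (in linear_map) submodule_image: "submodule (f ` carrier V) K W"
proof (rule W.submodule_smultI)
  show "\<zero>\<^bsub>W\<^esub> \<in> f ` carrier V" using map_zero by force
next
  fix a b assume "a \<in> f ` carrier V" "b \<in> f ` carrier V"
  then obtain x y where "x \<in> carrier V" "y \<in> carrier V" "a = f x" "b = f y" by blast
  then show "a \<oplus>\<^bsub>W\<^esub> b \<in> f ` carrier V"
    by (auto simp: linear_add[symmetric])
next
  fix a x assume "a \<in> carrier K" "x \<in> f ` carrier V"
  then show "a \<odot>\<^bsub>W\<^esub> x \<in> f ` carrier V" by (auto simp: linear_smult[symmetric])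
qed (auto simp: linear_closed)

section \<open>Subspaces and quotient spaces\<close>

text \<open>One setting for all quotients that occur: L/H, the first and second cohomology, and
  I/s_d(H).\<close>

locale subspace = V?: Module.module K V + U?: submodule U K V
  for K :: "('k, 'r) ring_scheme" and V :: "('k, 'v) module" and U :: "'v set"
begin

lemma sub_mem: "x \<in> U \<Longrightarrow> x \<in> carrier V"
  using V.submoduleE(1)[OF U.submodule_axioms] by auto

lemma sub_zero: "\<zero>\<^bsub>V\<^esub> \<in> U"
  using U.one_closed by simp

lemma sub_add: "\<lbrakk>x \<in> U; y \<in> U\<rbrakk> \<Longrightarrow> x \<oplus>\<^bsub>V\<^esub> y \<in> U"
  using V.submoduleE(5)[OF U.submodule_axioms] .

lemma sub_neg: "x \<in> U \<Longrightarrow> \<ominus>\<^bsub>V\<^esub> x \<in> U"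
  using V.submoduleE(3)[OF U.submodule_axioms] .

lemma sub_diff: "\<lbrakk>x \<in> U; y \<in> U\<rbrakk> \<Longrightarrow> x \<ominus>\<^bsub>V\<^esub> y \<in> U"
  by (simp add: a_minus_def sub_add sub_neg)

lemma sub_smult: "\<lbrakk>a \<in> carrier K; x \<in> U\<rbrakk> \<Longrightarrow> a \<odot>\<^bsub>V\<^esub> x \<in> U"
  by (rule U.smult_closed)

lemma module_sub: "Module.module K (V\<lparr>carrier := U\<rparr>)"
  using U.submodule_is_module V.module_axioms .

text \<open>Addition and scaling of the sub-record are literally those of \<open>V\<close>, but
  negation is defined through the carrier and has to be compared: the negative taken in
  \<open>V\<close> stays in \<open>U\<close>, and negatives are unique.\<close>

lemma neg_sub: "x \<in> U \<Longrightarrow> \<ominus>\<^bsub>V\<lparr>carrier := U\<rparr>\<^esub> x = \<ominus>\<^bsub>V\<^esub> x"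
proof -
  assume x: "x \<in> U"
  interpret S: Module.module K "V\<lparr>carrier := U\<rparr>" by (rule module_sub)
  show ?thesis
    using x S.M.minus_equality[of "\<ominus>\<^bsub>V\<^esub> x" x] by (simp add: V.M.l_neg sub_mem sub_neg)
qed

lemma diff_sub: "\<lbrakk>x \<in> U; y \<in> U\<rbrakk> \<Longrightarrow> x \<ominus>\<^bsub>V\<lparr>carrier := U\<rparr>\<^esub> y = x \<ominus>\<^bsub>V\<^esub> y"
  by (simp add: a_minus_def neg_sub)

lemma mem_coset_iff: "y \<in> U +>\<^bsub>V\<^esub> x \<longleftrightarrow> (\<exists>u\<in>U. y = u \<oplus>\<^bsub>V\<^esub> x)"
  by (auto simp: a_r_coset_def')

lemma coset_self: "x \<in> carrier V \<Longrightarrow> x \<in> U +>\<^bsub>V\<^esub> x"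
  unfolding mem_coset_iff by (rule bexI[of _ "\<zero>\<^bsub>V\<^esub>"]) (auto simp: sub_zero)

lemma coset_eq_iff:
  assumes "x \<in> carrier V" "y \<in> carrier V"
  shows "U +>\<^bsub>V\<^esub> x = U +>\<^bsub>V\<^esub> y \<longleftrightarrow> (\<exists>u\<in>U. x = u \<oplus>\<^bsub>V\<^esub> y)"
proof
  assume "U +>\<^bsub>V\<^esub> x = U +>\<^bsub>V\<^esub> y"
  then show "\<exists>u\<in>U. x = u \<oplus>\<^bsub>V\<^esub> y"
    using coset_self[OF assms(1)] mem_coset_iff by auto
next
  assume "\<exists>u\<in>U. x = u \<oplus>\<^bsub>V\<^esub> y"
  then obtain u where u: "u \<in> U" "x = u \<oplus>\<^bsub>V\<^esub> y" by blast
  show "U +>\<^bsub>V\<^esub> x = U +>\<^bsub>V\<^esub> y"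
  proof (intro equalityI subsetI)
    fix w assume "w \<in> U +>\<^bsub>V\<^esub> x"
    then obtain v where v: "v \<in> U" "w = v \<oplus>\<^bsub>V\<^esub> x" by (auto simp: mem_coset_iff)
    then have "w = (v \<oplus>\<^bsub>V\<^esub> u) \<oplus>\<^bsub>V\<^esub> y"
      using u assms by (simp add: V.M.a_assoc sub_mem)
    then show "w \<in> U +>\<^bsub>V\<^esub> y" unfolding mem_coset_iff using u v sub_add by blast
  next
    fix w assume "w \<in> U +>\<^bsub>V\<^esub> y"
    then obtain v where v: "v \<in> U" "w = v \<oplus>\<^bsub>V\<^esub> y" by (auto simp: mem_coset_iff)
    then have "w = (v \<ominus>\<^bsub>V\<^esub> u) \<oplus>\<^bsub>V\<^esub> x"
      using u assms by (simp add: V.M.diff_simps V.M.a_ac sub_mem)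
    then show "w \<in> U +>\<^bsub>V\<^esub> x" unfolding mem_coset_iff using u v sub_diff by blast
  qed
qed

lemma coset_eq_self_iff: "x \<in> carrier V \<Longrightarrow> U +>\<^bsub>V\<^esub> x = U \<longleftrightarrow> x \<in> U"
  using coset_eq_iff[of x "\<zero>\<^bsub>V\<^esub>"] sub_mem
  by (metis V.M.a_coset_add_zero V.M.r_zero V.M.zero_closed subsetI)

lemma coset_mem_eq: "\<lbrakk>x \<in> carrier V; y \<in> U +>\<^bsub>V\<^esub> x\<rbrakk> \<Longrightarrow> U +>\<^bsub>V\<^esub> y = U +>\<^bsub>V\<^esub> x"
  using coset_eq_iff sub_mem by (metis V.M.a_closed mem_coset_iff)

lemma coset_mem: "\<lbrakk>x \<in> carrier V; y \<in> U +>\<^bsub>V\<^esub> x\<rbrakk> \<Longrightarrow> y \<in> carrier V"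
  using sub_mem by (auto simp: mem_coset_iff)

lemma quot_carrier: "carrier (quot V U) = (\<lambda>x. U +>\<^bsub>V\<^esub> x) ` carrier V"
  by (auto simp: quot_def A_RCOSETS_def')

lemma quot_zero: "\<zero>\<^bsub>quot V U\<^esub> = U"
  by (simp add: quot_def)

lemma quot_add:
  assumes "x \<in> carrier V" "y \<in> carrier V"
  shows "(U +>\<^bsub>V\<^esub> x) \<oplus>\<^bsub>quot V U\<^esub> (U +>\<^bsub>V\<^esub> y) = U +>\<^bsub>V\<^esub> (x \<oplus>\<^bsub>V\<^esub> y)"
proof -
  have "abelian_subgroup U V"
    using U.subgroup_axioms by (intro abelian_subgroupI3 additive_subgroupI V.M.abelian_group_axioms)
  from abelian_subgroup.a_rcos_sum[OF this assms] show ?thesis by (simp add: quot_def)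
qed

lemma quot_smult:
  assumes "c \<in> carrier K" "x \<in> carrier V"
  shows "c \<odot>\<^bsub>quot V U\<^esub> (U +>\<^bsub>V\<^esub> x) = U +>\<^bsub>V\<^esub> (c \<odot>\<^bsub>V\<^esub> x)"
proof -
  have *: "U +>\<^bsub>V\<^esub> (c \<odot>\<^bsub>V\<^esub> y) = U +>\<^bsub>V\<^esub> (c \<odot>\<^bsub>V\<^esub> x)" if y: "y \<in> U +>\<^bsub>V\<^esub> x" for y
  proof -
    obtain u where u: "u \<in> U" "y = u \<oplus>\<^bsub>V\<^esub> x" using y by (auto simp: mem_coset_iff)
    then have "c \<odot>\<^bsub>V\<^esub> y = c \<odot>\<^bsub>V\<^esub> u \<oplus>\<^bsub>V\<^esub> c \<odot>\<^bsub>V\<^esub> x"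
      using assms by (simp add: sub_mem V.smult_r_distr)
    then show ?thesis using u assms by (subst coset_eq_iff) (auto simp: sub_mem sub_smult)
  qed
  have "(\<Union>y\<in>U +>\<^bsub>V\<^esub> x. U +>\<^bsub>V\<^esub> (c \<odot>\<^bsub>V\<^esub> y)) = U +>\<^bsub>V\<^esub> (c \<odot>\<^bsub>V\<^esub> x)"
    by (rule UN_constant_eq[OF coset_self[OF assms(2)]]) (use * in blast)
  then show ?thesis by (simp add: quot_def)
qed

text \<open>The hypotheses ask only for additivity in each argument and for \<open>U\<close> to
  absorb products from both sides. In this form the lemma covers both L/H and the quotient of the
  idealizer by the graph.\<close>

lemma quot_mult:
  assumes "x \<in> carrier V" "y \<in> carrier V"
    and closed: "\<And>x y. \<lbrakk>x \<in> carrier V; y \<in> carrier V\<rbrakk> \<Longrightarrow> x \<otimes>\<^bsub>V\<^esub> y \<in> carrier V"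
    and add_left: "\<And>u x y. \<lbrakk>u \<in> U; x \<in> carrier V; y \<in> carrier V\<rbrakk> \<Longrightarrow>
      (u \<oplus>\<^bsub>V\<^esub> x) \<otimes>\<^bsub>V\<^esub> y = u \<otimes>\<^bsub>V\<^esub> y \<oplus>\<^bsub>V\<^esub> x \<otimes>\<^bsub>V\<^esub> y"
    and add_right: "\<And>u x y. \<lbrakk>u \<in> U; x \<in> carrier V; y \<in> carrier V\<rbrakk> \<Longrightarrow>
      x \<otimes>\<^bsub>V\<^esub> (u \<oplus>\<^bsub>V\<^esub> y) = x \<otimes>\<^bsub>V\<^esub> u \<oplus>\<^bsub>V\<^esub> x \<otimes>\<^bsub>V\<^esub> y"
    and left: "\<And>u x. \<lbrakk>u \<in> U; x \<in> carrier V\<rbrakk> \<Longrightarrow> u \<otimes>\<^bsub>V\<^esub> x \<in> U"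
    and right: "\<And>u x. \<lbrakk>u \<in> U; x \<in> carrier V\<rbrakk> \<Longrightarrow> x \<otimes>\<^bsub>V\<^esub> u \<in> U"
  shows "(U +>\<^bsub>V\<^esub> x) \<otimes>\<^bsub>quot V U\<^esub> (U +>\<^bsub>V\<^esub> y) = U +>\<^bsub>V\<^esub> (x \<otimes>\<^bsub>V\<^esub> y)"
proof -
  have *: "U +>\<^bsub>V\<^esub> (a \<otimes>\<^bsub>V\<^esub> b) = U +>\<^bsub>V\<^esub> (x \<otimes>\<^bsub>V\<^esub> y)" if ab: "a \<in> U +>\<^bsub>V\<^esub> x" "b \<in> U +>\<^bsub>V\<^esub> y" for a b
  proof -
    obtain u v where u: "u \<in> U" "a = u \<oplus>\<^bsub>V\<^esub> x" and v: "v \<in> U" "b = v \<oplus>\<^bsub>V\<^esub> y"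
      using ab by (auto simp: mem_coset_iff)
    \<comment> \<open>Expanding (u + x)(v + y) leaves xy and two terms with a factor in
      \<open>U\<close>, which are absorbed.\<close>
    have "a \<otimes>\<^bsub>V\<^esub> b = (u \<otimes>\<^bsub>V\<^esub> b \<oplus>\<^bsub>V\<^esub> x \<otimes>\<^bsub>V\<^esub> v) \<oplus>\<^bsub>V\<^esub> x \<otimes>\<^bsub>V\<^esub> y"
      using u v assms(1,2) by (simp add: add_left add_right sub_mem closed V.M.a_ac)
    moreover have "u \<otimes>\<^bsub>V\<^esub> b \<oplus>\<^bsub>V\<^esub> x \<otimes>\<^bsub>V\<^esub> v \<in> U"
      using u v assms(1,2) by (simp add: left right sub_mem sub_add)
    ultimately show ?thesis
      using u v assms(1,2) by (subst coset_eq_iff) (auto simp: closed sub_mem)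
  qed
  have "(\<Union>a\<in>U +>\<^bsub>V\<^esub> x. \<Union>b\<in>U +>\<^bsub>V\<^esub> y. U +>\<^bsub>V\<^esub> (a \<otimes>\<^bsub>V\<^esub> b)) = U +>\<^bsub>V\<^esub> (x \<otimes>\<^bsub>V\<^esub> y)"
    by (intro UN_constant_eq[OF coset_self[OF assms(1)]] UN_constant_eq[OF coset_self[OF assms(2)]] * ballI)
  then show ?thesis by (simp add: quot_def rcoset_mult_def)
qed

lemma quot_cases:
  assumes "X \<in> carrier (quot V U)"
  obtains x where "x \<in> carrier V" "X = U +>\<^bsub>V\<^esub> x"
  using assms by (auto simp: quot_carrier)

lemma quotI: "x \<in> carrier V \<Longrightarrow> U +>\<^bsub>V\<^esub> x \<in> carrier (quot V U)"
  by (simp add: quot_carrier)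

lemma quot_abelian_group: "abelian_group (quot V U)"
proof (rule abelian_groupI)
  fix X assume "X \<in> carrier (quot V U)"
  then obtain x where x: "x \<in> carrier V" "X = U +>\<^bsub>V\<^esub> x" by (rule quot_cases)
  show "\<zero>\<^bsub>quot V U\<^esub> \<oplus>\<^bsub>quot V U\<^esub> X = X"
    using x quot_add[of "\<zero>\<^bsub>V\<^esub>" x] by (simp add: quot_zero sub_mem subsetI)
  show "\<exists>Y\<in>carrier (quot V U). Y \<oplus>\<^bsub>quot V U\<^esub> X = \<zero>\<^bsub>quot V U\<^esub>"
    using x by (intro bexI[of _ "U +>\<^bsub>V\<^esub> (\<ominus>\<^bsub>V\<^esub> x)"])
      (auto simp: quot_add quotI quot_zero V.M.l_neg sub_mem subsetI)
next
  show "\<zero>\<^bsub>quot V U\<^esub> \<in> carrier (quot V U)"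
    using quotI[of "\<zero>\<^bsub>V\<^esub>"] by (simp add: quot_zero sub_mem subsetI)
next
  fix X Y assume "X \<in> carrier (quot V U)" "Y \<in> carrier (quot V U)"
  then show "X \<oplus>\<^bsub>quot V U\<^esub> Y \<in> carrier (quot V U)"
    by (elim quot_cases) (simp add: quot_add quotI)
next
  fix X Y assume "X \<in> carrier (quot V U)" "Y \<in> carrier (quot V U)"
  then show "X \<oplus>\<^bsub>quot V U\<^esub> Y = Y \<oplus>\<^bsub>quot V U\<^esub> X"
    by (elim quot_cases) (simp add: quot_add V.M.a_comm)
next
  fix X Y Z assume "X \<in> carrier (quot V U)" "Y \<in> carrier (quot V U)" "Z \<in> carrier (quot V U)"
  then show "X \<oplus>\<^bsub>quot V U\<^esub> Y \<oplus>\<^bsub>quot V U\<^esub> Z = X \<oplus>\<^bsub>quot V U\<^esub> (Y \<oplus>\<^bsub>quot V U\<^esub> Z)"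
    by (elim quot_cases) (simp add: quot_add V.M.a_assoc)
qed

lemma module_quot: "Module.module K (quot V U)"
  by (rule moduleI[OF V.R.is_cring quot_abelian_group]; (elim quot_cases)?)
    (simp_all add: quot_add quot_smult quotI V.smult_l_distr V.smult_r_distr V.smult_assoc1)

lemma linear_map_coset: "linear_map K V (quot V U) (\<lambda>x. U +>\<^bsub>V\<^esub> x)"
  by (rule linear_mapI) (auto simp: V.module_axioms module_quot quotI quot_add quot_smult)

lemma quot_diff:
  "\<lbrakk>x \<in> carrier V; y \<in> carrier V\<rbrakk> \<Longrightarrow>
    (U +>\<^bsub>V\<^esub> x) \<ominus>\<^bsub>quot V U\<^esub> (U +>\<^bsub>V\<^esub> y) = U +>\<^bsub>V\<^esub> (x \<ominus>\<^bsub>V\<^esub> y)"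
  using linear_map.map_diff[OF linear_map_coset] by metis

text \<open>A linear map that kills \<open>U\<close> is constant on cosets, so the image of a coset
  is a singleton. \<open>quot_act\<close>, the projection of I/s_d(H) onto L/H and the three maps of
  the sequence are all evaluated through this fact.\<close>

lemma induced_map_coset:
  assumes "linear_map K V W f" "\<And>u. u \<in> U \<Longrightarrow> f u = \<zero>\<^bsub>W\<^esub>" "x \<in> carrier V"
  shows "the_elem (f ` (U +>\<^bsub>V\<^esub> x)) = f x"
proof -
  interpret f: linear_map K V W f by fact
  have "f y = f x" if "y \<in> U +>\<^bsub>V\<^esub> x" for y
    using that assms by (auto simp: mem_coset_iff f.linear_simps sub_mem)
  then show ?thesis using coset_self[OF assms(3)] by (intro the_elem_image_unique) blast+
qed

lemma linear_induced_map:
  assumes "linear_map K V W f" "\<And>u. u \<in> U \<Longrightarrow> f u = \<zero>\<^bsub>W\<^esub>"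
  shows "linear_map K (quot V U) W (\<lambda>X. the_elem (f ` X))"
proof -
  interpret f: linear_map K V W f by fact
  show ?thesis
    by (rule linear_mapI; (elim quot_cases)?)
      (simp_all add: f.W.module_axioms module_quot quot_add quot_smult
        induced_map_coset[OF assms] f.linear_simps)
qed

end

section \<open>Kernels and linear sections\<close>

lemma a_kernel_eq: "a_kernel A B f = {x \<in> carrier A. f x = \<zero>\<^bsub>B\<^esub>}"
  by (simp add: a_kernel_def')

text \<open>By Zorn's lemma the kernel of \<open>p\<close> has a linear complement, on which \<open>p\<close> is inverted.\<close>

lemma ex_linear_section:
  fixes K :: "('k, 'r) ring_scheme" and V :: "('k, 'v, 'a) module_scheme" and W :: "('k, 'w, 'b) module_scheme"
  assumes "Ring.field K" "linear_map K V W p" "p ` carrier V = carrier W"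
  shows "\<exists>s. linear_map K W V s \<and> (\<forall>x\<in>carrier W. p (s x) = x)"
proof -
  interpret K: Ring.field K by fact
  interpret p: linear_map K V W p by fact
  \<comment> \<open>These are the subspaces on which \<open>p\<close> is injective; a maximal one
    turns out to be a complement of the kernel.\<close>
  define S where "S = {C. submodule C K V \<and> (\<forall>x\<in>C. p x = \<zero>\<^bsub>W\<^esub> \<longrightarrow> x = \<zero>\<^bsub>V\<^esub>)}"
  note subE = p.V.submoduleE
  have "submodule {\<zero>\<^bsub>V\<^esub>} K V" by (rule p.V.submodule_smultI) auto
  then have "{\<zero>\<^bsub>V\<^esub>} \<in> S" by (auto simp: S_def)
  have "\<exists>C\<in>S. \<forall>X\<in>S. C \<subseteq> X \<longrightarrow> X = C"
  proof (rule subset_Zorn_nonempty)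
    show "S \<noteq> {}" using \<open>{\<zero>\<^bsub>V\<^esub>} \<in> S\<close> by blast
    fix \<C> assume C: "\<C> \<noteq> {}" "subset.chain S \<C>"
    then have sub: "\<C> \<subseteq> S" and lin: "\<And>A B. \<lbrakk>A \<in> \<C>; B \<in> \<C>\<rbrakk> \<Longrightarrow> A \<subseteq> B \<or> B \<subseteq> A"
      by (auto simp: subset_chain_def)
    have sm: "A \<in> \<C> \<Longrightarrow> submodule A K V" for A using sub by (auto simp: S_def)
    have "submodule (\<Union>\<C>) K V"
    proof (rule p.V.submodule_smultI)
      show "\<Union>\<C> \<subseteq> carrier V" using subE(1)[OF sm] by blast
      obtain A where "A \<in> \<C>" using C by blast
      then have "\<zero>\<^bsub>V\<^esub> \<in> A" using subgroup.one_closed[OF submodule.axioms(1)[OF sm]] by force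
      then show "\<zero>\<^bsub>V\<^esub> \<in> \<Union>\<C>" using \<open>A \<in> \<C>\<close> by blast
    next
      fix a b assume "a \<in> \<Union>\<C>" "b \<in> \<Union>\<C>"
      then obtain A B where AB: "A \<in> \<C>" "B \<in> \<C>" "a \<in> A" "b \<in> B" by blast
      then show "a \<oplus>\<^bsub>V\<^esub> b \<in> \<Union>\<C>"
        using lin[OF AB(1,2)] subE(5)[OF sm[OF AB(1)]] subE(5)[OF sm[OF AB(2)]] by blast
    next
      fix a x assume "a \<in> carrier K" "x \<in> \<Union>\<C>"
      then show "a \<odot>\<^bsub>V\<^esub> x \<in> \<Union>\<C>" using subE(4)[OF sm] by blast
    qed
    then show "\<Union>\<C> \<in> S" using sub by (auto simp: S_def)
  qed
  then obtain C where C: "C \<in> S" and max: "\<And>X. \<lbrakk>X \<in> S; C \<subseteq> X\<rbrakk> \<Longrightarrow> X = C" by blast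
  have sm: "submodule C K V" and inj0: "\<And>x. \<lbrakk>x \<in> C; p x = \<zero>\<^bsub>W\<^esub>\<rbrakk> \<Longrightarrow> x = \<zero>\<^bsub>V\<^esub>"
    using C by (auto simp: S_def)
  have Cc: "\<And>x. x \<in> C \<Longrightarrow> x \<in> carrier V" using subE(1)[OF sm] by blast
  have C0: "\<zero>\<^bsub>V\<^esub> \<in> C" using subgroup.one_closed[OF submodule.axioms(1)[OF sm]] by force
  note Cadd = subE(5)[OF sm] and Csm = subE(4)[OF sm] and Cneg = subE(3)[OF sm]
  have surj: "\<exists>c\<in>C. p c = p v" if v: "v \<in> carrier V" for v
  proof (rule ccontr)
    assume no: "\<not> (\<exists>c\<in>C. p c = p v)"
    \<comment> \<open>If \<open>C\<close> missed the value \<open>p v\<close>, adjoining the line of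
      \<open>v\<close> would give a larger member of \<open>S\<close>, against maximality.\<close>
    define C' where "C' = {c \<oplus>\<^bsub>V\<^esub> a \<odot>\<^bsub>V\<^esub> v |c a. c \<in> C \<and> a \<in> carrier K}"
    have inC': "c \<oplus>\<^bsub>V\<^esub> a \<odot>\<^bsub>V\<^esub> v \<in> C'" if "c \<in> C" "a \<in> carrier K" for c a
      using that by (auto simp: C'_def)
    have "C \<subseteq> C'" using inC'[of _ "\<zero>\<^bsub>K\<^esub>"] v Cc by force
    have "v \<in> C'" using inC'[of "\<zero>\<^bsub>V\<^esub>" "\<one>\<^bsub>K\<^esub>"] v C0 by simp
    have "submodule C' K V"
    proof (rule p.V.submodule_smultI)
      show "C' \<subseteq> carrier V" using v Cc by (auto simp: C'_def)
      show "\<zero>\<^bsub>V\<^esub> \<in> C'" using C0 \<open>C \<subseteq> C'\<close> by blast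
    next
      fix x y assume "x \<in> C'" "y \<in> C'"
      then obtain c a c' a' where *: "c \<in> C" "a \<in> carrier K" "c' \<in> C" "a' \<in> carrier K"
        "x = c \<oplus>\<^bsub>V\<^esub> a \<odot>\<^bsub>V\<^esub> v" "y = c' \<oplus>\<^bsub>V\<^esub> a' \<odot>\<^bsub>V\<^esub> v" by (auto simp: C'_def)
      then have "x \<oplus>\<^bsub>V\<^esub> y = (c \<oplus>\<^bsub>V\<^esub> c') \<oplus>\<^bsub>V\<^esub> (a \<oplus>\<^bsub>K\<^esub> a') \<odot>\<^bsub>V\<^esub> v"
        using v Cc by (simp add: p.V.smult_l_distr p.V.M.a_ac)
      then show "x \<oplus>\<^bsub>V\<^esub> y \<in> C'" using * Cadd by (auto intro: inC')
    next
      fix b x assume b: "b \<in> carrier K" and "x \<in> C'"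
      then obtain c a where *: "c \<in> C" "a \<in> carrier K" "x = c \<oplus>\<^bsub>V\<^esub> a \<odot>\<^bsub>V\<^esub> v"
        by (auto simp: C'_def)
      then have "b \<odot>\<^bsub>V\<^esub> x = b \<odot>\<^bsub>V\<^esub> c \<oplus>\<^bsub>V\<^esub> (b \<otimes>\<^bsub>K\<^esub> a) \<odot>\<^bsub>V\<^esub> v"
        using v Cc b by (simp add: p.V.smult_r_distr p.V.smult_assoc1)
      then show "b \<odot>\<^bsub>V\<^esub> x \<in> C'" using * b Csm by (auto intro: inC')
    qed
    moreover have "x = \<zero>\<^bsub>V\<^esub>" if x: "x \<in> C'" "p x = \<zero>\<^bsub>W\<^esub>" for x
    proof -
      obtain c a where *: "c \<in> C" "a \<in> carrier K" "x = c \<oplus>\<^bsub>V\<^esub> a \<odot>\<^bsub>V\<^esub> v"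
        using x by (auto simp: C'_def)
      show ?thesis
      proof (cases "a = \<zero>\<^bsub>K\<^esub>")
        case True
        then have "x = c" using * v Cc by simp
        then show ?thesis using inj0 * x by simp
      next
        case False
        \<comment> \<open>Dividing the relation p c + a p v = 0 by \<open>a\<close> exhibits
          \<open>p v\<close> as the image of an element of \<open>C\<close>, contrary to
          \<open>no\<close>.\<close>
        then have a: "a \<in> Units K" using * K.field_Units by simp
        define i where "i = inv\<^bsub>K\<^esub> a"
        have i: "i \<in> carrier K" "i \<otimes>\<^bsub>K\<^esub> a = \<one>\<^bsub>K\<^esub>" using a by (auto simp: i_def)
        have "p c \<oplus>\<^bsub>W\<^esub> a \<odot>\<^bsub>W\<^esub> p v = \<zero>\<^bsub>W\<^esub>"
          using x * v Cc by (simp add: p.linear_simps)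
        then have "i \<odot>\<^bsub>W\<^esub> (p c \<oplus>\<^bsub>W\<^esub> a \<odot>\<^bsub>W\<^esub> p v) = \<zero>\<^bsub>W\<^esub>" using i by simp
        then have "i \<odot>\<^bsub>W\<^esub> p c \<oplus>\<^bsub>W\<^esub> p v = \<zero>\<^bsub>W\<^esub>"
          using i * v Cc
          by (simp add: p.W.smult_r_distr p.linear_simps p.W.smult_assoc1[symmetric])
        then have "p v = p (\<ominus>\<^bsub>V\<^esub> (i \<odot>\<^bsub>V\<^esub> c))"
          using i * v Cc p.W.M.minus_equality[of "p v" "i \<odot>\<^bsub>W\<^esub> p c"]
          by (simp add: p.linear_simps p.W.M.a_comm)
        then show ?thesis using no i * Csm Cneg by metis
      qed
    qed
    ultimately have "C' \<in> S" by (auto simp: S_def)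
    then have "v \<in> C" using max \<open>C \<subseteq> C'\<close> \<open>v \<in> C'\<close> by blast
    then show False using no by blast
  qed
  have inj: "x = y" if "x \<in> C" "y \<in> C" "p x = p y" for x y
  proof -
    have "p (x \<oplus>\<^bsub>V\<^esub> \<ominus>\<^bsub>V\<^esub> y) = \<zero>\<^bsub>W\<^esub>"
      using that Cc by (simp add: p.linear_simps p.W.M.r_neg)
    then have "x \<ominus>\<^bsub>V\<^esub> y = \<zero>\<^bsub>V\<^esub>"
      unfolding a_minus_def using that Cadd Cneg by (intro inj0) auto
    then show ?thesis using that Cc by (simp add: p.V.M.diff_simps)
  qed
  have "\<exists>s. \<forall>w\<in>carrier W. s w \<in> C \<and> p (s w) = w"
    using assms(3) surj by (intro bchoice) (metis image_iff)
  then obtain s where s: "\<And>w. w \<in> carrier W \<Longrightarrow> s w \<in> C" "\<And>w. w \<in> carrier W \<Longrightarrow> p (s w) = w"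
    by blast
  \<comment> \<open>Both sides of each linearity equation lie in \<open>C\<close> and have the same
    image under \<open>p\<close>, so \<open>inj\<close> identifies them.\<close>
  have "linear_map K W V s"
    by (rule linear_mapI)
      (auto intro!: inj simp: p.V.module_axioms p.W.module_axioms Cc Cadd Csm s p.linear_simps)
  then show ?thesis using s by blast
qed

section \<open>Lie algebras and modules\<close>

context lie_algebra
begin

lemma bracket_closed: "\<lbrakk>x \<in> carrier L; y \<in> carrier L\<rbrakk> \<Longrightarrow> x \<otimes>\<^bsub>L\<^esub> y \<in> carrier L"
  using linear_map.linear_closed[OF bracket_linear_right] .

lemma bracket_add_right:
  "\<lbrakk>x \<in> carrier L; y \<in> carrier L; z \<in> carrier L\<rbrakk> \<Longrightarrow>
    x \<otimes>\<^bsub>L\<^esub> (y \<oplus>\<^bsub>L\<^esub> z) = x \<otimes>\<^bsub>L\<^esub> y \<oplus>\<^bsub>L\<^esub> x \<otimes>\<^bsub>L\<^esub> z"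
  using linear_map.linear_add[OF bracket_linear_right] .

lemma bracket_add_left:
  "\<lbrakk>x \<in> carrier L; y \<in> carrier L; z \<in> carrier L\<rbrakk> \<Longrightarrow>
    (x \<oplus>\<^bsub>L\<^esub> y) \<otimes>\<^bsub>L\<^esub> z = x \<otimes>\<^bsub>L\<^esub> z \<oplus>\<^bsub>L\<^esub> y \<otimes>\<^bsub>L\<^esub> z"
  using linear_map.linear_add[OF bracket_linear_left] .

lemma bracket_diff_right:
  "\<lbrakk>x \<in> carrier L; y \<in> carrier L; z \<in> carrier L\<rbrakk> \<Longrightarrow>
    x \<otimes>\<^bsub>L\<^esub> (y \<ominus>\<^bsub>L\<^esub> z) = x \<otimes>\<^bsub>L\<^esub> y \<ominus>\<^bsub>L\<^esub> x \<otimes>\<^bsub>L\<^esub> z"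
  using linear_map.map_diff[OF bracket_linear_right] .

lemma bracket_diff_left:
  "\<lbrakk>x \<in> carrier L; y \<in> carrier L; z \<in> carrier L\<rbrakk> \<Longrightarrow>
    (x \<ominus>\<^bsub>L\<^esub> y) \<otimes>\<^bsub>L\<^esub> z = x \<otimes>\<^bsub>L\<^esub> z \<ominus>\<^bsub>L\<^esub> y \<otimes>\<^bsub>L\<^esub> z"
  using linear_map.map_diff[OF bracket_linear_left] .

lemma bracket_smult_right:
  "\<lbrakk>a \<in> carrier K; x \<in> carrier L; y \<in> carrier L\<rbrakk> \<Longrightarrow>
    x \<otimes>\<^bsub>L\<^esub> (a \<odot>\<^bsub>L\<^esub> y) = a \<odot>\<^bsub>L\<^esub> (x \<otimes>\<^bsub>L\<^esub> y)"
  using linear_map.linear_smult[OF bracket_linear_right] .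

lemma bracket_smult_left:
  "\<lbrakk>a \<in> carrier K; x \<in> carrier L; y \<in> carrier L\<rbrakk> \<Longrightarrow>
    (a \<odot>\<^bsub>L\<^esub> x) \<otimes>\<^bsub>L\<^esub> y = a \<odot>\<^bsub>L\<^esub> (x \<otimes>\<^bsub>L\<^esub> y)"
  using linear_map.linear_smult[OF bracket_linear_left] .

lemmas bracket_simps = bracket_closed bracket_add_right bracket_add_left bracket_diff_right
  bracket_diff_left bracket_smult_right bracket_smult_left

text \<open>Polarisation of the alternating law: expand [x + y, x + y] = 0.\<close>

lemma bracket_antisym:
  assumes "x \<in> carrier L" "y \<in> carrier L"
  shows "y \<otimes>\<^bsub>L\<^esub> x = \<ominus>\<^bsub>L\<^esub> (x \<otimes>\<^bsub>L\<^esub> y)"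
proof -
  have "(x \<oplus>\<^bsub>L\<^esub> y) \<otimes>\<^bsub>L\<^esub> (x \<oplus>\<^bsub>L\<^esub> y) = \<zero>\<^bsub>L\<^esub>"
    using assms by (intro bracket_alternating) simp
  then have "y \<otimes>\<^bsub>L\<^esub> x \<oplus>\<^bsub>L\<^esub> x \<otimes>\<^bsub>L\<^esub> y = \<zero>\<^bsub>L\<^esub>"
    using assms bracket_alternating[of x] bracket_alternating[of y]
    by (simp add: bracket_simps L.M.a_comm)
  then show ?thesis
    using assms by (intro L.M.minus_equality[symmetric]) (auto simp: bracket_closed)
qed

text \<open>Jacobi with two of its brackets turned around by antisymmetry: bracketing with
  \<open>x\<close> is a derivation of the Lie algebra.\<close>

lemma bracket_leibniz:
  assumes "x \<in> carrier L" "y \<in> carrier L" "z \<in> carrier L"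
  shows "x \<otimes>\<^bsub>L\<^esub> (y \<otimes>\<^bsub>L\<^esub> z) = (x \<otimes>\<^bsub>L\<^esub> y) \<otimes>\<^bsub>L\<^esub> z \<oplus>\<^bsub>L\<^esub> y \<otimes>\<^bsub>L\<^esub> (x \<otimes>\<^bsub>L\<^esub> z)"
proof -
  have "z \<otimes>\<^bsub>L\<^esub> x = \<ominus>\<^bsub>L\<^esub> (x \<otimes>\<^bsub>L\<^esub> z)" "z \<otimes>\<^bsub>L\<^esub> (x \<otimes>\<^bsub>L\<^esub> y) = \<ominus>\<^bsub>L\<^esub> ((x \<otimes>\<^bsub>L\<^esub> y) \<otimes>\<^bsub>L\<^esub> z)"
    using assms by (intro bracket_antisym bracket_closed; simp)+
  moreover have "y \<otimes>\<^bsub>L\<^esub> (\<ominus>\<^bsub>L\<^esub> (x \<otimes>\<^bsub>L\<^esub> z)) = \<ominus>\<^bsub>L\<^esub> (y \<otimes>\<^bsub>L\<^esub> (x \<otimes>\<^bsub>L\<^esub> z))"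
    using assms by (intro linear_map.map_neg[OF bracket_linear_right] bracket_closed)
  ultimately have "x \<otimes>\<^bsub>L\<^esub> (y \<otimes>\<^bsub>L\<^esub> z) \<oplus>\<^bsub>L\<^esub> \<ominus>\<^bsub>L\<^esub> (y \<otimes>\<^bsub>L\<^esub> (x \<otimes>\<^bsub>L\<^esub> z)) \<oplus>\<^bsub>L\<^esub> \<ominus>\<^bsub>L\<^esub> ((x \<otimes>\<^bsub>L\<^esub> y) \<otimes>\<^bsub>L\<^esub> z) = \<zero>\<^bsub>L\<^esub>"
    using jacobi[OF assms] by simp
  then show ?thesis
    using assms by (simp add: bracket_closed L.M.diff_simps L.M.a_ac)
qed

lemma bracket_jacobi_left:
  assumes "x \<in> carrier L" "y \<in> carrier L" "z \<in> carrier L"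
  shows "(x \<otimes>\<^bsub>L\<^esub> y) \<otimes>\<^bsub>L\<^esub> z = x \<otimes>\<^bsub>L\<^esub> (y \<otimes>\<^bsub>L\<^esub> z) \<ominus>\<^bsub>L\<^esub> y \<otimes>\<^bsub>L\<^esub> (x \<otimes>\<^bsub>L\<^esub> z)"
  using bracket_leibniz[OF assms] assms by (simp add: bracket_closed L.M.diff_simps)

text \<open>The negative of the Jacobi identity, in the shape in which triple brackets occur in the
  2-cocycle condition.\<close>

lemma jacobi_left:
  assumes "x \<in> carrier L" "y \<in> carrier L" "z \<in> carrier L"
  shows "(x \<otimes>\<^bsub>L\<^esub> y) \<otimes>\<^bsub>L\<^esub> z \<oplus>\<^bsub>L\<^esub> (y \<otimes>\<^bsub>L\<^esub> z) \<otimes>\<^bsub>L\<^esub> x \<oplus>\<^bsub>L\<^esub> (z \<otimes>\<^bsub>L\<^esub> x) \<otimes>\<^bsub>L\<^esub> y = \<zero>\<^bsub>L\<^esub>"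
proof -
  have "\<ominus>\<^bsub>L\<^esub> (x \<otimes>\<^bsub>L\<^esub> (y \<otimes>\<^bsub>L\<^esub> z) \<oplus>\<^bsub>L\<^esub> y \<otimes>\<^bsub>L\<^esub> (z \<otimes>\<^bsub>L\<^esub> x) \<oplus>\<^bsub>L\<^esub> z \<otimes>\<^bsub>L\<^esub> (x \<otimes>\<^bsub>L\<^esub> y)) = \<zero>\<^bsub>L\<^esub>"
    using jacobi[OF assms] by simp
  then show ?thesis
    using assms bracket_antisym[of z "x \<otimes>\<^bsub>L\<^esub> y"] bracket_antisym[of x "y \<otimes>\<^bsub>L\<^esub> z"]
      bracket_antisym[of y "z \<otimes>\<^bsub>L\<^esub> x"]
    by (simp add: bracket_closed L.M.minus_add L.M.a_ac)
qed

end

context lie_module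
begin

lemma act_closed: "\<lbrakk>x \<in> carrier L; n \<in> carrier N\<rbrakk> \<Longrightarrow> act x n \<in> carrier N"
  using linear_map.linear_closed[OF act_linear_right] .

lemma act_add_right:
  "\<lbrakk>x \<in> carrier L; m \<in> carrier N; n \<in> carrier N\<rbrakk> \<Longrightarrow>
    act x (m \<oplus>\<^bsub>N\<^esub> n) = act x m \<oplus>\<^bsub>N\<^esub> act x n"
  using linear_map.linear_add[OF act_linear_right] .

lemma act_add_left:
  "\<lbrakk>x \<in> carrier L; y \<in> carrier L; n \<in> carrier N\<rbrakk> \<Longrightarrow>
    act (x \<oplus>\<^bsub>L\<^esub> y) n = act x n \<oplus>\<^bsub>N\<^esub> act y n"
  using linear_map.linear_add[OF act_linear_left] .

lemma act_diff_right:
  "\<lbrakk>x \<in> carrier L; m \<in> carrier N; n \<in> carrier N\<rbrakk> \<Longrightarrow>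
    act x (m \<ominus>\<^bsub>N\<^esub> n) = act x m \<ominus>\<^bsub>N\<^esub> act x n"
  using linear_map.map_diff[OF act_linear_right] .

lemma act_diff_left:
  "\<lbrakk>x \<in> carrier L; y \<in> carrier L; n \<in> carrier N\<rbrakk> \<Longrightarrow>
    act (x \<ominus>\<^bsub>L\<^esub> y) n = act x n \<ominus>\<^bsub>N\<^esub> act y n"
  using linear_map.map_diff[OF act_linear_left] .

lemma act_smult_right:
  "\<lbrakk>a \<in> carrier K; x \<in> carrier L; n \<in> carrier N\<rbrakk> \<Longrightarrow>
    act x (a \<odot>\<^bsub>N\<^esub> n) = a \<odot>\<^bsub>N\<^esub> act x n"
  using linear_map.linear_smult[OF act_linear_right] .

lemma act_smult_left:
  "\<lbrakk>a \<in> carrier K; x \<in> carrier L; n \<in> carrier N\<rbrakk> \<Longrightarrow>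
    act (a \<odot>\<^bsub>L\<^esub> x) n = a \<odot>\<^bsub>N\<^esub> act x n"
  using linear_map.linear_smult[OF act_linear_left] .

lemma act_zero_right: "x \<in> carrier L \<Longrightarrow> act x \<zero>\<^bsub>N\<^esub> = \<zero>\<^bsub>N\<^esub>"
  using linear_map.map_zero[OF act_linear_right] .

lemma act_zero_left: "n \<in> carrier N \<Longrightarrow> act \<zero>\<^bsub>L\<^esub> n = \<zero>\<^bsub>N\<^esub>"
  using linear_map.map_zero[OF act_linear_left] .

lemmas act_simps = act_closed act_add_right act_add_left act_diff_right act_diff_left
  act_smult_right act_smult_left act_zero_right act_zero_left

end

section \<open>Spaces of functions\<close>

lemma fun_space_sel:
  "carrier (fun_space A V) = A \<rightarrow>\<^sub>E carrier V"
  "\<zero>\<^bsub>fun_space A V\<^esub> = (\<lambda>x\<in>A. \<zero>\<^bsub>V\<^esub>)"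
  "f \<oplus>\<^bsub>fun_space A V\<^esub> g = (\<lambda>x\<in>A. f x \<oplus>\<^bsub>V\<^esub> g x)"
  "c \<odot>\<^bsub>fun_space A V\<^esub> f = (\<lambda>x\<in>A. c \<odot>\<^bsub>V\<^esub> f x)"
  by (simp_all add: fun_space_def)

lemma module_fun_space:
  assumes "Module.module K V"
  shows "Module.module K (fun_space A V)"
proof -
  interpret V: Module.module K V by fact
  have ag: "abelian_group (fun_space A V)"
  proof (rule abelian_groupI)
    fix f assume f: "f \<in> carrier (fun_space A V)"
    then have fx: "\<And>x. x \<in> A \<Longrightarrow> f x \<in> carrier V"
      by (auto simp: fun_space_sel)
    show "\<exists>g\<in>carrier (fun_space A V). g \<oplus>\<^bsub>fun_space A V\<^esub> f = \<zero>\<^bsub>fun_space A V\<^esub>"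
      by (intro bexI[of _ "\<lambda>x\<in>A. \<ominus>\<^bsub>V\<^esub> f x"])
        (auto simp: fun_space_sel fun_eq_iff V.M.l_neg fx)
    show "\<zero>\<^bsub>fun_space A V\<^esub> \<oplus>\<^bsub>fun_space A V\<^esub> f = f"
    proof (rule ext)
      fix x show "(\<zero>\<^bsub>fun_space A V\<^esub> \<oplus>\<^bsub>fun_space A V\<^esub> f) x = f x"
        using f fx[of x] by (cases "x \<in> A") (auto simp: fun_space_sel PiE_iff extensional_def)
    qed
  next
    fix f g h assume "f \<in> carrier (fun_space A V)" "g \<in> carrier (fun_space A V)"
      "h \<in> carrier (fun_space A V)"
    then show "f \<oplus>\<^bsub>fun_space A V\<^esub> g \<oplus>\<^bsub>fun_space A V\<^esub> h =
        f \<oplus>\<^bsub>fun_space A V\<^esub> (g \<oplus>\<^bsub>fun_space A V\<^esub> h)"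
      by (auto simp: fun_space_sel fun_eq_iff PiE_iff V.M.a_assoc)
  next
    fix f g assume "f \<in> carrier (fun_space A V)" "g \<in> carrier (fun_space A V)"
    then show "f \<oplus>\<^bsub>fun_space A V\<^esub> g = g \<oplus>\<^bsub>fun_space A V\<^esub> f"
      by (auto simp: fun_space_sel fun_eq_iff PiE_iff V.M.a_comm)
  qed (auto simp: fun_space_sel PiE_iff)
  show ?thesis
  proof (rule moduleI[OF V.R.is_cring ag])
    fix f assume "f \<in> carrier (fun_space A V)"
    then show "\<one>\<^bsub>K\<^esub> \<odot>\<^bsub>fun_space A V\<^esub> f = f"
      by (auto simp: fun_space_sel fun_eq_iff PiE_iff extensional_def)
  qed (auto simp: fun_space_sel fun_eq_iff PiE_iff V.smult_l_distr V.smult_r_distr V.smult_assoc1)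
qed

section \<open>Cochains in low degree\<close>

text \<open>Instantiated below for L acting on M, for H acting on M and for L/H acting on M^H. The
  types are plain \<open>module\<close> records because \<open>Der\<close> and
  \<open>cocycles2\<close> are defined on these.\<close>

locale lie_cohomology = lie_module K L N act
  for K :: "('k, 'r) ring_scheme" and L :: "('k, 'l) module" and N :: "('k, 'n) module"
    and act :: "'l \<Rightarrow> 'n \<Rightarrow> 'n"
begin

lemma Der_sel:
  "\<zero>\<^bsub>Der K L N act\<^esub> = (\<lambda>x\<in>carrier L. \<zero>\<^bsub>N\<^esub>)"
  "f \<oplus>\<^bsub>Der K L N act\<^esub> g = (\<lambda>x\<in>carrier L. f x \<oplus>\<^bsub>N\<^esub> g x)"
  "c \<odot>\<^bsub>Der K L N act\<^esub> f = (\<lambda>x\<in>carrier L. c \<odot>\<^bsub>N\<^esub> f x)"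
  by (simp_all add: Der_def fun_space_sel)

lemma DerD:
  assumes "d \<in> carrier (Der K L N act)"
  shows "d \<in> extensional (carrier L)" "linear_map K L N d"
    "\<And>x y. \<lbrakk>x \<in> carrier L; y \<in> carrier L\<rbrakk> \<Longrightarrow>
      d (x \<otimes>\<^bsub>L\<^esub> y) = act x (d y) \<ominus>\<^bsub>N\<^esub> act y (d x)"
  using assms by (auto simp: Der_def PiE_iff)

lemma DerI:
  assumes "linear_map K L N d"
    and "\<And>x y. \<lbrakk>x \<in> carrier L; y \<in> carrier L\<rbrakk> \<Longrightarrow>
      d (x \<otimes>\<^bsub>L\<^esub> y) = act x (d y) \<ominus>\<^bsub>N\<^esub> act y (d x)"
  shows "restrict d (carrier L) \<in> carrier (Der K L N act)"
  using assms linear_map.linear_closed[OF assms(1)]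
  by (auto simp: Der_def bracket_closed intro: linear_map_cong[OF assms(1)])

text \<open>Derivations, like the 2-cocycles below, inherit the vector space axioms from the space
  of all functions, so that only closure has to be checked.\<close>

lemma submodule_Der: "submodule (carrier (Der K L N act)) K (fun_space (carrier L) N)"
proof -
  interpret F: Module.module K "fun_space (carrier L) N"
    by (rule module_fun_space[OF N.module_axioms])
  show ?thesis
  proof (rule F.submodule_smultI)
    show "carrier (Der K L N act) \<subseteq> carrier (fun_space (carrier L) N)"
      by (auto simp: Der_def fun_space_sel)
    show "\<zero>\<^bsub>fun_space (carrier L) N\<^esub> \<in> carrier (Der K L N act)"
      unfolding fun_space_sel
      by (rule DerI) (auto intro!: linear_mapI simp: L.module_axioms N.module_axioms act_simps N.M.diff_self)
  next
    fix d e assume "d \<in> carrier (Der K L N act)" "e \<in> carrier (Der K L N act)"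
    note d = DerD[OF this(1)] and e = DerD[OF this(2)]
    interpret d: linear_map K L N d by fact
    interpret e: linear_map K L N e by fact
    show "d \<oplus>\<^bsub>fun_space (carrier L) N\<^esub> e \<in> carrier (Der K L N act)"
      unfolding fun_space_sel using d(2) e(2)
      by (intro DerI linear_map_add)
        (auto simp: d(3) e(3) act_simps d.linear_simps e.linear_simps N.M.diff_simps N.M.a_ac)
  next
    fix a d assume a: "a \<in> carrier K" and "d \<in> carrier (Der K L N act)"
    note d = DerD[OF this(2)]
    interpret d: linear_map K L N d by fact
    show "a \<odot>\<^bsub>fun_space (carrier L) N\<^esub> d \<in> carrier (Der K L N act)"
      unfolding fun_space_sel using d(2) a
      by (intro DerI linear_map_smult)
        (auto simp: d(3) act_simps d.linear_simps N.smult_diff)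
  qed
qed

lemma module_Der: "Module.module K (Der K L N act)"
proof -
  have "(fun_space (carrier L) N)\<lparr>carrier := carrier (Der K L N act)\<rparr> = Der K L N act"
    by (simp add: Der_def)
  then show ?thesis
    using submodule.submodule_is_module[OF submodule_Der module_fun_space[OF N.module_axioms]]
    by metis
qed

lemma inner_Der: "n \<in> carrier N \<Longrightarrow> (\<lambda>x\<in>carrier L. act x n) \<in> carrier (Der K L N act)"
  by (rule DerI) (auto intro!: act_linear_left act_bracket)

text \<open>Makes \<open>Inn\<close>, as the image of a linear map, a subspace of the
  derivations.\<close>

lemma linear_inner: "linear_map K N (Der K L N act) (\<lambda>n. \<lambda>x\<in>carrier L. act x n)"
  by (rule linear_mapI)
    (auto simp: N.module_axioms module_Der inner_Der Der_sel act_simps fun_eq_iff)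

sublocale Inn: subspace K "Der K L N act" "Inn L N act"
  using module_Der linear_map.submodule_image[OF linear_inner]
  by (auto simp: subspace_def Inn_def)

section \<open>Two-cocycles and coboundaries\<close>

lemma cocycles2_sel:
  "\<zero>\<^bsub>cocycles2 K L N act\<^esub> = (\<lambda>x\<in>carrier L \<times> carrier L. \<zero>\<^bsub>N\<^esub>)"
  "f \<oplus>\<^bsub>cocycles2 K L N act\<^esub> g = (\<lambda>x\<in>carrier L \<times> carrier L. f x \<oplus>\<^bsub>N\<^esub> g x)"
  "c \<odot>\<^bsub>cocycles2 K L N act\<^esub> f = (\<lambda>x\<in>carrier L \<times> carrier L. c \<odot>\<^bsub>N\<^esub> f x)"
  by (simp_all add: cocycles2_def fun_space_sel)

lemma cocycles2D:
  assumes "f \<in> carrier (cocycles2 K L N act)"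
  shows "f \<in> extensional (carrier L \<times> carrier L)"
    "\<And>x. x \<in> carrier L \<Longrightarrow> linear_map K L N (\<lambda>y. f (x, y))"
    "\<And>y. y \<in> carrier L \<Longrightarrow> linear_map K L N (\<lambda>x. f (x, y))"
    "\<And>x. x \<in> carrier L \<Longrightarrow> f (x, x) = \<zero>\<^bsub>N\<^esub>"
    "\<And>x y z. \<lbrakk>x \<in> carrier L; y \<in> carrier L; z \<in> carrier L\<rbrakk> \<Longrightarrow>
      act x (f (y, z)) \<oplus>\<^bsub>N\<^esub> act y (f (z, x)) \<oplus>\<^bsub>N\<^esub> act z (f (x, y)) =
      f (x \<otimes>\<^bsub>L\<^esub> y, z) \<oplus>\<^bsub>N\<^esub> f (y \<otimes>\<^bsub>L\<^esub> z, x) \<oplus>\<^bsub>N\<^esub> f (z \<otimes>\<^bsub>L\<^esub> x, y)"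
    "\<And>x y. \<lbrakk>x \<in> carrier L; y \<in> carrier L\<rbrakk> \<Longrightarrow> f (x, y) \<in> carrier N"
  using assms by (auto simp: cocycles2_def PiE_iff)

lemma cocycles2I:
  assumes "\<And>x. x \<in> carrier L \<Longrightarrow> linear_map K L N (\<lambda>y. f (x, y))"
    "\<And>y. y \<in> carrier L \<Longrightarrow> linear_map K L N (\<lambda>x. f (x, y))"
    "\<And>x. x \<in> carrier L \<Longrightarrow> f (x, x) = \<zero>\<^bsub>N\<^esub>"
    "\<And>x y z. \<lbrakk>x \<in> carrier L; y \<in> carrier L; z \<in> carrier L\<rbrakk> \<Longrightarrow>
      act x (f (y, z)) \<oplus>\<^bsub>N\<^esub> act y (f (z, x)) \<oplus>\<^bsub>N\<^esub> act z (f (x, y)) =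
      f (x \<otimes>\<^bsub>L\<^esub> y, z) \<oplus>\<^bsub>N\<^esub> f (y \<otimes>\<^bsub>L\<^esub> z, x) \<oplus>\<^bsub>N\<^esub> f (z \<otimes>\<^bsub>L\<^esub> x, y)"
  shows "restrict f (carrier L \<times> carrier L) \<in> carrier (cocycles2 K L N act)"
  unfolding cocycles2_def
  using assms linear_map.linear_closed[OF assms(1)]
  by (auto simp: bracket_closed intro: linear_map_cong[OF assms(1)] linear_map_cong[OF assms(2)])

lemma submodule_cocycles2:
  "submodule (carrier (cocycles2 K L N act)) K (fun_space (carrier L \<times> carrier L) N)"
proof -
  interpret F: Module.module K "fun_space (carrier L \<times> carrier L) N"
    by (rule module_fun_space[OF N.module_axioms])
  show ?thesis
  proof (rule F.submodule_smultI)
    show "carrier (cocycles2 K L N act) \<subseteq> carrier (fun_space (carrier L \<times> carrier L) N)"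
      by (auto simp: cocycles2_def fun_space_sel)
    show "\<zero>\<^bsub>fun_space (carrier L \<times> carrier L) N\<^esub> \<in> carrier (cocycles2 K L N act)"
      unfolding fun_space_sel
      by (rule cocycles2I) (auto intro!: linear_mapI simp: L.module_axioms N.module_axioms act_simps)
  next
    fix f g assume "f \<in> carrier (cocycles2 K L N act)" "g \<in> carrier (cocycles2 K L N act)"
    note f = cocycles2D[OF this(1)] and g = cocycles2D[OF this(2)]
    show "f \<oplus>\<^bsub>fun_space (carrier L \<times> carrier L) N\<^esub> g \<in> carrier (cocycles2 K L N act)"
      unfolding fun_space_sel
    proof (intro cocycles2I linear_map_add f(2,3) g(2,3))
      fix x y z assume xyz: "x \<in> carrier L" "y \<in> carrier L" "z \<in> carrier L"
      have "act x (f (y, z) \<oplus>\<^bsub>N\<^esub> g (y, z)) \<oplus>\<^bsub>N\<^esub> act y (f (z, x) \<oplus>\<^bsub>N\<^esub> g (z, x)) \<oplus>\<^bsub>N\<^esub>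
          act z (f (x, y) \<oplus>\<^bsub>N\<^esub> g (x, y)) =
        (act x (f (y, z)) \<oplus>\<^bsub>N\<^esub> act y (f (z, x)) \<oplus>\<^bsub>N\<^esub> act z (f (x, y))) \<oplus>\<^bsub>N\<^esub>
        (act x (g (y, z)) \<oplus>\<^bsub>N\<^esub> act y (g (z, x)) \<oplus>\<^bsub>N\<^esub> act z (g (x, y)))"
        using xyz by (simp add: f(6) g(6) act_simps N.M.a_ac)
      then show "act x (f (y, z) \<oplus>\<^bsub>N\<^esub> g (y, z)) \<oplus>\<^bsub>N\<^esub> act y (f (z, x) \<oplus>\<^bsub>N\<^esub> g (z, x)) \<oplus>\<^bsub>N\<^esub>
          act z (f (x, y) \<oplus>\<^bsub>N\<^esub> g (x, y)) =
        (f (x \<otimes>\<^bsub>L\<^esub> y, z) \<oplus>\<^bsub>N\<^esub> g (x \<otimes>\<^bsub>L\<^esub> y, z)) \<oplus>\<^bsub>N\<^esub>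
        (f (y \<otimes>\<^bsub>L\<^esub> z, x) \<oplus>\<^bsub>N\<^esub> g (y \<otimes>\<^bsub>L\<^esub> z, x)) \<oplus>\<^bsub>N\<^esub>
        (f (z \<otimes>\<^bsub>L\<^esub> x, y) \<oplus>\<^bsub>N\<^esub> g (z \<otimes>\<^bsub>L\<^esub> x, y))"
        using xyz by (simp add: f(5,6) g(5,6) bracket_closed N.M.a_ac)
    qed (auto simp: f(4) g(4))
  next
    fix a f assume a: "a \<in> carrier K" and "f \<in> carrier (cocycles2 K L N act)"
    note f = cocycles2D[OF this(2)]
    show "a \<odot>\<^bsub>fun_space (carrier L \<times> carrier L) N\<^esub> f \<in> carrier (cocycles2 K L N act)"
      unfolding fun_space_sel
    proof (intro cocycles2I linear_map_smult f(2,3) a)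
      fix x y z assume xyz: "x \<in> carrier L" "y \<in> carrier L" "z \<in> carrier L"
      show "act x (a \<odot>\<^bsub>N\<^esub> f (y, z)) \<oplus>\<^bsub>N\<^esub> act y (a \<odot>\<^bsub>N\<^esub> f (z, x)) \<oplus>\<^bsub>N\<^esub> act z (a \<odot>\<^bsub>N\<^esub> f (x, y)) =
        a \<odot>\<^bsub>N\<^esub> f (x \<otimes>\<^bsub>L\<^esub> y, z) \<oplus>\<^bsub>N\<^esub> a \<odot>\<^bsub>N\<^esub> f (y \<otimes>\<^bsub>L\<^esub> z, x) \<oplus>\<^bsub>N\<^esub> a \<odot>\<^bsub>N\<^esub> f (z \<otimes>\<^bsub>L\<^esub> x, y)"
        using xyz a f(5)[OF xyz]
        by (simp add: act_simps f(6) bracket_closed N.smult_r_distr[symmetric])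
    qed (auto simp: f(4) a)
  qed
qed

lemma module_cocycles2: "Module.module K (cocycles2 K L N act)"
proof -
  have "(fun_space (carrier L \<times> carrier L) N)\<lparr>carrier := carrier (cocycles2 K L N act)\<rparr> =
      cocycles2 K L N act"
    by (simp add: cocycles2_def)
  then show ?thesis
    using submodule.submodule_is_module[OF submodule_cocycles2 module_fun_space[OF N.module_axioms]]
    by metis
qed

text \<open>The Chevalley-Eilenberg differential of a 1-cochain; on linear maps its image is
  \<open>coboundaries2\<close>.\<close>

definition coboundary :: "('l \<Rightarrow> 'n) \<Rightarrow> 'l \<times> 'l \<Rightarrow> 'n" where
  "coboundary b = (\<lambda>(x, y)\<in>carrier L \<times> carrier L.
     act x (b y) \<ominus>\<^bsub>N\<^esub> act y (b x) \<ominus>\<^bsub>N\<^esub> b (x \<otimes>\<^bsub>L\<^esub> y))"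

lemma coboundaries2_eq: "coboundaries2 K L N act = coboundary ` {b. linear_map K L N b}"
  by (simp add: coboundaries2_def coboundary_def)

lemma coboundary_cocycle:
  assumes "linear_map K L N b"
  shows "coboundary b \<in> carrier (cocycles2 K L N act)"
  unfolding coboundary_def
proof (rule cocycles2I)
  interpret b: linear_map K L N b by fact
  {
    fix x assume x: "x \<in> carrier L"
    have "linear_map K L N (\<lambda>y. act x (b y) \<ominus>\<^bsub>N\<^esub> act y (b x) \<ominus>\<^bsub>N\<^esub> b (x \<otimes>\<^bsub>L\<^esub> y))"
      using x
      by (intro linear_map_diff linear_map_comp[OF assms act_linear_right] act_linear_left
          linear_map_comp[OF bracket_linear_right assms]) (auto simp: b.linear_simps)
    then show "linear_map K L N (\<lambda>y. case (x, y) of (x, y) \<Rightarrow>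
        act x (b y) \<ominus>\<^bsub>N\<^esub> act y (b x) \<ominus>\<^bsub>N\<^esub> b (x \<otimes>\<^bsub>L\<^esub> y))" by simp
  next
    fix y assume y: "y \<in> carrier L"
    have "linear_map K L N (\<lambda>x. act x (b y) \<ominus>\<^bsub>N\<^esub> act y (b x) \<ominus>\<^bsub>N\<^esub> b (x \<otimes>\<^bsub>L\<^esub> y))"
      using y
      by (intro linear_map_diff linear_map_comp[OF assms act_linear_right] act_linear_left
          linear_map_comp[OF bracket_linear_left assms]) (auto simp: b.linear_simps)
    then show "linear_map K L N (\<lambda>x. case (x, y) of (x, y) \<Rightarrow>
        act x (b y) \<ominus>\<^bsub>N\<^esub> act y (b x) \<ominus>\<^bsub>N\<^esub> b (x \<otimes>\<^bsub>L\<^esub> y))" by simp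
  next
    fix x assume "x \<in> carrier L"
    then show "(case (x, x) of (x, y) \<Rightarrow>
        act x (b y) \<ominus>\<^bsub>N\<^esub> act y (b x) \<ominus>\<^bsub>N\<^esub> b (x \<otimes>\<^bsub>L\<^esub> y)) = \<zero>\<^bsub>N\<^esub>"
      by (simp add: bracket_alternating b.linear_simps act_simps N.M.diff_self N.M.diff_zero)
  next
    fix x y z assume xyz: "x \<in> carrier L" "y \<in> carrier L" "z \<in> carrier L"
    \<comment> \<open>The triple brackets enter the right-hand side of the cocycle condition through
      \<open>b\<close> of a Jacobi sum. Solving for one term lets the simplifier eliminate it; the
      action terms cancel by \<open>act_bracket\<close>.\<close>
    have "b ((x \<otimes>\<^bsub>L\<^esub> y) \<otimes>\<^bsub>L\<^esub> z \<oplus>\<^bsub>L\<^esub> (y \<otimes>\<^bsub>L\<^esub> z) \<otimes>\<^bsub>L\<^esub> x \<oplus>\<^bsub>L\<^esub> (z \<otimes>\<^bsub>L\<^esub> x) \<otimes>\<^bsub>L\<^esub> y) = \<zero>\<^bsub>N\<^esub>"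
      using xyz by (simp add: jacobi_left b.map_zero)
    then have "b ((x \<otimes>\<^bsub>L\<^esub> y) \<otimes>\<^bsub>L\<^esub> z) =
        \<zero>\<^bsub>N\<^esub> \<ominus>\<^bsub>N\<^esub> (b ((y \<otimes>\<^bsub>L\<^esub> z) \<otimes>\<^bsub>L\<^esub> x) \<oplus>\<^bsub>N\<^esub> b ((z \<otimes>\<^bsub>L\<^esub> x) \<otimes>\<^bsub>L\<^esub> y))"
      using xyz by (simp add: bracket_closed b.linear_simps N.M.diff_simps N.M.a_ac)
    then show "act x (case (y, z) of (x, y) \<Rightarrow>
        act x (b y) \<ominus>\<^bsub>N\<^esub> act y (b x) \<ominus>\<^bsub>N\<^esub> b (x \<otimes>\<^bsub>L\<^esub> y)) \<oplus>\<^bsub>N\<^esub>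
      act y (case (z, x) of (x, y) \<Rightarrow>
        act x (b y) \<ominus>\<^bsub>N\<^esub> act y (b x) \<ominus>\<^bsub>N\<^esub> b (x \<otimes>\<^bsub>L\<^esub> y)) \<oplus>\<^bsub>N\<^esub>
      act z (case (x, y) of (x, y) \<Rightarrow>
        act x (b y) \<ominus>\<^bsub>N\<^esub> act y (b x) \<ominus>\<^bsub>N\<^esub> b (x \<otimes>\<^bsub>L\<^esub> y)) =
      (case (x \<otimes>\<^bsub>L\<^esub> y, z) of (x, y) \<Rightarrow>
        act x (b y) \<ominus>\<^bsub>N\<^esub> act y (b x) \<ominus>\<^bsub>N\<^esub> b (x \<otimes>\<^bsub>L\<^esub> y)) \<oplus>\<^bsub>N\<^esub>
      (case (y \<otimes>\<^bsub>L\<^esub> z, x) of (x, y) \<Rightarrow>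
        act x (b y) \<ominus>\<^bsub>N\<^esub> act y (b x) \<ominus>\<^bsub>N\<^esub> b (x \<otimes>\<^bsub>L\<^esub> y)) \<oplus>\<^bsub>N\<^esub>
      (case (z \<otimes>\<^bsub>L\<^esub> x, y) of (x, y) \<Rightarrow>
        act x (b y) \<ominus>\<^bsub>N\<^esub> act y (b x) \<ominus>\<^bsub>N\<^esub> b (x \<otimes>\<^bsub>L\<^esub> y))"
      using xyz
      by (simp add: act_simps act_bracket b.linear_simps bracket_closed N.M.diff_simps N.M.a_ac)
  }
qed

lemma submodule_coboundaries2: "submodule (coboundaries2 K L N act) K (cocycles2 K L N act)"
proof -
  interpret C: Module.module K "cocycles2 K L N act" by (rule module_cocycles2)
  show ?thesis
    unfolding coboundaries2_eq
  proof (rule C.submodule_smultI)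
    have "\<zero>\<^bsub>cocycles2 K L N act\<^esub> = coboundary (\<lambda>_. \<zero>\<^bsub>N\<^esub>)"
      by (auto simp: cocycles2_sel coboundary_def act_simps N.M.diff_self fun_eq_iff)
    then show "\<zero>\<^bsub>cocycles2 K L N act\<^esub> \<in> coboundary ` {b. linear_map K L N b}"
      by (auto intro!: linear_mapI simp: L.module_axioms N.module_axioms)
  next
    fix f g assume "f \<in> coboundary ` {b. linear_map K L N b}" "g \<in> coboundary ` {b. linear_map K L N b}"
    then obtain b c where b: "linear_map K L N b" "f = coboundary b"
      and c: "linear_map K L N c" "g = coboundary c" by blast
    interpret b: linear_map K L N b by fact
    interpret c: linear_map K L N c by fact
    have "f \<oplus>\<^bsub>cocycles2 K L N act\<^esub> g = coboundary (\<lambda>x. b x \<oplus>\<^bsub>N\<^esub> c x)"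
      by (auto simp: b c cocycles2_sel coboundary_def act_simps b.linear_simps c.linear_simps
          bracket_closed N.M.diff_simps N.M.a_ac fun_eq_iff)
    then show "f \<oplus>\<^bsub>cocycles2 K L N act\<^esub> g \<in> coboundary ` {b. linear_map K L N b}"
      using linear_map_add[OF b(1) c(1)] by auto
  next
    fix a f assume a: "a \<in> carrier K" and "f \<in> coboundary ` {b. linear_map K L N b}"
    then obtain b where b: "linear_map K L N b" "f = coboundary b" by blast
    interpret b: linear_map K L N b by fact
    have "a \<odot>\<^bsub>cocycles2 K L N act\<^esub> f = coboundary (\<lambda>x. a \<odot>\<^bsub>N\<^esub> b x)"
      using a by (auto simp: b cocycles2_sel coboundary_def act_simps b.linear_simps
          bracket_closed N.smult_diff fun_eq_iff)
    then show "a \<odot>\<^bsub>cocycles2 K L N act\<^esub> f \<in> coboundary ` {b. linear_map K L N b}"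
      using linear_map_smult[OF b(1) a] by auto
  qed (auto intro: coboundary_cocycle)
qed

sublocale B2: subspace K "cocycles2 K L N act" "coboundaries2 K L N act"
  using module_cocycles2 submodule_coboundaries2 by (auto simp: subspace_def)

end

lemma a_r_coset_carrier_update: "a_r_coset (V\<lparr>carrier := D\<rparr>) U x = a_r_coset V U x"
  by (simp add: a_r_coset_def')

text \<open>Coset operations do not look at the carrier, so dividing a subspace by \<open>U\<close>
  amounts to cutting the quotient down to its cosets. This is how a subspace of cohomology classes
  becomes a quotient of a space of cochains.\<close>

lemma quot_carrier_update:
  "quot (V\<lparr>carrier := D\<rparr>) U = (quot V U)\<lparr>carrier := (\<lambda>x. U +>\<^bsub>V\<^esub> x) ` D\<rparr>"
  by (auto simp: quot_def A_RCOSETS_def' a_r_coset_carrier_update set_add_def' rcoset_mult_def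
      fun_eq_iff)

context subspace
begin

lemma linear_inclusion: "linear_map K (V\<lparr>carrier := U\<rparr>) V (\<lambda>x. x)"
  by (rule linear_mapI) (auto simp: module_sub V.module_axioms sub_mem)

lemma linear_restrict_carrier: "linear_map K V W f \<Longrightarrow> linear_map K (V\<lparr>carrier := U\<rparr>) W f"
  using linear_map_comp[OF linear_inclusion] .

lemma linear_into_sub:
  assumes "linear_map K W V f" "\<And>x. x \<in> carrier W \<Longrightarrow> f x \<in> U"
  shows "linear_map K W (V\<lparr>carrier := U\<rparr>) f"
proof -
  interpret f: linear_map K W V f by fact
  show ?thesis
    by (rule linear_mapI)
      (simp_all add: f.V.module_axioms module_sub assms(2) f.linear_add f.linear_smult)
qed

text \<open>Needed where a quotient is taken inside a subspace: inner derivations inside the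
  invariant ones, and the graph of a derivation inside its idealizer.\<close>

lemma subspace_sub:
  assumes "submodule U' K V" "U' \<subseteq> U"
  shows "subspace K (V\<lparr>carrier := U\<rparr>) U'"
proof -
  interpret S: Module.module K "V\<lparr>carrier := U\<rparr>" by (rule module_sub)
  interpret U': subspace K V U' using assms(1) by (simp add: subspace_def V.module_axioms)
  have "submodule U' K (V\<lparr>carrier := U\<rparr>)"
    by (rule S.submodule_smultI)
      (simp_all add: assms(2) U'.sub_zero U'.sub_add U'.sub_smult)
  then show ?thesis by (simp add: subspace_def module_sub)
qed

end

section \<open>The inflation and restriction maps\<close>

locale lie_ideal_module = lie_ideal K L H + lie_module K L M act
  for K :: "('k, 'r) ring_scheme" and L :: "('k, 'l) module" and H :: "'l set"
    and M :: "('k, 'm) module" and act :: "'l \<Rightarrow> 'm \<Rightarrow> 'm"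
begin

sublocale H: subspace K L H
  by (simp add: subspace_def L.module_axioms submodule_axioms)

lemma bracket_in_ideal_left: "\<lbrakk>z \<in> H; x \<in> carrier L\<rbrakk> \<Longrightarrow> z \<otimes>\<^bsub>L\<^esub> x \<in> H"
  using bracket_antisym[of x z] bracket_in_ideal[of x z] H.sub_neg H.sub_mem by simp

lemma lie_algebra_ideal: "lie_algebra K (L\<lparr>carrier := H\<rparr>)"
proof -
  have "linear_map K (L\<lparr>carrier := H\<rparr>) (L\<lparr>carrier := H\<rparr>) (\<lambda>y. x \<otimes>\<^bsub>L\<^esub> y)"
    "linear_map K (L\<lparr>carrier := H\<rparr>) (L\<lparr>carrier := H\<rparr>) (\<lambda>y. y \<otimes>\<^bsub>L\<^esub> x)" if "x \<in> H" for x
    using that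
    by (auto intro!: linear_mapI simp: H.module_sub bracket_in_ideal bracket_simps H.sub_mem)
  then show ?thesis
    using K.field_axioms H.module_sub
    by (auto simp: lie_algebra_def lie_algebra_axioms_def bracket_alternating jacobi H.sub_mem)
qed

lemma quot_bracket:
  assumes "x \<in> carrier L" "y \<in> carrier L"
  shows "(H +>\<^bsub>L\<^esub> x) \<otimes>\<^bsub>quot L H\<^esub> (H +>\<^bsub>L\<^esub> y) = H +>\<^bsub>L\<^esub> (x \<otimes>\<^bsub>L\<^esub> y)"
  using assms
  by (intro H.quot_mult) (auto simp: bracket_simps H.sub_mem bracket_in_ideal bracket_in_ideal_left)

lemma lie_algebra_quot: "lie_algebra K (quot L H)"
proof -
  have "linear_map K (quot L H) (quot L H) (\<lambda>Y. X \<otimes>\<^bsub>quot L H\<^esub> Y)"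
    "linear_map K (quot L H) (quot L H) (\<lambda>Y. Y \<otimes>\<^bsub>quot L H\<^esub> X)" if X: "X \<in> carrier (quot L H)" for X
    by (rule H.quot_cases[OF X]; rule linear_mapI; (elim H.quot_cases)?;
        simp add: H.module_quot H.quot_add H.quot_smult quot_bracket bracket_simps H.quotI)+
  moreover have "X \<otimes>\<^bsub>quot L H\<^esub> X = \<zero>\<^bsub>quot L H\<^esub>" if X: "X \<in> carrier (quot L H)" for X
    by (rule H.quot_cases[OF X])
      (simp add: quot_bracket bracket_alternating H.quot_zero H.coset_eq_self_iff H.sub_zero)
  moreover have "X \<otimes>\<^bsub>quot L H\<^esub> (Y \<otimes>\<^bsub>quot L H\<^esub> Z) \<oplus>\<^bsub>quot L H\<^esub> Y \<otimes>\<^bsub>quot L H\<^esub> (Z \<otimes>\<^bsub>quot L H\<^esub> X)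
      \<oplus>\<^bsub>quot L H\<^esub> Z \<otimes>\<^bsub>quot L H\<^esub> (X \<otimes>\<^bsub>quot L H\<^esub> Y) = \<zero>\<^bsub>quot L H\<^esub>"
    if X: "X \<in> carrier (quot L H)" and Y: "Y \<in> carrier (quot L H)" and Z: "Z \<in> carrier (quot L H)"
    for X Y Z
    by (rule H.quot_cases[OF X]; rule H.quot_cases[OF Y]; rule H.quot_cases[OF Z])
      (simp add: quot_bracket bracket_closed jacobi H.quot_add H.quot_zero H.coset_eq_self_iff
        H.sub_zero)
  ultimately show ?thesis
    using K.field_axioms H.module_quot by (simp add: lie_algebra_def lie_algebra_axioms_def)
qed

lemma lie_module_ideal: "lie_module K (L\<lparr>carrier := H\<rparr>) M act"
  unfolding lie_module_def lie_module_axioms_def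
  using lie_algebra_ideal N.module_axioms
  by (auto simp: H.sub_mem act_bracket intro!: act_linear_right
      H.linear_restrict_carrier act_linear_left)

abbreviation MH :: "'m set" where "MH \<equiv> {n \<in> carrier M. \<forall>z\<in>H. act z n = \<zero>\<^bsub>M\<^esub>}"

lemma invariants_eq: "invariants H M act = M\<lparr>carrier := MH\<rparr>"
  by (simp add: invariants_def)

lemma invariants_sel:
  "x \<oplus>\<^bsub>invariants H M act\<^esub> y = x \<oplus>\<^bsub>M\<^esub> y"
  "c \<odot>\<^bsub>invariants H M act\<^esub> x = c \<odot>\<^bsub>M\<^esub> x"
  "\<zero>\<^bsub>invariants H M act\<^esub> = \<zero>\<^bsub>M\<^esub>"
  by (simp_all add: invariants_def)

sublocale MH: subspace K M MH
  unfolding subspace_def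
  by (auto intro!: N.module_axioms N.submodule_smultI simp: act_simps H.sub_mem)

lemma act_commute:
  "\<lbrakk>x \<in> carrier L; y \<in> carrier L; n \<in> carrier M\<rbrakk> \<Longrightarrow>
    act x (act y n) = act (x \<otimes>\<^bsub>L\<^esub> y) n \<oplus>\<^bsub>M\<^esub> act y (act x n)"
  by (simp add: act_bracket act_closed N.M.diff_simps N.M.a_ac)

text \<open>z (x n) = [z, x] n + x (z n), and both terms vanish because [z, x] lies in the
  ideal.\<close>

lemma act_invariants: "\<lbrakk>x \<in> carrier L; n \<in> MH\<rbrakk> \<Longrightarrow> act x n \<in> MH"
  using act_commute[of _ x n] H.sub_mem bracket_in_ideal_left by (auto simp: act_simps)

lemma quot_act_coset:
  assumes "x \<in> carrier L" "n \<in> MH"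
  shows "quot_act act (H +>\<^bsub>L\<^esub> x) n = act x n"
  unfolding quot_act_def using assms
  by (intro H.induced_map_coset[OF act_linear_left]) auto

lemma lie_module_quot: "lie_module K (quot L H) (invariants H M act) (quot_act act)"
proof -
  have "linear_map K (M\<lparr>carrier := MH\<rparr>) (M\<lparr>carrier := MH\<rparr>) (quot_act act X)"
    if X: "X \<in> carrier (quot L H)" for X
  proof -
    obtain x where x: "x \<in> carrier L" "X = H +>\<^bsub>L\<^esub> x" by (rule H.quot_cases[OF X])
    have "linear_map K (M\<lparr>carrier := MH\<rparr>) (M\<lparr>carrier := MH\<rparr>) (act x)"
      using act_linear_right[OF x(1)] act_invariants[OF x(1)]
      by (intro MH.linear_into_sub MH.linear_restrict_carrier) auto
    then show ?thesis by (rule linear_map_cong) (use x quot_act_coset in auto)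
  qed
  moreover have "linear_map K (quot L H) (M\<lparr>carrier := MH\<rparr>) (\<lambda>X. quot_act act X n)" if "n \<in> MH" for n
    unfolding quot_act_def using that act_linear_left[of n] act_invariants
    by (intro H.linear_induced_map MH.linear_into_sub) auto
  moreover have "quot_act act (X \<otimes>\<^bsub>quot L H\<^esub> Y) n =
      quot_act act X (quot_act act Y n) \<ominus>\<^bsub>M\<lparr>carrier := MH\<rparr>\<^esub> quot_act act Y (quot_act act X n)"
    if X: "X \<in> carrier (quot L H)" and Y: "Y \<in> carrier (quot L H)" and n: "n \<in> MH" for X Y n
  proof -
    obtain x where x: "x \<in> carrier L" "X = H +>\<^bsub>L\<^esub> x" by (rule H.quot_cases[OF X])
    obtain y where y: "y \<in> carrier L" "Y = H +>\<^bsub>L\<^esub> y" by (rule H.quot_cases[OF Y])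
    have "act (x \<otimes>\<^bsub>L\<^esub> y) n = act x (act y n) \<ominus>\<^bsub>M\<lparr>carrier := MH\<rparr>\<^esub> act y (act x n)"
      using x y n act_bracket[of x y n] MH.diff_sub[OF act_invariants act_invariants] act_invariants
      by simp
    then show ?thesis
      using x y n act_invariants
      by (simp only: quot_act_coset quot_bracket bracket_closed)
  qed
  ultimately show ?thesis
    unfolding lie_module_def lie_module_axioms_def invariants_eq
    using lie_algebra_quot MH.module_sub by auto
qed

sublocale G: lie_cohomology K L M act ..

sublocale I: lie_cohomology K "L\<lparr>carrier := H\<rparr>" M act
  by (rule lie_cohomology.intro[OF lie_module_ideal])

sublocale Q: lie_cohomology K "quot L H" "invariants H M act" "quot_act act"
  by (rule lie_cohomology.intro[OF lie_module_quot])

abbreviation "H1Q \<equiv> H1 K (quot L H) (invariants H M act) (quot_act act)"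
abbreviation "H1G \<equiv> H1 K L M act"
abbreviation "DerQ \<equiv> Der K (quot L H) (invariants H M act) (quot_act act)"
abbreviation "DerG \<equiv> Der K L M act"
abbreviation "DerI \<equiv> Der K (L\<lparr>carrier := H\<rparr>) M act"
abbreviation "InnG \<equiv> Inn L M act"
abbreviation "InnI \<equiv> Inn (L\<lparr>carrier := H\<rparr>) M act"
abbreviation "InnQ \<equiv> Inn (quot L H) (invariants H M act) (quot_act act)"

section \<open>Inflation and its injectivity\<close>

definition inf_der :: "('l set \<Rightarrow> 'm) \<Rightarrow> 'l \<Rightarrow> 'm" where
  "inf_der d = (\<lambda>x\<in>carrier L. d (H +>\<^bsub>L\<^esub> x))"

lemma DerQ_closed: "\<lbrakk>d \<in> carrier DerQ; x \<in> carrier L\<rbrakk> \<Longrightarrow> d (H +>\<^bsub>L\<^esub> x) \<in> MH"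
  using linear_map.linear_closed[OF Q.DerD(2)] H.quotI by (simp add: invariants_eq)

lemma inf_der_Der:
  assumes d: "d \<in> carrier DerQ"
  shows "inf_der d \<in> carrier DerG"
  unfolding inf_der_def
proof (rule G.DerI)
  show "linear_map K L M (\<lambda>x. d (H +>\<^bsub>L\<^esub> x))"
    using linear_map_comp[OF linear_map_comp[OF H.linear_map_coset] MH.linear_inclusion]
      Q.DerD(2)[OF d] by (simp add: invariants_eq)
next
  fix x y assume xy: "x \<in> carrier L" "y \<in> carrier L"
  have "d (H +>\<^bsub>L\<^esub> (x \<otimes>\<^bsub>L\<^esub> y)) = quot_act act (H +>\<^bsub>L\<^esub> x) (d (H +>\<^bsub>L\<^esub> y))
      \<ominus>\<^bsub>M\<lparr>carrier := MH\<rparr>\<^esub> quot_act act (H +>\<^bsub>L\<^esub> y) (d (H +>\<^bsub>L\<^esub> x))"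
    using Q.DerD(3)[OF d H.quotI[OF xy(1)] H.quotI[OF xy(2)]] xy
    by (simp add: quot_bracket invariants_eq)
  also have "\<dots> = act x (d (H +>\<^bsub>L\<^esub> y)) \<ominus>\<^bsub>M\<lparr>carrier := MH\<rparr>\<^esub> act y (d (H +>\<^bsub>L\<^esub> x))"
    using xy d by (simp only: quot_act_coset DerQ_closed)
  also have "\<dots> = act x (d (H +>\<^bsub>L\<^esub> y)) \<ominus>\<^bsub>M\<^esub> act y (d (H +>\<^bsub>L\<^esub> x))"
    using xy d by (intro MH.diff_sub act_invariants DerQ_closed)
  finally show "d (H +>\<^bsub>L\<^esub> (x \<otimes>\<^bsub>L\<^esub> y)) = act x (d (H +>\<^bsub>L\<^esub> y)) \<ominus>\<^bsub>M\<^esub> act y (d (H +>\<^bsub>L\<^esub> x))" .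
qed

lemma linear_inf_der: "linear_map K DerQ DerG inf_der"
proof (rule linear_mapI)
  fix d e assume "d \<in> carrier DerQ" "e \<in> carrier DerQ"
  then show "inf_der (d \<oplus>\<^bsub>DerQ\<^esub> e) = inf_der d \<oplus>\<^bsub>DerG\<^esub> inf_der e"
    by (auto simp: inf_der_def Q.Der_sel G.Der_sel fun_eq_iff H.quotI invariants_sel)
next
  fix a d assume "a \<in> carrier K" "d \<in> carrier DerQ"
  then show "inf_der (a \<odot>\<^bsub>DerQ\<^esub> d) = a \<odot>\<^bsub>DerG\<^esub> inf_der d"
    by (auto simp: inf_der_def Q.Der_sel G.Der_sel fun_eq_iff H.quotI invariants_sel)
qed (simp_all add: Q.module_Der G.module_Der inf_der_Der)

text \<open>If the inflated derivation is x -> x m, then for z in H the element z m is the value of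
  \<open>d\<close> at the zero coset; hence \<open>m\<close> is H-invariant and already induces
  \<open>d\<close> on L/H. One direction makes inflation well defined on classes, the other makes it
  injective.\<close>

lemma inf_der_inner_iff:
  assumes d: "d \<in> carrier DerQ"
  shows "inf_der d \<in> InnG \<longleftrightarrow> d \<in> InnQ"
proof
  assume "inf_der d \<in> InnG"
  then obtain m where m: "m \<in> carrier M" "inf_der d = (\<lambda>x\<in>carrier L. act x m)"
    by (auto simp: Inn_def)
  have d': "d (H +>\<^bsub>L\<^esub> x) = act x m" if "x \<in> carrier L" for x
    using fun_cong[OF m(2), of x] that by (simp add: inf_der_def)
  have "act z m = \<zero>\<^bsub>M\<^esub>" if z: "z \<in> H" for z
  proof -
    have "H +>\<^bsub>L\<^esub> z = \<zero>\<^bsub>quot L H\<^esub>"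
      using z by (simp add: H.coset_eq_self_iff H.quot_zero H.sub_mem)
    then show ?thesis
      using d'[OF H.sub_mem[OF z]] linear_map.map_zero[OF Q.DerD(2)[OF d]]
      by (simp add: invariants_eq)
  qed
  then have mH: "m \<in> MH" using m by simp
  have "d = (\<lambda>X\<in>carrier (quot L H). quot_act act X m)"
  proof (rule extensionalityI[OF Q.DerD(1)[OF d] restrict_extensional])
    fix X assume X: "X \<in> carrier (quot L H)"
    then obtain x where "x \<in> carrier L" "X = H +>\<^bsub>L\<^esub> x" by (rule H.quot_cases)
    then show "d X = (\<lambda>X\<in>carrier (quot L H). quot_act act X m) X"
      using X mH by (simp only: quot_act_coset d' restrict_apply if_True)
  qed
  then show "d \<in> InnQ" using mH by (auto simp: Inn_def invariants_eq)
next
  assume "d \<in> InnQ"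
  then obtain m where m: "m \<in> MH" "d = (\<lambda>X\<in>carrier (quot L H). quot_act act X m)"
    by (auto simp: Inn_def invariants_eq)
  then have "inf_der d = (\<lambda>x\<in>carrier L. act x m)"
    using quot_act_coset[OF _ m(1)] by (auto simp: inf_der_def H.quotI fun_eq_iff)
  then show "inf_der d \<in> InnG" using m(1) by (auto simp: Inn_def)
qed

lemma infl_eq: "infl K L H M act = (\<lambda>c. the_elem ((\<lambda>d. InnG +>\<^bsub>DerG\<^esub> inf_der d) ` c))"
  by (simp add: infl_def H1_class_def inf_der_def fun_eq_iff)

lemma linear_infl_class: "linear_map K DerQ H1G (\<lambda>d. InnG +>\<^bsub>DerG\<^esub> inf_der d)"
  unfolding H1_def by (rule linear_map_comp[OF linear_inf_der G.Inn.linear_map_coset])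

lemma infl_class_inner: "d \<in> InnQ \<Longrightarrow> InnG +>\<^bsub>DerG\<^esub> inf_der d = \<zero>\<^bsub>H1G\<^esub>"
  using inf_der_inner_iff Q.Inn.sub_mem
  by (simp add: H1_def G.Inn.quot_zero G.Inn.coset_eq_self_iff inf_der_Der)

lemma linear_infl: "linear_map K H1Q H1G (infl K L H M act)"
  unfolding infl_eq using Q.Inn.linear_induced_map[OF linear_infl_class infl_class_inner]
  by (simp add: H1_def)

lemma infl_coset:
  "d \<in> carrier DerQ \<Longrightarrow> infl K L H M act (InnQ +>\<^bsub>DerQ\<^esub> d) = InnG +>\<^bsub>DerG\<^esub> inf_der d"
  unfolding infl_eq by (rule Q.Inn.induced_map_coset[OF linear_infl_class infl_class_inner])

lemma kernel_infl: "a_kernel H1Q H1G (infl K L H M act) = {\<zero>\<^bsub>H1Q\<^esub>}"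
proof -
  have "infl K L H M act c = \<zero>\<^bsub>H1G\<^esub> \<longleftrightarrow> c = \<zero>\<^bsub>H1Q\<^esub>" if c: "c \<in> carrier H1Q" for c
  proof -
    obtain d where d: "d \<in> carrier DerQ" "c = InnQ +>\<^bsub>DerQ\<^esub> d"
      using c unfolding H1_def by (rule Q.Inn.quot_cases)
    then show ?thesis
      by (simp add: infl_coset H1_def G.Inn.quot_zero Q.Inn.quot_zero G.Inn.coset_eq_self_iff
          Q.Inn.coset_eq_self_iff inf_der_Der inf_der_inner_iff)
  qed
  moreover have "\<zero>\<^bsub>H1Q\<^esub> \<in> carrier H1Q"
    using linear_infl abelian_group.axioms(1) abelian_monoid.zero_closed
    by (auto simp: linear_map_def Module.module_def)
  ultimately show ?thesis by (auto simp: a_kernel_eq)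
qed

section \<open>Derivations of the ideal whose class is invariant\<close>

lemma DerI_simps:
  assumes "d \<in> carrier DerI"
  shows "z \<in> H \<Longrightarrow> d z \<in> carrier M"
    and "\<lbrakk>z \<in> H; w \<in> H\<rbrakk> \<Longrightarrow> d (z \<oplus>\<^bsub>L\<^esub> w) = d z \<oplus>\<^bsub>M\<^esub> d w"
    and "\<lbrakk>z \<in> H; w \<in> H\<rbrakk> \<Longrightarrow> d (z \<ominus>\<^bsub>L\<^esub> w) = d z \<ominus>\<^bsub>M\<^esub> d w"
    and "\<lbrakk>a \<in> carrier K; z \<in> H\<rbrakk> \<Longrightarrow> d (a \<odot>\<^bsub>L\<^esub> z) = a \<odot>\<^bsub>M\<^esub> d z"
    and "\<lbrakk>z \<in> H; w \<in> H\<rbrakk> \<Longrightarrow> d (z \<otimes>\<^bsub>L\<^esub> w) = act z (d w) \<ominus>\<^bsub>M\<^esub> act w (d z)"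
    and "d \<zero>\<^bsub>L\<^esub> = \<zero>\<^bsub>M\<^esub>"
proof -
  interpret d: linear_map K "L\<lparr>carrier := H\<rparr>" M d by (rule I.DerD(2)[OF assms])
  show "z \<in> H \<Longrightarrow> d z \<in> carrier M"
    and "\<lbrakk>z \<in> H; w \<in> H\<rbrakk> \<Longrightarrow> d (z \<oplus>\<^bsub>L\<^esub> w) = d z \<oplus>\<^bsub>M\<^esub> d w"
    and "\<lbrakk>z \<in> H; w \<in> H\<rbrakk> \<Longrightarrow> d (z \<ominus>\<^bsub>L\<^esub> w) = d z \<ominus>\<^bsub>M\<^esub> d w"
    and "\<lbrakk>a \<in> carrier K; z \<in> H\<rbrakk> \<Longrightarrow> d (a \<odot>\<^bsub>L\<^esub> z) = a \<odot>\<^bsub>M\<^esub> d z"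
    and "\<lbrakk>z \<in> H; w \<in> H\<rbrakk> \<Longrightarrow> d (z \<otimes>\<^bsub>L\<^esub> w) = act z (d w) \<ominus>\<^bsub>M\<^esub> act w (d z)"
    and "d \<zero>\<^bsub>L\<^esub> = \<zero>\<^bsub>M\<^esub>"
    using d.linear_closed[of z] d.linear_add[of z w] d.map_diff[of z w] d.linear_smult[of a z]
      d.map_zero I.DerD(3)[OF assms, of z w]
    by (simp_all add: H.diff_sub)
qed

text \<open>The preimage of the invariant classes in Der(H, M): each \<open>x\<close> moves
  \<open>d\<close> to an inner derivation. The elements \<open>m\<close> are kept explicit because
  they are exactly the first components of the elements over \<open>x\<close> in the
  idealizer.\<close>

definition invariant_ders :: "('l \<Rightarrow> 'm) set" where
  "invariant_ders = {d \<in> carrier DerI. \<forall>x\<in>carrier L. \<exists>m\<in>carrier M. \<forall>z\<in>H.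
     act x (d z) \<ominus>\<^bsub>M\<^esub> d (x \<otimes>\<^bsub>L\<^esub> z) = act z m}"

lemma invariant_dersD: "d \<in> invariant_ders \<Longrightarrow> d \<in> carrier DerI"
  by (simp add: invariant_ders_def)

text \<open>The elements \<open>m\<close> add and scale along with the derivations.\<close>

lemma submodule_invariant_ders: "submodule invariant_ders K DerI"
proof (rule module.submodule_smultI[OF I.module_Der])
  have "\<zero>\<^bsub>DerI\<^esub> \<in> carrier DerI" using I.Inn.sub_mem I.Inn.sub_zero by blast
  moreover have "\<forall>z\<in>H. act x (\<zero>\<^bsub>DerI\<^esub> z) \<ominus>\<^bsub>M\<^esub> \<zero>\<^bsub>DerI\<^esub> (x \<otimes>\<^bsub>L\<^esub> z) = act z \<zero>\<^bsub>M\<^esub>"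
    if "x \<in> carrier L" for x
    using that by (auto simp: I.Der_sel bracket_in_ideal act_simps H.sub_mem N.M.diff_self)
  ultimately show "\<zero>\<^bsub>DerI\<^esub> \<in> invariant_ders"
    unfolding invariant_ders_def by blast
next
  fix d e assume "d \<in> invariant_ders" "e \<in> invariant_ders"
  then have d: "d \<in> carrier DerI" and e: "e \<in> carrier DerI" 
    and dm: "\<And>x. x \<in> carrier L \<Longrightarrow> \<exists>m\<in>carrier M. \<forall>z\<in>H. act x (d z) \<ominus>\<^bsub>M\<^esub> d (x \<otimes>\<^bsub>L\<^esub> z) = act z m"
    and em: "\<And>x. x \<in> carrier L \<Longrightarrow> \<exists>m\<in>carrier M. \<forall>z\<in>H. act x (e z) \<ominus>\<^bsub>M\<^esub> e (x \<otimes>\<^bsub>L\<^esub> z) = act z m"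
    by (auto simp: invariant_ders_def)
  have "\<exists>m\<in>carrier M. \<forall>z\<in>H. act x ((d \<oplus>\<^bsub>DerI\<^esub> e) z) \<ominus>\<^bsub>M\<^esub> (d \<oplus>\<^bsub>DerI\<^esub> e) (x \<otimes>\<^bsub>L\<^esub> z) = act z m"
    if x: "x \<in> carrier L" for x
  proof -
    obtain m n where m: "m \<in> carrier M" "\<forall>z\<in>H. act x (d z) \<ominus>\<^bsub>M\<^esub> d (x \<otimes>\<^bsub>L\<^esub> z) = act z m"
      and n: "n \<in> carrier M" "\<forall>z\<in>H. act x (e z) \<ominus>\<^bsub>M\<^esub> e (x \<otimes>\<^bsub>L\<^esub> z) = act z n"
      using dm[OF x] em[OF x] by blast
    have "act x ((d \<oplus>\<^bsub>DerI\<^esub> e) z) \<ominus>\<^bsub>M\<^esub> (d \<oplus>\<^bsub>DerI\<^esub> e) (x \<otimes>\<^bsub>L\<^esub> z) = act z (m \<oplus>\<^bsub>M\<^esub> n)"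
      if z: "z \<in> H" for z
    proof -
      have "act x ((d \<oplus>\<^bsub>DerI\<^esub> e) z) \<ominus>\<^bsub>M\<^esub> (d \<oplus>\<^bsub>DerI\<^esub> e) (x \<otimes>\<^bsub>L\<^esub> z) =
          (act x (d z) \<ominus>\<^bsub>M\<^esub> d (x \<otimes>\<^bsub>L\<^esub> z)) \<oplus>\<^bsub>M\<^esub> (act x (e z) \<ominus>\<^bsub>M\<^esub> e (x \<otimes>\<^bsub>L\<^esub> z))"
        using x z by (simp add: I.Der_sel DerI_simps[OF d] DerI_simps[OF e] act_simps
            bracket_in_ideal N.M.diff_simps N.M.a_ac)
      also have "\<dots> = act z (m \<oplus>\<^bsub>M\<^esub> n)" using m n z by (simp add: act_simps H.sub_mem)
      finally show ?thesis .
    qed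
    then show ?thesis using m n by blast
  qed
  moreover have "d \<oplus>\<^bsub>DerI\<^esub> e \<in> carrier DerI"
    using d e by (simp add: abelian_monoid.a_closed abelian_group.axioms(1)
        Module.module.axioms(2)[OF I.module_Der])
  ultimately show "d \<oplus>\<^bsub>DerI\<^esub> e \<in> invariant_ders" by (simp add: invariant_ders_def)
next
  fix a d assume a: "a \<in> carrier K" and "d \<in> invariant_ders"
  then have d: "d \<in> carrier DerI"
    and dm: "\<And>x. x \<in> carrier L \<Longrightarrow> \<exists>m\<in>carrier M. \<forall>z\<in>H. act x (d z) \<ominus>\<^bsub>M\<^esub> d (x \<otimes>\<^bsub>L\<^esub> z) = act z m"
    by (auto simp: invariant_ders_def)
  have "\<exists>m\<in>carrier M. \<forall>z\<in>H. act x ((a \<odot>\<^bsub>DerI\<^esub> d) z) \<ominus>\<^bsub>M\<^esub> (a \<odot>\<^bsub>DerI\<^esub> d) (x \<otimes>\<^bsub>L\<^esub> z) = act z m"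
    if x: "x \<in> carrier L" for x
  proof -
    obtain m where m: "m \<in> carrier M" "\<forall>z\<in>H. act x (d z) \<ominus>\<^bsub>M\<^esub> d (x \<otimes>\<^bsub>L\<^esub> z) = act z m"
      using dm[OF x] by blast
    have "act x ((a \<odot>\<^bsub>DerI\<^esub> d) z) \<ominus>\<^bsub>M\<^esub> (a \<odot>\<^bsub>DerI\<^esub> d) (x \<otimes>\<^bsub>L\<^esub> z) = act z (a \<odot>\<^bsub>M\<^esub> m)"
      if z: "z \<in> H" for z
    proof -
      have "act x ((a \<odot>\<^bsub>DerI\<^esub> d) z) \<ominus>\<^bsub>M\<^esub> (a \<odot>\<^bsub>DerI\<^esub> d) (x \<otimes>\<^bsub>L\<^esub> z) =
          a \<odot>\<^bsub>M\<^esub> (act x (d z) \<ominus>\<^bsub>M\<^esub> d (x \<otimes>\<^bsub>L\<^esub> z))"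
        using x z a by (simp add: I.Der_sel DerI_simps[OF d] act_simps bracket_in_ideal N.smult_diff)
      also have "\<dots> = act z (a \<odot>\<^bsub>M\<^esub> m)" using m z a by (simp add: act_simps H.sub_mem)
      finally show ?thesis .
    qed
    then show ?thesis using m a by blast
  qed
  moreover have "a \<odot>\<^bsub>DerI\<^esub> d \<in> carrier DerI"
    using a d by (rule Module.module.smult_closed[OF I.module_Der])
  ultimately show "a \<odot>\<^bsub>DerI\<^esub> d \<in> invariant_ders" by (simp add: invariant_ders_def)
qed (simp add: invariant_ders_def)

sublocale D: subspace K DerI invariant_ders
  by (simp add: subspace_def I.module_Der submodule_invariant_ders)

section \<open>Restriction of derivations\<close>

lemma DerG_simps:
  assumes "d \<in> carrier DerG"
  shows "x \<in> carrier L \<Longrightarrow> d x \<in> carrier M"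
    and "\<lbrakk>x \<in> carrier L; y \<in> carrier L\<rbrakk> \<Longrightarrow> d (x \<oplus>\<^bsub>L\<^esub> y) = d x \<oplus>\<^bsub>M\<^esub> d y"
    and "\<lbrakk>x \<in> carrier L; y \<in> carrier L\<rbrakk> \<Longrightarrow> d (x \<ominus>\<^bsub>L\<^esub> y) = d x \<ominus>\<^bsub>M\<^esub> d y"
    and "\<lbrakk>x \<in> carrier L; y \<in> carrier L\<rbrakk> \<Longrightarrow>
      d (x \<otimes>\<^bsub>L\<^esub> y) = act x (d y) \<ominus>\<^bsub>M\<^esub> act y (d x)"
  using linear_map.linear_simps[OF G.DerD(2)[OF assms]] G.DerD(3)[OF assms] by auto

text \<open>The derivation law on L reads x d(z) - d [x, z] = z d(x), so \<open>d x\<close> itself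
  is the element that invariance asks for.\<close>

lemma res_Der:
  assumes d: "d \<in> carrier DerG"
  shows "restrict d H \<in> invariant_ders"
proof -
  have "restrict d (carrier (L\<lparr>carrier := H\<rparr>)) \<in> carrier DerI"
    using H.linear_restrict_carrier[OF G.DerD(2)[OF d]] G.DerD(3)[OF d]
    by (intro I.DerI) (auto simp: H.sub_mem)
  moreover have "act x (d z) \<ominus>\<^bsub>M\<^esub> d (x \<otimes>\<^bsub>L\<^esub> z) = act z (d x)" if "x \<in> carrier L" "z \<in> H" for x z
    using that by (simp add: DerG_simps[OF d] H.sub_mem act_simps N.M.diff_simps N.M.a_ac)
  ultimately show ?thesis
    using DerG_simps(1)[OF d] by (auto simp: invariant_ders_def bracket_in_ideal)
qed

lemma linear_res_der: "linear_map K DerG (DerI\<lparr>carrier := invariant_ders\<rparr>) (\<lambda>d. restrict d H)"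
proof (rule linear_mapI)
  fix d e assume "d \<in> carrier DerG" "e \<in> carrier DerG"
  then show "restrict (d \<oplus>\<^bsub>DerG\<^esub> e) H =
      restrict d H \<oplus>\<^bsub>DerI\<lparr>carrier := invariant_ders\<rparr>\<^esub> restrict e H"
    by (auto simp: I.Der_sel G.Der_sel fun_eq_iff H.sub_mem)
next
  fix a d assume "a \<in> carrier K" "d \<in> carrier DerG"
  then show "restrict (a \<odot>\<^bsub>DerG\<^esub> d) H = a \<odot>\<^bsub>DerI\<lparr>carrier := invariant_ders\<rparr>\<^esub> restrict d H"
    by (auto simp: I.Der_sel G.Der_sel fun_eq_iff H.sub_mem)
qed (simp_all add: D.module_sub G.module_Der res_Der)

lemma res_inner: "m \<in> carrier M \<Longrightarrow> restrict (\<lambda>x\<in>carrier L. act x m) H = (\<lambda>z\<in>H. act z m)"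
  by (auto simp: fun_eq_iff restrict_def H.sub_mem)

lemma res_InnG: "d \<in> InnG \<Longrightarrow> restrict d H \<in> InnI"
  by (auto simp: Inn_def res_inner simp del: restrict_restrict)

text \<open>An inner derivation of H is the restriction of the inner derivation of L given by the
  same element.\<close>

lemma InnI_invariant: "InnI \<subseteq> invariant_ders"
proof
  fix d assume "d \<in> InnI"
  then obtain m where m: "m \<in> carrier M" "d = (\<lambda>z\<in>H. act z m)" by (auto simp: Inn_def)
  then have "d = restrict (\<lambda>x\<in>carrier L. act x m) H" by (simp only: res_inner)
  then show "d \<in> invariant_ders" using res_Der[OF G.inner_Der[OF m(1)]] by (simp only:)
qed

sublocale DI: subspace K "DerI\<lparr>carrier := invariant_ders\<rparr>" InnI
  by (rule D.subspace_sub[OF I.Inn.submodule_axioms InnI_invariant])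

section \<open>The action on H^1(H, M) and its invariants\<close>

text \<open>Both \<open>act x\<close> and bracketing with \<open>x\<close> obey a Leibniz rule; the
  mixed terms, in which [x, z] acts on d(w) or [x, w] on d(z), cancel in their difference.\<close>

lemma der_act_Der:
  assumes d: "d \<in> carrier DerI" and x: "x \<in> carrier L"
  shows "der_act L H M act x d \<in> carrier DerI"
proof -
  have "restrict (\<lambda>z. act x (d z) \<ominus>\<^bsub>M\<^esub> d (x \<otimes>\<^bsub>L\<^esub> z)) (carrier (L\<lparr>carrier := H\<rparr>)) \<in> carrier DerI"
  proof (rule I.DerI)
    show "linear_map K (L\<lparr>carrier := H\<rparr>) M (\<lambda>z. act x (d z) \<ominus>\<^bsub>M\<^esub> d (x \<otimes>\<^bsub>L\<^esub> z))"
      using x by (intro linear_mapI)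
        (auto simp: H.module_sub N.module_axioms DerI_simps[OF d] act_simps bracket_in_ideal
          bracket_simps H.sub_mem N.M.diff_simps N.M.a_ac N.smult_diff)
  next
    fix z w assume "z \<in> carrier (L\<lparr>carrier := H\<rparr>)" "w \<in> carrier (L\<lparr>carrier := H\<rparr>)"
    then have zw: "z \<in> H" "w \<in> H" by auto
    then show "act x (d (z \<otimes>\<^bsub>L\<lparr>carrier := H\<rparr>\<^esub> w)) \<ominus>\<^bsub>M\<^esub> d (x \<otimes>\<^bsub>L\<^esub> (z \<otimes>\<^bsub>L\<lparr>carrier := H\<rparr>\<^esub> w)) =
        act z (act x (d w) \<ominus>\<^bsub>M\<^esub> d (x \<otimes>\<^bsub>L\<^esub> w)) \<ominus>\<^bsub>M\<^esub> act w (act x (d z) \<ominus>\<^bsub>M\<^esub> d (x \<otimes>\<^bsub>L\<^esub> z))"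
      using x bracket_leibniz[OF x H.sub_mem[OF zw(1)] H.sub_mem[OF zw(2)]]
      by (simp add: DerI_simps[OF d] act_simps bracket_in_ideal bracket_in_ideal_left H.sub_mem
          act_bracket N.M.diff_simps N.M.a_ac)
  qed
  then show ?thesis by (simp add: der_act_def)
qed

text \<open>The action is \<open>the_elem\<close> over pairs of representatives, so the choices of
  \<open>x\<close> and of \<open>d\<close> have to be shown irrelevant together.\<close>

lemma H1_act_coset:
  assumes d: "d \<in> carrier DerI" and x: "x \<in> carrier L"
  shows "H1_act K L H M act (H +>\<^bsub>L\<^esub> x) (InnI +>\<^bsub>DerI\<^esub> d) = InnI +>\<^bsub>DerI\<^esub> der_act L H M act x d"
proof -
  have *: "InnI +>\<^bsub>DerI\<^esub> der_act L H M act y e = InnI +>\<^bsub>DerI\<^esub> der_act L H M act x d"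
    if y: "y \<in> H +>\<^bsub>L\<^esub> x" and e: "e \<in> InnI +>\<^bsub>DerI\<^esub> d" for y e
  proof -
    obtain h where h: "h \<in> H" "y = h \<oplus>\<^bsub>L\<^esub> x" using y by (auto simp: H.mem_coset_iff)
    obtain i where "i \<in> InnI" "e = i \<oplus>\<^bsub>DerI\<^esub> d" using e by (auto simp: I.Inn.mem_coset_iff)
    then obtain m where m: "m \<in> carrier M" "e = (\<lambda>z\<in>H. act z m) \<oplus>\<^bsub>DerI\<^esub> d"
      by (auto simp: Inn_def)
    have yL: "y \<in> carrier L" and eD: "e \<in> carrier DerI"
      using y e x d H.coset_mem I.Inn.coset_mem by auto
    \<comment> \<open>Replacing \<open>x\<close> by h + x adds the inner derivation of
      \<open>d h\<close>, because \<open>d\<close> is a derivation on H; adding the inner derivation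
      of \<open>m\<close> to \<open>d\<close> contributes that of \<open>act y m\<close>.\<close>
    have "der_act L H M act y e =
        (\<lambda>z\<in>H. act z (act y m \<oplus>\<^bsub>M\<^esub> d h)) \<oplus>\<^bsub>DerI\<^esub> der_act L H M act x d"
      using x h m
      by (auto simp: der_act_def fun_eq_iff I.Der_sel act_simps H.sub_mem bracket_simps
          bracket_in_ideal DerI_simps[OF d] act_bracket H.sub_add N.M.diff_simps N.M.a_ac)
    moreover have "(\<lambda>z\<in>H. act z (act y m \<oplus>\<^bsub>M\<^esub> d h)) \<in> InnI"
      using yL m h DerI_simps(1)[OF d] by (auto simp: Inn_def act_simps)
    ultimately show ?thesis
      using der_act_Der[OF d x] der_act_Der[OF eD yL] by (subst I.Inn.coset_eq_iff) auto
  qed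
  have "(x, d) \<in> (H +>\<^bsub>L\<^esub> x) \<times> (InnI +>\<^bsub>DerI\<^esub> d)"
    using H.coset_self[OF x] I.Inn.coset_self[OF d] by simp
  then have "the_elem ((\<lambda>p. case p of (x, d) \<Rightarrow> InnI +>\<^bsub>DerI\<^esub> der_act L H M act x d) `
      ((H +>\<^bsub>L\<^esub> x) \<times> (InnI +>\<^bsub>DerI\<^esub> d))) = (case (x, d) of (x, d) \<Rightarrow> InnI +>\<^bsub>DerI\<^esub> der_act L H M act x d)"
    by (intro the_elem_image_unique) (use * in blast)+
  then show ?thesis by (simp add: H1_act_def H1_class_def)
qed

lemma invariant_ders_iff:
  assumes d: "d \<in> carrier DerI"
  shows "d \<in> invariant_ders \<longleftrightarrow> (\<forall>x\<in>carrier L. der_act L H M act x d \<in> InnI)"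
proof -
  have "restrict f H = restrict g H \<longleftrightarrow> (\<forall>z\<in>H. f z = g z)" for f g :: "'l \<Rightarrow> 'm"
    by (auto simp: fun_eq_iff restrict_def)
  then show ?thesis
    using d by (simp add: invariant_ders_def der_act_def Inn_def image_iff)
qed

text \<open>Written as a quotient by a subspace, the target of restriction and source of
  transgression falls under the facts on induced maps.\<close>

lemma H1_invariants_eq: "H1_invariants K L H M act = quot (DerI\<lparr>carrier := invariant_ders\<rparr>) InnI"
proof -
  have "{c \<in> carrier (quot DerI InnI). \<forall>X\<in>carrier (quot L H). H1_act K L H M act X c = InnI} =
      (\<lambda>d. InnI +>\<^bsub>DerI\<^esub> d) ` invariant_ders"
  proof -
    have "(\<forall>X\<in>carrier (quot L H). H1_act K L H M act X (InnI +>\<^bsub>DerI\<^esub> d) = InnI) \<longleftrightarrow>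
        d \<in> invariant_ders" if d: "d \<in> carrier DerI" for d
      using d by (simp add: H.quot_carrier H1_act_coset I.Inn.coset_eq_self_iff der_act_Der
          invariant_ders_iff)
    then show ?thesis
      using invariant_dersD by (auto simp: I.Inn.quot_carrier)
  qed
  then show ?thesis
    by (simp add: H1_invariants_def H1_def invariants_def quot_carrier_update I.Inn.quot_zero)
qed

abbreviation "H1I \<equiv> H1_invariants K L H M act"

text \<open>\<open>H1_class\<close> forms cosets in the space of all derivations of H; as sets they
  agree with those formed in the subspace of invariant ones.\<close>

lemma res_eq: "res K L H M act = (\<lambda>c. the_elem ((\<lambda>d. InnI +>\<^bsub>DerI\<lparr>carrier := invariant_ders\<rparr>\<^esub> restrict d H) ` c))"
  by (simp add: res_def H1_class_def a_r_coset_carrier_update fun_eq_iff)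

lemma linear_res_class:
  "linear_map K DerG H1I (\<lambda>d. InnI +>\<^bsub>DerI\<lparr>carrier := invariant_ders\<rparr>\<^esub> restrict d H)"
  unfolding H1_invariants_eq by (rule linear_map_comp[OF linear_res_der DI.linear_map_coset])

lemma res_class_inner:
  "d \<in> InnG \<Longrightarrow> InnI +>\<^bsub>DerI\<lparr>carrier := invariant_ders\<rparr>\<^esub> restrict d H = \<zero>\<^bsub>H1I\<^esub>"
  unfolding H1_invariants_eq
  using res_InnG DI.coset_eq_self_iff DI.sub_mem by (simp add: DI.quot_zero)

lemma linear_res: "linear_map K H1G H1I (res K L H M act)"
  unfolding res_eq using G.Inn.linear_induced_map[OF linear_res_class res_class_inner]
  by (simp add: H1_def)

lemma res_coset:
  "d \<in> carrier DerG \<Longrightarrow>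
    res K L H M act (InnG +>\<^bsub>DerG\<^esub> d) = InnI +>\<^bsub>DerI\<lparr>carrier := invariant_ders\<rparr>\<^esub> restrict d H"
  unfolding res_eq by (rule G.Inn.induced_map_coset[OF linear_res_class res_class_inner])

lemma res_coset_zero_iff:
  assumes "d \<in> carrier DerG"
  shows "res K L H M act (InnG +>\<^bsub>DerG\<^esub> d) = \<zero>\<^bsub>H1I\<^esub> \<longleftrightarrow> restrict d H \<in> InnI"
  using assms res_Der[OF assms] DI.coset_eq_self_iff[of "restrict d H"]
  by (simp add: res_coset H1_invariants_eq DI.quot_zero)

section \<open>Exactness at H^1(L, M)\<close>

text \<open>Applying \<open>d\<close> to [z, x], which lies in H, gives 0 = z d(x), so all values of
  \<open>d\<close> are H-invariant; and a linear map that vanishes on H factors through L/H.\<close>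

lemma Der_vanishing_descends:
  assumes d: "d \<in> carrier DerG" and van: "\<And>z. z \<in> H \<Longrightarrow> d z = \<zero>\<^bsub>M\<^esub>"
  shows "\<exists>e\<in>carrier DerQ. inf_der e = d"
proof -
  have dMH: "d x \<in> MH" if x: "x \<in> carrier L" for x
  proof -
    have "act z (d x) = \<zero>\<^bsub>M\<^esub>" if z: "z \<in> H" for z
    proof -
      have "\<zero>\<^bsub>M\<^esub> = d (z \<otimes>\<^bsub>L\<^esub> x)" using van bracket_in_ideal_left z x by simp
      also have "\<dots> = act z (d x)"
        using z x by (simp add: DerG_simps[OF d] H.sub_mem van act_simps N.M.diff_zero)
      finally show ?thesis by simp
    qed
    then show ?thesis using DerG_simps(1)[OF d x] by simp
  qed
  define e where "e = (\<lambda>X. the_elem (d ` X))"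
  have lin: "linear_map K (quot L H) (M\<lparr>carrier := MH\<rparr>) e"
    unfolding e_def using G.DerD(2)[OF d] dMH van
    by (intro H.linear_induced_map MH.linear_into_sub) auto
  have e: "e (H +>\<^bsub>L\<^esub> x) = d x" if "x \<in> carrier L" for x
    unfolding e_def using H.induced_map_coset[OF G.DerD(2)[OF d] van that] .
  have "restrict e (carrier (quot L H)) \<in> carrier DerQ"
  proof (rule Q.DerI)
    show "linear_map K (quot L H) (invariants H M act) e" using lin by (simp add: invariants_eq)
  next
    fix X Y assume X: "X \<in> carrier (quot L H)" and Y: "Y \<in> carrier (quot L H)"
    obtain x where x: "x \<in> carrier L" "X = H +>\<^bsub>L\<^esub> x" by (rule H.quot_cases[OF X])
    obtain y where y: "y \<in> carrier L" "Y = H +>\<^bsub>L\<^esub> y" by (rule H.quot_cases[OF Y])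
    have "e (X \<otimes>\<^bsub>quot L H\<^esub> Y) = act x (d y) \<ominus>\<^bsub>M\<^esub> act y (d x)"
      using x y by (simp add: quot_bracket e bracket_closed DerG_simps[OF d])
    also have "\<dots> = act x (d y) \<ominus>\<^bsub>M\<lparr>carrier := MH\<rparr>\<^esub> act y (d x)"
      using x y by (intro MH.diff_sub[symmetric] act_invariants dMH)
    also have "\<dots> = quot_act act X (e Y) \<ominus>\<^bsub>M\<lparr>carrier := MH\<rparr>\<^esub> quot_act act Y (e X)"
      using x y by (simp only: e quot_act_coset dMH)
    finally show "e (X \<otimes>\<^bsub>quot L H\<^esub> Y) =
        quot_act act X (e Y) \<ominus>\<^bsub>invariants H M act\<^esub> quot_act act Y (e X)"
      by (simp add: invariants_eq)
  qed
  moreover have "inf_der (restrict e (carrier (quot L H))) = d"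
    using G.DerD(1)[OF d] by (auto simp: inf_der_def H.quotI e fun_eq_iff extensional_def)
  ultimately show ?thesis by blast
qed

lemma image_infl: "infl K L H M act ` carrier H1Q = a_kernel H1G H1I (res K L H M act)"
proof (intro equalityI subsetI)
  fix c assume "c \<in> infl K L H M act ` carrier H1Q"
  then obtain e where e: "e \<in> carrier DerQ" "c = InnG +>\<^bsub>DerG\<^esub> inf_der e"
    by (auto simp: H1_def Q.Inn.quot_carrier infl_coset)
  have "inf_der e z = \<zero>\<^bsub>M\<^esub>" if z: "z \<in> H" for z
  proof -
    have "H +>\<^bsub>L\<^esub> z = \<zero>\<^bsub>quot L H\<^esub>"
      using z by (simp add: H.coset_eq_self_iff H.quot_zero H.sub_mem)
    then show ?thesis
      using z linear_map.map_zero[OF Q.DerD(2)[OF e(1)]]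
      by (simp add: inf_der_def H.sub_mem invariants_eq)
  qed
  \<comment> \<open>The zero restriction is written as the inner derivation of the zero
    element.\<close>
  then have "restrict (inf_der e) H = (\<lambda>z\<in>H. act z \<zero>\<^bsub>M\<^esub>)"
    by (auto simp: act_simps H.sub_mem fun_eq_iff)
  then have "restrict (inf_der e) H \<in> InnI" by (auto simp: Inn_def)
  then show "c \<in> a_kernel H1G H1I (res K L H M act)"
    using e inf_der_Der[OF e(1)]
    by (simp add: a_kernel_eq res_coset_zero_iff H1_def G.Inn.quotI)
next
  fix c assume "c \<in> a_kernel H1G H1I (res K L H M act)"
  then obtain d where d: "d \<in> carrier DerG" "c = InnG +>\<^bsub>DerG\<^esub> d" "restrict d H \<in> InnI"
    by (auto simp: a_kernel_eq H1_def G.Inn.quot_carrier res_coset_zero_iff)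
  then obtain m where m: "m \<in> carrier M" "restrict d H = (\<lambda>z\<in>H. act z m)"
    by (auto simp: Inn_def)
  \<comment> \<open>Subtracting the inner derivation of L with the same \<open>m\<close> keeps the
    class and makes the derivation vanish on H.\<close>
  define i where "i = (\<lambda>x\<in>carrier L. act x m)"
  have i: "i \<in> InnG" "i \<in> carrier DerG" using m G.inner_Der by (auto simp: Inn_def i_def)
  have dz: "d z = i z" if "z \<in> H" for z
    using fun_cong[OF m(2), of z] that by (simp add: i_def H.sub_mem)
  \<comment> \<open>\<open>Der_sel\<close> describes sums pointwise, so the values of the difference
    are read off from this sum.\<close>
  have di: "d = (d \<ominus>\<^bsub>DerG\<^esub> i) \<oplus>\<^bsub>DerG\<^esub> i"
    using d i by (simp add: G.Inn.V.M.diff_simps)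
  define d' where "d' = d \<ominus>\<^bsub>DerG\<^esub> i"
  have d': "d' \<in> carrier DerG" using d i by (simp add: d'_def)
  have "d' z = \<zero>\<^bsub>M\<^esub>" if z: "z \<in> H" for z
  proof -
    have "d z = d' z \<oplus>\<^bsub>M\<^esub> i z"
      using fun_cong[OF di, of z] z by (simp add: G.Der_sel H.sub_mem d'_def)
    then show ?thesis
      using z dz DerG_simps(1)[OF d'] DerG_simps(1)[OF i(2)] H.sub_mem by simp
  qed
  then obtain e where e: "e \<in> carrier DerQ" "inf_der e = d'"
    using Der_vanishing_descends[OF d'] by blast
  have "d = i \<oplus>\<^bsub>DerG\<^esub> d'" using di d' i by (simp add: d'_def G.Inn.V.M.a_comm)
  then have "c = InnG +>\<^bsub>DerG\<^esub> inf_der e"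
    unfolding d(2) e(2) using d(1) d' i(1) by (subst G.Inn.coset_eq_iff) auto
  then show "c \<in> infl K L H M act ` carrier H1Q"
    using e(1) infl_coset[OF e(1)] by (auto simp: H1_def Q.Inn.quot_carrier intro!: image_eqI)
qed

end

section \<open>The transgression\<close>

context lie_ideal_module
begin

section \<open>The semidirect product and the idealizer of the graph\<close>

lemma semidirect_sel:
  "carrier (semidirect L M act) = carrier M \<times> carrier L"
  "(m, x) \<otimes>\<^bsub>semidirect L M act\<^esub> (n, y) = (act x n \<ominus>\<^bsub>M\<^esub> act y m, x \<otimes>\<^bsub>L\<^esub> y)"
  "\<zero>\<^bsub>semidirect L M act\<^esub> = (\<zero>\<^bsub>M\<^esub>, \<zero>\<^bsub>L\<^esub>)"
  "(m, x) \<oplus>\<^bsub>semidirect L M act\<^esub> (n, y) = (m \<oplus>\<^bsub>M\<^esub> n, x \<oplus>\<^bsub>L\<^esub> y)"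
  "c \<odot>\<^bsub>semidirect L M act\<^esub> (m, x) = (c \<odot>\<^bsub>M\<^esub> m, c \<odot>\<^bsub>L\<^esub> x)"
  by (simp_all add: semidirect_def)

lemma module_semidirect: "Module.module K (semidirect L M act)"
proof (rule moduleI[OF K.is_cring])
  show "abelian_group (semidirect L M act)"
  proof (rule abelian_groupI)
    fix u assume "u \<in> carrier (semidirect L M act)"
    then obtain m x where "u = (m, x)" "m \<in> carrier M" "x \<in> carrier L"
      by (auto simp: semidirect_sel)
    then show "\<exists>v\<in>carrier (semidirect L M act). v \<oplus>\<^bsub>semidirect L M act\<^esub> u = \<zero>\<^bsub>semidirect L M act\<^esub>"
      by (intro bexI[of _ "(\<ominus>\<^bsub>M\<^esub> m, \<ominus>\<^bsub>L\<^esub> x)"])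
        (auto simp: semidirect_sel N.M.l_neg L.M.l_neg)
  qed (auto simp: semidirect_sel N.M.a_ac L.M.a_ac)
qed (auto simp: semidirect_sel N.smult_l_distr L.smult_l_distr N.smult_r_distr L.smult_r_distr
    N.smult_assoc1 L.smult_assoc1)

abbreviation "E \<equiv> graph_idealizer L H M act"

lemma E_sel:
  "(m, x) \<otimes>\<^bsub>E d\<^esub> (n, y) = (act x n \<ominus>\<^bsub>M\<^esub> act y m, x \<otimes>\<^bsub>L\<^esub> y)"
  "\<zero>\<^bsub>E d\<^esub> = (\<zero>\<^bsub>M\<^esub>, \<zero>\<^bsub>L\<^esub>)"
  "(m, x) \<oplus>\<^bsub>E d\<^esub> (n, y) = (m \<oplus>\<^bsub>M\<^esub> n, x \<oplus>\<^bsub>L\<^esub> y)"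
  "c \<odot>\<^bsub>E d\<^esub> (m, x) = (c \<odot>\<^bsub>M\<^esub> m, c \<odot>\<^bsub>L\<^esub> x)"
  by (simp_all add: graph_idealizer_def semidirect_sel)

text \<open>[(m, x), (d z, z)] has second component [x, z] in H, so it lies in the graph exactly
  when its first component is d [x, z]. Read differently: the inner derivation of \<open>m\<close>
  is the effect of \<open>x\<close> on \<open>d\<close>.\<close>

lemma E_iff:
  assumes d: "d \<in> carrier DerI"
  shows "(m, x) \<in> carrier (E d) \<longleftrightarrow> m \<in> carrier M \<and> x \<in> carrier L \<and>
    (\<forall>z\<in>H. act z m = act x (d z) \<ominus>\<^bsub>M\<^esub> d (x \<otimes>\<^bsub>L\<^esub> z))"
proof -
  have "(act x (d z) \<ominus>\<^bsub>M\<^esub> act z m, x \<otimes>\<^bsub>L\<^esub> z) \<in> der_graph H d \<longleftrightarrow>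
      act z m = act x (d z) \<ominus>\<^bsub>M\<^esub> d (x \<otimes>\<^bsub>L\<^esub> z)"
    if "m \<in> carrier M" "x \<in> carrier L" "z \<in> H" for z
    using that
    by (auto simp: der_graph_def image_iff bracket_in_ideal DerI_simps[OF d] act_simps H.sub_mem
        N.M.diff_simps N.M.a_ac)
  then show ?thesis
    by (auto simp: graph_idealizer_def semidirect_sel der_graph_def)
qed

lemma E_act:
  "\<lbrakk>d \<in> carrier DerI; (m, x) \<in> carrier (E d); z \<in> H\<rbrakk> \<Longrightarrow>
    act z m = act x (d z) \<ominus>\<^bsub>M\<^esub> d (x \<otimes>\<^bsub>L\<^esub> z)"
  by (simp add: E_iff)

lemma E_bracket:
  assumes d: "d \<in> carrier DerI" and mx: "(m, x) \<in> carrier (E d)" and ny: "(n, y) \<in> carrier (E d)"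
  shows "(act x n \<ominus>\<^bsub>M\<^esub> act y m, x \<otimes>\<^bsub>L\<^esub> y) \<in> carrier (E d)"
proof -
  have m: "m \<in> carrier M" "x \<in> carrier L" and n: "n \<in> carrier M" "y \<in> carrier L"
    using mx ny by (auto simp: E_iff[OF d])
  \<comment> \<open>The two middle terms are symmetric in \<open>x\<close> and \<open>y\<close>, so
    they drop out when this formula and the one with the roles of (m, x) and (n, y) exchanged are
    subtracted.\<close>
  have *: "act z (act x n) = act x (act y (d z)) \<ominus>\<^bsub>M\<^esub> act x (d (y \<otimes>\<^bsub>L\<^esub> z)) \<ominus>\<^bsub>M\<^esub> act y (d (x \<otimes>\<^bsub>L\<^esub> z))
      \<oplus>\<^bsub>M\<^esub> d (y \<otimes>\<^bsub>L\<^esub> (x \<otimes>\<^bsub>L\<^esub> z))"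
    if z: "z \<in> H" and n: "n \<in> carrier M" "x \<in> carrier L" "y \<in> carrier L" "(n, y) \<in> carrier (E d)"
    for x y n z
  proof -
    have "act z (act x n) = act x (act z n) \<ominus>\<^bsub>M\<^esub> act (x \<otimes>\<^bsub>L\<^esub> z) n"
      using z n by (simp add: act_bracket H.sub_mem act_simps N.M.diff_simps N.M.a_ac)
    then show ?thesis
      using z n E_act[OF d n(4) z] E_act[OF d n(4) bracket_in_ideal[OF n(2) z]]
      by (simp add: DerI_simps[OF d] H.sub_mem act_simps bracket_in_ideal N.M.diff_simps N.M.a_ac)
  qed
  have "act z (act x n \<ominus>\<^bsub>M\<^esub> act y m) = act (x \<otimes>\<^bsub>L\<^esub> y) (d z) \<ominus>\<^bsub>M\<^esub> d ((x \<otimes>\<^bsub>L\<^esub> y) \<otimes>\<^bsub>L\<^esub> z)"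
    if z: "z \<in> H" for z
  proof -
    have "d ((x \<otimes>\<^bsub>L\<^esub> y) \<otimes>\<^bsub>L\<^esub> z) = d (x \<otimes>\<^bsub>L\<^esub> (y \<otimes>\<^bsub>L\<^esub> z)) \<ominus>\<^bsub>M\<^esub> d (y \<otimes>\<^bsub>L\<^esub> (x \<otimes>\<^bsub>L\<^esub> z))"
      using bracket_jacobi_left[of x y z] m n z
      by (simp add: H.sub_mem DerI_simps[OF d] bracket_in_ideal)
    then show ?thesis
      using m n z
      by (simp add: *[OF z n(1) m(2) n(2) ny] *[OF z m(1) n(2) m(2) mx] act_bracket act_simps H.sub_mem DerI_simps[OF d] bracket_in_ideal
          N.M.diff_simps N.M.a_ac)
  qed
  then show ?thesis using m n by (simp add: E_iff[OF d] act_simps bracket_closed)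
qed

lemma submodule_E:
  assumes d: "d \<in> carrier DerI"
  shows "submodule (carrier (E d)) K (semidirect L M act)"
proof (rule module.submodule_smultI[OF module_semidirect])
  show "carrier (E d) \<subseteq> carrier (semidirect L M act)" by (auto simp: graph_idealizer_def)
  show "\<zero>\<^bsub>semidirect L M act\<^esub> \<in> carrier (E d)"
    \<comment> \<open>This instance yields [0, z] = 0.\<close>
    using bracket_smult_left[of "\<zero>\<^bsub>K\<^esub>" "\<zero>\<^bsub>L\<^esub>"]
    by (auto simp: semidirect_sel E_iff[OF d] act_simps H.sub_mem DerI_simps[OF d] bracket_closed
        N.M.diff_self)
next
  fix u v assume "u \<in> carrier (E d)" "v \<in> carrier (E d)"
  then show "u \<oplus>\<^bsub>semidirect L M act\<^esub> v \<in> carrier (E d)"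
    by (cases u; cases v)
      (simp add: semidirect_sel E_iff[OF d] act_simps H.sub_mem DerI_simps[OF d] bracket_simps
        bracket_in_ideal N.M.diff_simps N.M.a_ac)
next
  fix a u assume "a \<in> carrier K" "u \<in> carrier (E d)"
  then show "a \<odot>\<^bsub>semidirect L M act\<^esub> u \<in> carrier (E d)"
    by (cases u)
      (simp add: semidirect_sel E_iff[OF d] act_simps H.sub_mem DerI_simps[OF d] bracket_simps
        bracket_in_ideal N.smult_diff)
qed

lemma graph_iff: "(m, x) \<in> der_graph H d \<longleftrightarrow> x \<in> H \<and> m = d x"
  by (auto simp: der_graph_def)

text \<open>That the graph is contained in its own idealizer is the derivation law of
  \<open>d\<close> on H.\<close>

lemma subspace_graph:
  assumes d: "d \<in> carrier DerI"
  shows "subspace K (E d) (der_graph H d)"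
proof -
  interpret S: Module.module K "semidirect L M act" by (rule module_semidirect)
  interpret S: subspace K "semidirect L M act" "carrier (E d)"
    by (simp add: subspace_def S.module_axioms submodule_E[OF d])
  have "submodule (der_graph H d) K (semidirect L M act)"
  proof (rule S.submodule_smultI)
    show "der_graph H d \<subseteq> carrier (semidirect L M act)"
      by (auto simp: der_graph_def semidirect_sel DerI_simps[OF d] H.sub_mem)
    show "\<zero>\<^bsub>semidirect L M act\<^esub> \<in> der_graph H d"
      by (simp add: semidirect_sel graph_iff DerI_simps[OF d] H.sub_zero)
  next
    fix u v assume "u \<in> der_graph H d" "v \<in> der_graph H d"
    then show "u \<oplus>\<^bsub>semidirect L M act\<^esub> v \<in> der_graph H d"
      by (cases u; cases v) (simp add: semidirect_sel graph_iff DerI_simps[OF d] H.sub_add)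
  next
    fix a u assume "a \<in> carrier K" "u \<in> der_graph H d"
    then show "a \<odot>\<^bsub>semidirect L M act\<^esub> u \<in> der_graph H d"
      by (cases u) (simp add: semidirect_sel graph_iff DerI_simps[OF d] H.sub_smult)
  qed
  moreover have "der_graph H d \<subseteq> carrier (E d)"
  proof
    fix u assume "u \<in> der_graph H d"
    then obtain z where z: "z \<in> H" "u = (d z, z)" by (auto simp: der_graph_def)
    then show "u \<in> carrier (E d)"
      by (simp add: E_iff[OF d] DerI_simps[OF d] H.sub_mem act_simps N.M.diff_simps N.M.a_ac)
  qed
  moreover have "(semidirect L M act)\<lparr>carrier := carrier (E d)\<rparr> = E d"
    by (simp add: graph_idealizer_def)
  ultimately show ?thesis using S.subspace_sub by metis
qed

lemma linear_E_fst: "d \<in> carrier DerI \<Longrightarrow> linear_map K (E d) M fst"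
  using subspace_graph[of d]
  by (intro linear_mapI) (auto simp: subspace_def N.module_axioms E_sel E_iff)

lemma linear_E_snd: "d \<in> carrier DerI \<Longrightarrow> linear_map K (E d) L snd"
  using subspace_graph[of d]
  by (intro linear_mapI) (auto simp: subspace_def L.module_axioms E_sel E_iff)

text \<open>Subtraction in \<open>E d\<close> is defined through its carrier; the two linear
  projections reduce it to the components.\<close>

lemma E_diff:
  assumes "d \<in> carrier DerI" "(m, x) \<in> carrier (E d)" "(n, y) \<in> carrier (E d)"
  shows "(m, x) \<ominus>\<^bsub>E d\<^esub> (n, y) = (m \<ominus>\<^bsub>M\<^esub> n, x \<ominus>\<^bsub>L\<^esub> y)"
  using linear_map.map_diff[OF linear_E_fst assms(2,3)] linear_map.map_diff[OF linear_E_snd assms(2,3)]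
    assms(1) by (intro prod_eqI) auto

section \<open>A linear section of L -> L/H\<close>

text \<open>The section is chosen once, so that the constructions below can be constants of the
  locale instead of carrying it as a parameter.\<close>

definition lin_sec :: "'l set \<Rightarrow> 'l" where
  "lin_sec = (SOME t. linear_map K (quot L H) L t \<and> (\<forall>X\<in>carrier (quot L H). H +>\<^bsub>L\<^esub> t X = X))"

lemma lin_sec: "linear_map K (quot L H) L lin_sec \<and> (\<forall>X\<in>carrier (quot L H). H +>\<^bsub>L\<^esub> lin_sec X = X)"
  unfolding lin_sec_def
  using ex_linear_section[OF K.field_axioms H.linear_map_coset H.quot_carrier[symmetric]]
  by (rule someI_ex)

sublocale lin_sec: linear_map K "quot L H" L lin_sec
  using lin_sec by blast

lemma lin_sec_coset: "X \<in> carrier (quot L H) \<Longrightarrow> H +>\<^bsub>L\<^esub> lin_sec X = X"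
  using lin_sec by blast

lemma diff_lin_sec: "x \<in> carrier L \<Longrightarrow> x \<ominus>\<^bsub>L\<^esub> lin_sec (H +>\<^bsub>L\<^esub> x) \<in> H"
proof -
  assume x: "x \<in> carrier L"
  have t: "lin_sec (H +>\<^bsub>L\<^esub> x) \<in> carrier L" using x H.quotI lin_sec.linear_closed by blast
  obtain u where "u \<in> H" "x = u \<oplus>\<^bsub>L\<^esub> lin_sec (H +>\<^bsub>L\<^esub> x)"
    using H.coset_eq_iff[OF x t] lin_sec_coset[OF H.quotI[OF x]] by auto
  then have "x \<ominus>\<^bsub>L\<^esub> lin_sec (H +>\<^bsub>L\<^esub> x) = u"
    using x t by (simp add: L.M.diff_simps H.sub_mem)
  then show ?thesis using \<open>u \<in> H\<close> by simp
qed

abbreviation "br \<equiv> mult (quot L H)"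

lemma br_closed: "\<lbrakk>X \<in> carrier (quot L H); Y \<in> carrier (quot L H)\<rbrakk> \<Longrightarrow> br X Y \<in> carrier (quot L H)"
  by (rule Q.bracket_closed)

text \<open>Measures how far \<open>lin_sec\<close> is from a homomorphism. Its values lie in H,
  where \<open>d\<close> is defined.\<close>

definition defect :: "'l set \<Rightarrow> 'l set \<Rightarrow> 'l" where
  "defect X Y = lin_sec X \<otimes>\<^bsub>L\<^esub> lin_sec Y \<ominus>\<^bsub>L\<^esub> lin_sec (br X Y)"

lemma defect_mem:
  assumes "X \<in> carrier (quot L H)" "Y \<in> carrier (quot L H)"
  shows "defect X Y \<in> H"
proof -
  have "H +>\<^bsub>L\<^esub> (lin_sec X \<otimes>\<^bsub>L\<^esub> lin_sec Y) = br X Y"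
    using quot_bracket[of "lin_sec X" "lin_sec Y"] assms
    by (simp add: lin_sec.linear_closed lin_sec_coset)
  then show ?thesis
    using diff_lin_sec[of "lin_sec X \<otimes>\<^bsub>L\<^esub> lin_sec Y"] assms
    by (simp add: defect_def lin_sec.linear_closed bracket_closed)
qed

section \<open>Liftings and their cocycles\<close>

text \<open>Membership in \<open>E d\<close> says that the inner derivation of \<mu> X is the effect
  of \<open>lin_sec X\<close> on \<open>d\<close>; thus \<mu> chooses, linearly in X, the elements
  that invariance of the class of \<open>d\<close> promises.\<close>

definition lifting :: "('l \<Rightarrow> 'm) \<Rightarrow> ('l set \<Rightarrow> 'm) \<Rightarrow> bool" where
  "lifting d \<mu> \<longleftrightarrow> linear_map K (quot L H) M \<mu> \<and>
     (\<forall>X\<in>carrier (quot L H). (\<mu> X, lin_sec X) \<in> carrier (E d))"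

text \<open>The cocycle \<open>[s X, s Y] - s [X, Y]\<close> for \<open>s X\<close> the class of \<open>(\<mu> X, lin_sec X)\<close> in \<open>I/s\<^sub>d(H)\<close>.\<close>

definition curv :: "('l \<Rightarrow> 'm) \<Rightarrow> ('l set \<Rightarrow> 'm) \<Rightarrow> 'l set \<Rightarrow> 'l set \<Rightarrow> 'm" where
  "curv d \<mu> X Y = act (lin_sec X) (\<mu> Y) \<ominus>\<^bsub>M\<^esub> act (lin_sec Y) (\<mu> X) \<ominus>\<^bsub>M\<^esub> \<mu> (br X Y) \<ominus>\<^bsub>M\<^esub> d (defect X Y)"

definition curv_cocycle :: "('l \<Rightarrow> 'm) \<Rightarrow> ('l set \<Rightarrow> 'm) \<Rightarrow> 'l set \<times> 'l set \<Rightarrow> 'm" where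
  "curv_cocycle d \<mu> = (\<lambda>(X, Y)\<in>carrier (quot L H) \<times> carrier (quot L H). curv d \<mu> X Y)"

text \<open>The pair is the bracket of the lifts of X and Y, minus the lift of [X, Y], minus the
  graph element over \<open>defect X Y\<close>; all three lie in \<open>E d\<close>, which is closed
  under brackets and differences.\<close>

lemma curv_E:
  assumes d: "d \<in> carrier DerI" and \<mu>: "lifting d \<mu>"
    and XY: "X \<in> carrier (quot L H)" "Y \<in> carrier (quot L H)"
  shows "(curv d \<mu> X Y, \<zero>\<^bsub>L\<^esub>) \<in> carrier (E d)"
proof -
  interpret Gr: subspace K "E d" "der_graph H d" by (rule subspace_graph[OF d])
  have E: "(\<mu> X, lin_sec X) \<in> carrier (E d)" if "X \<in> carrier (quot L H)" for X
    using \<mu> that by (simp add: lifting_def)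
  note b = E_bracket[OF d E[OF XY(1)] E[OF XY(2)]] and c = E[OF br_closed[OF XY]]
  have g: "(d (defect X Y), defect X Y) \<in> carrier (E d)"
    using defect_mem[OF XY] by (intro Gr.sub_mem) (simp add: graph_iff)
  have dL: "defect X Y \<in> carrier L" using defect_mem[OF XY] H.sub_mem by blast
  have "((act (lin_sec X) (\<mu> Y) \<ominus>\<^bsub>M\<^esub> act (lin_sec Y) (\<mu> X), lin_sec X \<otimes>\<^bsub>L\<^esub> lin_sec Y) \<ominus>\<^bsub>E d\<^esub>
      (\<mu> (br X Y), lin_sec (br X Y))) \<ominus>\<^bsub>E d\<^esub> (d (defect X Y), defect X Y) \<in> carrier (E d)"
    using b c g by (intro Gr.V.M.minus_closed)
  moreover have "(act (lin_sec X) (\<mu> Y) \<ominus>\<^bsub>M\<^esub> act (lin_sec Y) (\<mu> X) \<ominus>\<^bsub>M\<^esub> \<mu> (br X Y), defect X Y)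
      \<in> carrier (E d)"
    using Gr.V.M.minus_closed[OF b c] by (simp add: E_diff[OF d b c] defect_def)
  ultimately show ?thesis
    using g by (simp add: E_diff[OF d b c] E_diff[OF d _ g] curv_def L.M.diff_self dL
        flip: defect_def)
qed

text \<open>At x = 0 the membership condition reads z m = 0. This is the copy of M^H inside the
  idealizer.\<close>

lemma E_zero_iff: "d \<in> carrier DerI \<Longrightarrow> (m, \<zero>\<^bsub>L\<^esub>) \<in> carrier (E d) \<longleftrightarrow> m \<in> MH"
proof -
  assume d: "d \<in> carrier DerI"
  have "\<zero>\<^bsub>L\<^esub> \<otimes>\<^bsub>L\<^esub> z = \<zero>\<^bsub>L\<^esub>" if "z \<in> H" for z
    using linear_map.map_zero[OF bracket_linear_left[OF H.sub_mem[OF that]]] .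
  then show ?thesis
    by (auto simp: E_iff[OF d] act_simps DerI_simps[OF d] N.M.diff_self)
qed

lemma curv_MH:
  assumes "d \<in> carrier DerI" "lifting d \<mu>" "X \<in> carrier (quot L H)" "Y \<in> carrier (quot L H)"
  shows "curv d \<mu> X Y \<in> MH"
  using curv_E[OF assms] E_zero_iff[OF assms(1)] by blast

text \<open>\<open>defect\<close> is linear in each argument as a map into H, hence so is its
  composite with \<open>d\<close>; the other terms are composites of linear maps.\<close>

lemma linear_curv:
  assumes d: "d \<in> carrier DerI" and \<mu>: "lifting d \<mu>" and X: "X \<in> carrier (quot L H)"
  shows "linear_map K (quot L H) (invariants H M act) (\<lambda>Y. curv d \<mu> X Y)"
    and "linear_map K (quot L H) (invariants H M act) (\<lambda>Y. curv d \<mu> Y X)"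
proof -
  have \<mu>l: "linear_map K (quot L H) M \<mu>" using \<mu> by (simp add: lifting_def)
  note t = lin_sec.linear_map_axioms
  have tX: "lin_sec X \<in> carrier L" and \<mu>X: "\<mu> X \<in> carrier M"
    using lin_sec.linear_closed[OF X] linear_map.linear_closed[OF \<mu>l X] .
  have "linear_map K (quot L H) (L\<lparr>carrier := H\<rparr>) (\<lambda>Y. defect X Y)"
    unfolding defect_def using defect_mem[OF X, unfolded defect_def]
    by (intro H.linear_into_sub linear_map_diff linear_map_comp[OF t bracket_linear_right[OF tX]]
        linear_map_comp[OF Q.bracket_linear_right[OF X] t])
  note e1 = linear_map_comp[OF this I.DerD(2)[OF d]]
  have "linear_map K (quot L H) (L\<lparr>carrier := H\<rparr>) (\<lambda>Y. defect Y X)"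
    unfolding defect_def using defect_mem[OF _ X, unfolded defect_def]
    by (intro H.linear_into_sub linear_map_diff linear_map_comp[OF t bracket_linear_left[OF tX]]
        linear_map_comp[OF Q.bracket_linear_left[OF X] t])
  note e2 = linear_map_comp[OF this I.DerD(2)[OF d]]
  have "linear_map K (quot L H) M (\<lambda>Y. curv d \<mu> X Y)"
    unfolding curv_def
    by (intro linear_map_diff linear_map_comp[OF \<mu>l act_linear_right[OF tX]] e1
        linear_map_comp[OF t act_linear_left[OF \<mu>X]]
        linear_map_comp[OF Q.bracket_linear_right[OF X] \<mu>l])
  then show "linear_map K (quot L H) (invariants H M act) (\<lambda>Y. curv d \<mu> X Y)"
    unfolding invariants_eq by (rule MH.linear_into_sub) (rule curv_MH[OF d \<mu> X])
  have "linear_map K (quot L H) M (\<lambda>Y. curv d \<mu> Y X)"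
    unfolding curv_def
    by (intro linear_map_diff linear_map_comp[OF \<mu>l act_linear_right[OF tX]] e2
        linear_map_comp[OF t act_linear_left[OF \<mu>X]]
        linear_map_comp[OF Q.bracket_linear_left[OF X] \<mu>l])
  then show "linear_map K (quot L H) (invariants H M act) (\<lambda>Y. curv d \<mu> Y X)"
    unfolding invariants_eq by (rule MH.linear_into_sub) (rule curv_MH[OF d \<mu> _ X])
qed

text \<open>The share of one cyclic position in the cocycle condition. Besides the expected
  \<open>curv d \<mu> (br Y Z) X\<close> there remain a value of \<mu>, a value of \<open>d\<close>
  and terms in which L acts twice, arranged so that each kind vanishes in the cyclic sum.\<close>

lemma curv_cyclic:
  assumes d: "d \<in> carrier DerI" and \<mu>: "lifting d \<mu>"
    and X: "X \<in> carrier (quot L H)" and Y: "Y \<in> carrier (quot L H)" and Z: "Z \<in> carrier (quot L H)"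
  defines "x \<equiv> lin_sec X" and "y \<equiv> lin_sec Y" and "z \<equiv> lin_sec Z"
  shows "lin_sec (br (br Y Z) X) \<oplus>\<^bsub>L\<^esub> x \<otimes>\<^bsub>L\<^esub> (y \<otimes>\<^bsub>L\<^esub> z) \<in> H"
    and "act x (curv d \<mu> Y Z) =
      curv d \<mu> (br Y Z) X \<oplus>\<^bsub>M\<^esub> \<mu> (br (br Y Z) X) \<ominus>\<^bsub>M\<^esub> d (lin_sec (br (br Y Z) X) \<oplus>\<^bsub>L\<^esub> x \<otimes>\<^bsub>L\<^esub> (y \<otimes>\<^bsub>L\<^esub> z)) \<oplus>\<^bsub>M\<^esub>
      (act x (act y (\<mu> Z)) \<ominus>\<^bsub>M\<^esub> act x (act z (\<mu> Y)) \<ominus>\<^bsub>M\<^esub> act y (act z (\<mu> X)) \<oplus>\<^bsub>M\<^esub> act z (act y (\<mu> X)))"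
proof -
  let ?c = "lin_sec (br (br Y Z) X) \<oplus>\<^bsub>L\<^esub> x \<otimes>\<^bsub>L\<^esub> (y \<otimes>\<^bsub>L\<^esub> z)"
  interpret \<mu>: linear_map K "quot L H" M \<mu> using \<mu> by (simp add: lifting_def)
  define v where "v = lin_sec (br Y Z)"
  define w where "w = lin_sec (br (br Y Z) X)"
  have L: "x \<in> carrier L" "y \<in> carrier L" "z \<in> carrier L" "v \<in> carrier L" "w \<in> carrier L"
    using X Y Z by (simp_all add: x_def y_def z_def v_def w_def br_closed lin_sec.linear_closed)
  have m: "\<mu> X \<in> carrier M" "\<mu> Y \<in> carrier M" "\<mu> Z \<in> carrier M" "\<mu> (br Y Z) \<in> carrier M"
    "\<mu> (br (br Y Z) X) \<in> carrier M"
    using X Y Z by (simp_all add: br_closed \<mu>.linear_closed)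
  have f: "defect Y Z \<in> H" "defect (br Y Z) X \<in> H" "x \<otimes>\<^bsub>L\<^esub> defect Y Z \<in> H"
    using X Y Z L by (simp_all add: defect_mem br_closed bracket_in_ideal)
  have f': "defect Y Z = y \<otimes>\<^bsub>L\<^esub> z \<ominus>\<^bsub>L\<^esub> v" "defect (br Y Z) X = v \<otimes>\<^bsub>L\<^esub> x \<ominus>\<^bsub>L\<^esub> w"
    by (simp_all add: defect_def v_def w_def x_def y_def z_def)
  have vx: "v \<otimes>\<^bsub>L\<^esub> x = \<ominus>\<^bsub>L\<^esub> (x \<otimes>\<^bsub>L\<^esub> v)" using L by (intro bracket_antisym)
  \<comment> \<open>The lift \<open>v\<close> of [Y, Z] cancels. What is left has as cyclic sum a
    Jacobi sum in L/H, carried over by \<open>lin_sec\<close>, plus one in L.\<close>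
  have c: "w \<oplus>\<^bsub>L\<^esub> x \<otimes>\<^bsub>L\<^esub> (y \<otimes>\<^bsub>L\<^esub> z) = x \<otimes>\<^bsub>L\<^esub> defect Y Z \<ominus>\<^bsub>L\<^esub> defect (br Y Z) X"
    unfolding f' vx using L by (simp add: bracket_simps L.M.diff_simps L.M.a_ac)
  show cH: "?c \<in> H" using f H.sub_diff by (simp add: c flip: w_def)
  have dc: "d ?c = d (x \<otimes>\<^bsub>L\<^esub> defect Y Z) \<ominus>\<^bsub>M\<^esub> d (defect (br Y Z) X)"
    using f by (simp add: c DerI_simps[OF d] flip: w_def)
  have EX: "(\<mu> X, x) \<in> carrier (E d)" using \<mu> X by (simp add: lifting_def x_def)
  have "act (defect Y Z) (\<mu> X) = act y (act z (\<mu> X)) \<ominus>\<^bsub>M\<^esub> act z (act y (\<mu> X)) \<ominus>\<^bsub>M\<^esub> act v (\<mu> X)"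
    unfolding f' using L m by (simp add: act_simps act_bracket bracket_closed)
  \<comment> \<open>Membership of (\<mu> X, x) in \<open>E d\<close>, tested on
    \<open>defect Y Z\<close>, trades the action of \<open>x\<close> on
    \<open>d (defect Y Z)\<close> for \<open>d\<close> of a bracket.\<close>
  then have xd: "act x (d (defect Y Z)) = act y (act z (\<mu> X)) \<ominus>\<^bsub>M\<^esub> act z (act y (\<mu> X)) \<ominus>\<^bsub>M\<^esub> act v (\<mu> X)
      \<oplus>\<^bsub>M\<^esub> d (x \<otimes>\<^bsub>L\<^esub> defect Y Z)"
    using E_act[OF d EX f(1)] L m f
    by (simp add: DerI_simps[OF d] act_simps N.M.diff_simps N.M.a_ac)
  have "act x (curv d \<mu> Y Z) = act x (act y (\<mu> Z)) \<ominus>\<^bsub>M\<^esub> act x (act z (\<mu> Y)) \<ominus>\<^bsub>M\<^esub> act x (\<mu> (br Y Z)) \<ominus>\<^bsub>M\<^esub>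
      act x (d (defect Y Z))"
    using L m f by (simp add: curv_def act_simps DerI_simps[OF d] flip: y_def z_def)
  moreover have "curv d \<mu> (br Y Z) X = act v (\<mu> X) \<ominus>\<^bsub>M\<^esub> act x (\<mu> (br Y Z)) \<ominus>\<^bsub>M\<^esub>
      \<mu> (br (br Y Z) X) \<ominus>\<^bsub>M\<^esub> d (defect (br Y Z) X)"
    by (simp add: curv_def v_def x_def)
  ultimately show "act x (curv d \<mu> Y Z) =
      curv d \<mu> (br Y Z) X \<oplus>\<^bsub>M\<^esub> \<mu> (br (br Y Z) X) \<ominus>\<^bsub>M\<^esub> d ?c \<oplus>\<^bsub>M\<^esub>
      (act x (act y (\<mu> Z)) \<ominus>\<^bsub>M\<^esub> act x (act z (\<mu> Y)) \<ominus>\<^bsub>M\<^esub> act y (act z (\<mu> X)) \<oplus>\<^bsub>M\<^esub> act z (act y (\<mu> X)))"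
    unfolding dc xd using L m f
    by (simp add: act_closed DerI_simps(1)[OF d] N.M.diff_simps N.M.a_ac)
qed

text \<open>The condition is checked on the explicit formula, by summing \<open>curv_cyclic\<close>
  over the cyclic permutations of X, Y, Z.\<close>

lemma curv_cocycle_cocycle:
  assumes d: "d \<in> carrier DerI" and \<mu>: "lifting d \<mu>"
  shows "curv_cocycle d \<mu> \<in> carrier (cocycles2 K (quot L H) (invariants H M act) (quot_act act))"
  unfolding curv_cocycle_def
proof (rule Q.cocycles2I)
  interpret \<mu>: linear_map K "quot L H" M \<mu> using \<mu> by (simp add: lifting_def)
  {
    fix X assume "X \<in> carrier (quot L H)"
    then show "linear_map K (quot L H) (invariants H M act) (\<lambda>Y. case (X, Y) of (X, Y) \<Rightarrow> curv d \<mu> X Y)"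
      and "linear_map K (quot L H) (invariants H M act) (\<lambda>Y. case (Y, X) of (X, Y) \<Rightarrow> curv d \<mu> X Y)"
      using linear_curv[OF d \<mu>] by simp_all
  next
    fix X assume X: "X \<in> carrier (quot L H)"
    have "defect X X = \<zero>\<^bsub>L\<^esub>"
      using X by (simp add: defect_def bracket_alternating Q.bracket_alternating
          lin_sec.linear_closed lin_sec.map_zero L.M.diff_self)
    then show "(case (X, X) of (X, Y) \<Rightarrow> curv d \<mu> X Y) = \<zero>\<^bsub>invariants H M act\<^esub>"
      using X by (simp add: curv_def Q.bracket_alternating \<mu>.linear_closed \<mu>.map_zero act_closed
          lin_sec.linear_closed DerI_simps[OF d] N.M.diff_self invariants_sel)
  next
    fix X Y Z
    assume X: "X \<in> carrier (quot L H)" and Y: "Y \<in> carrier (quot L H)" and Z: "Z \<in> carrier (quot L H)"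
    define x y z where xyz: "x = lin_sec X" "y = lin_sec Y" "z = lin_sec Z"
    have L: "x \<in> carrier L" "y \<in> carrier L" "z \<in> carrier L"
      using X Y Z by (simp_all add: xyz lin_sec.linear_closed)
    have m: "\<mu> X \<in> carrier M" "\<mu> Y \<in> carrier M" "\<mu> Z \<in> carrier M"
      using X Y Z by (simp_all add: \<mu>.linear_closed)
    define a b c where abc: "a = br (br Y Z) X" "b = br (br Z X) Y" "c = br (br X Y) Z"
    have abcQ: "a \<in> carrier (quot L H)" "b \<in> carrier (quot L H)" "c \<in> carrier (quot L H)"
      using X Y Z by (simp_all add: abc br_closed)
    have abc0: "a \<oplus>\<^bsub>quot L H\<^esub> b \<oplus>\<^bsub>quot L H\<^esub> c = \<zero>\<^bsub>quot L H\<^esub>"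
      unfolding abc by (rule Q.jacobi_left[OF Y Z X])
    define p q r where pqr: "p = lin_sec a \<oplus>\<^bsub>L\<^esub> x \<otimes>\<^bsub>L\<^esub> (y \<otimes>\<^bsub>L\<^esub> z)"
      "q = lin_sec b \<oplus>\<^bsub>L\<^esub> y \<otimes>\<^bsub>L\<^esub> (z \<otimes>\<^bsub>L\<^esub> x)" "r = lin_sec c \<oplus>\<^bsub>L\<^esub> z \<otimes>\<^bsub>L\<^esub> (x \<otimes>\<^bsub>L\<^esub> y)"
    have pqrH: "p \<in> H" "q \<in> H" "r \<in> H"
      using curv_cyclic(1)[OF d \<mu> X Y Z] curv_cyclic(1)[OF d \<mu> Y Z X] curv_cyclic(1)[OF d \<mu> Z X Y]
      by (simp_all add: pqr xyz abc)
    \<comment> \<open>Jacobi is used twice, once in L/H under \<open>lin_sec\<close> and once in L,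
      so that \<open>d\<close> is applied to zero.\<close>
    have "p \<oplus>\<^bsub>L\<^esub> q \<oplus>\<^bsub>L\<^esub> r = lin_sec (a \<oplus>\<^bsub>quot L H\<^esub> b \<oplus>\<^bsub>quot L H\<^esub> c) \<oplus>\<^bsub>L\<^esub>
        (x \<otimes>\<^bsub>L\<^esub> (y \<otimes>\<^bsub>L\<^esub> z) \<oplus>\<^bsub>L\<^esub> y \<otimes>\<^bsub>L\<^esub> (z \<otimes>\<^bsub>L\<^esub> x) \<oplus>\<^bsub>L\<^esub> z \<otimes>\<^bsub>L\<^esub> (x \<otimes>\<^bsub>L\<^esub> y))"
      using L abcQ by (simp add: pqr lin_sec.linear_simps bracket_closed L.M.a_ac)
    also have "\<dots> = \<zero>\<^bsub>L\<^esub>" using L by (simp add: abc0 lin_sec.map_zero jacobi)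
    finally have dpqr: "d p \<oplus>\<^bsub>M\<^esub> d q \<oplus>\<^bsub>M\<^esub> d r = \<zero>\<^bsub>M\<^esub>"
      using pqrH by (simp add: DerI_simps[OF d] H.sub_add flip: DerI_simps(2)[OF d])
    have \<mu>abc: "\<mu> a \<oplus>\<^bsub>M\<^esub> \<mu> b \<oplus>\<^bsub>M\<^esub> \<mu> c = \<zero>\<^bsub>M\<^esub>"
      using abc0 abcQ \<mu>.map_zero by (simp flip: \<mu>.linear_add)
    have F: "curv d \<mu> X Y \<in> carrier M" "curv d \<mu> X Y \<in> MH" if "X \<in> carrier (quot L H)" "Y \<in> carrier (quot L H)" for X Y
      using curv_MH[OF d \<mu> that] by auto
    have Fx: "act x (curv d \<mu> Y Z) = curv d \<mu> (br Y Z) X \<oplus>\<^bsub>M\<^esub> \<mu> a \<ominus>\<^bsub>M\<^esub> d p \<oplus>\<^bsub>M\<^esub>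
      (act x (act y (\<mu> Z)) \<ominus>\<^bsub>M\<^esub> act x (act z (\<mu> Y)) \<ominus>\<^bsub>M\<^esub> act y (act z (\<mu> X)) \<oplus>\<^bsub>M\<^esub> act z (act y (\<mu> X)))"
      using curv_cyclic(2)[OF d \<mu> X Y Z] by (simp add: pqr xyz abc)
    have Fy: "act y (curv d \<mu> Z X) = curv d \<mu> (br Z X) Y \<oplus>\<^bsub>M\<^esub> \<mu> b \<ominus>\<^bsub>M\<^esub> d q \<oplus>\<^bsub>M\<^esub>
      (act y (act z (\<mu> X)) \<ominus>\<^bsub>M\<^esub> act y (act x (\<mu> Z)) \<ominus>\<^bsub>M\<^esub> act z (act x (\<mu> Y)) \<oplus>\<^bsub>M\<^esub> act x (act z (\<mu> Y)))"
      using curv_cyclic(2)[OF d \<mu> Y Z X] by (simp add: pqr xyz abc)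
    have Fz: "act z (curv d \<mu> X Y) = curv d \<mu> (br X Y) Z \<oplus>\<^bsub>M\<^esub> \<mu> c \<ominus>\<^bsub>M\<^esub> d r \<oplus>\<^bsub>M\<^esub>
      (act z (act x (\<mu> Y)) \<ominus>\<^bsub>M\<^esub> act z (act y (\<mu> X)) \<ominus>\<^bsub>M\<^esub> act x (act y (\<mu> Z)) \<oplus>\<^bsub>M\<^esub> act y (act x (\<mu> Z)))"
      using curv_cyclic(2)[OF d \<mu> Z X Y] by (simp add: pqr xyz abc)
    \<comment> \<open>The twelve terms with two actions cancel in pairs.\<close>
    have "act x (curv d \<mu> Y Z) \<oplus>\<^bsub>M\<^esub> act y (curv d \<mu> Z X) \<oplus>\<^bsub>M\<^esub> act z (curv d \<mu> X Y) =
        (curv d \<mu> (br X Y) Z \<oplus>\<^bsub>M\<^esub> curv d \<mu> (br Y Z) X \<oplus>\<^bsub>M\<^esub> curv d \<mu> (br Z X) Y) \<oplus>\<^bsub>M\<^esub>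
        (\<mu> a \<oplus>\<^bsub>M\<^esub> \<mu> b \<oplus>\<^bsub>M\<^esub> \<mu> c) \<ominus>\<^bsub>M\<^esub> (d p \<oplus>\<^bsub>M\<^esub> d q \<oplus>\<^bsub>M\<^esub> d r)"
      unfolding Fx Fy Fz using L m abcQ pqrH F(1) X Y Z
      by (simp add: act_closed br_closed \<mu>.linear_closed DerI_simps(1)[OF d] N.M.diff_simps N.M.a_ac)
    also have "\<dots> = curv d \<mu> (br X Y) Z \<oplus>\<^bsub>M\<^esub> curv d \<mu> (br Y Z) X \<oplus>\<^bsub>M\<^esub> curv d \<mu> (br Z X) Y"
      unfolding \<mu>abc dpqr using F(1) X Y Z by (simp add: br_closed N.M.diff_zero)
    finally have *: "act x (curv d \<mu> Y Z) \<oplus>\<^bsub>M\<^esub> act y (curv d \<mu> Z X) \<oplus>\<^bsub>M\<^esub> act z (curv d \<mu> X Y) =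
      curv d \<mu> (br X Y) Z \<oplus>\<^bsub>M\<^esub> curv d \<mu> (br Y Z) X \<oplus>\<^bsub>M\<^esub> curv d \<mu> (br Z X) Y" .
    have qa: "quot_act act X n = act (lin_sec X) n" if "X \<in> carrier (quot L H)" "n \<in> MH" for X n
      using quot_act_coset[of "lin_sec X" n] that lin_sec_coset[of X] lin_sec.linear_closed by simp
    show "quot_act act X (case (Y, Z) of (X, Y) \<Rightarrow> curv d \<mu> X Y) \<oplus>\<^bsub>invariants H M act\<^esub>
        quot_act act Y (case (Z, X) of (X, Y) \<Rightarrow> curv d \<mu> X Y) \<oplus>\<^bsub>invariants H M act\<^esub>
        quot_act act Z (case (X, Y) of (X, Y) \<Rightarrow> curv d \<mu> X Y) =
      (case (br X Y, Z) of (X, Y) \<Rightarrow> curv d \<mu> X Y) \<oplus>\<^bsub>invariants H M act\<^esub>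
        (case (br Y Z, X) of (X, Y) \<Rightarrow> curv d \<mu> X Y) \<oplus>\<^bsub>invariants H M act\<^esub>
        (case (br Z X, Y) of (X, Y) \<Rightarrow> curv d \<mu> X Y)"
      using * by (simp only: prod.case invariants_sel qa[OF X F(2)[OF Y Z]] qa[OF Y F(2)[OF Z X]]
          qa[OF Z F(2)[OF X Y]] xyz)
  }
qed

abbreviation "C2 \<equiv> cocycles2 K (quot L H) (invariants H M act) (quot_act act)"
abbreviation "B2 \<equiv> coboundaries2 K (quot L H) (invariants H M act) (quot_act act)"
abbreviation "H2Q \<equiv> H2 K (quot L H) (invariants H M act) (quot_act act)"

lemma quot_act_lin_sec:
  "\<lbrakk>X \<in> carrier (quot L H); n \<in> MH\<rbrakk> \<Longrightarrow> quot_act act X n = act (lin_sec X) n"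
  using quot_act_coset[of "lin_sec X" n] lin_sec_coset[of X] lin_sec.linear_closed by simp

text \<open>Translates the quotient action and the operations of the record of invariants into the
  terms in which \<open>curv\<close> is written.\<close>

lemma coboundary_invariants:
  assumes b: "linear_map K (quot L H) (M\<lparr>carrier := MH\<rparr>) b"
    and XY: "X \<in> carrier (quot L H)" "Y \<in> carrier (quot L H)"
  shows "Q.coboundary b (X, Y) =
    act (lin_sec X) (b Y) \<ominus>\<^bsub>M\<^esub> act (lin_sec Y) (b X) \<ominus>\<^bsub>M\<^esub> b (br X Y)"
proof -
  have bH: "b X \<in> MH" if "X \<in> carrier (quot L H)" for X
    using linear_map.linear_closed[OF b that] by simp
  have aH: "act (lin_sec X) (b Y) \<in> MH" if "X \<in> carrier (quot L H)" "Y \<in> carrier (quot L H)" for X Y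
    using that by (intro act_invariants bH lin_sec.linear_closed)
  have "Q.coboundary b (X, Y) = act (lin_sec X) (b Y) \<ominus>\<^bsub>M\<lparr>carrier := MH\<rparr>\<^esub> act (lin_sec Y) (b X)
      \<ominus>\<^bsub>M\<lparr>carrier := MH\<rparr>\<^esub> b (br X Y)"
    using XY bH by (simp only: Q.coboundary_def prod.case restrict_apply SigmaI if_True
        quot_act_lin_sec) (simp add: invariants_eq)
  then show ?thesis
    using XY by (simp only: MH.diff_sub MH.sub_diff aH bH br_closed)
qed

text \<open>Two liftings solve the same inhomogeneous equation, so their difference takes values in
  M^H and is a 1-cochain of L/H; the term \<open>d (defect X Y)\<close> is common to both and
  cancels.\<close>

lemma curv_cocycle_cohomologous:
  assumes d: "d \<in> carrier DerI" and \<mu>: "lifting d \<mu>" and \<nu>: "lifting d \<nu>"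
  shows "B2 +>\<^bsub>C2\<^esub> curv_cocycle d \<mu> = B2 +>\<^bsub>C2\<^esub> curv_cocycle d \<nu>"
proof -
  interpret \<mu>: linear_map K "quot L H" M \<mu> using \<mu> by (simp add: lifting_def)
  interpret \<nu>: linear_map K "quot L H" M \<nu> using \<nu> by (simp add: lifting_def)
  define b where "b = (\<lambda>X. \<mu> X \<ominus>\<^bsub>M\<^esub> \<nu> X)"
  have "b X \<in> MH" if X: "X \<in> carrier (quot L H)" for X
  proof -
    have "(\<mu> X, lin_sec X) \<in> carrier (E d)" "(\<nu> X, lin_sec X) \<in> carrier (E d)"
      using \<mu> \<nu> X by (simp_all add: lifting_def)
    then show ?thesis
      using X by (auto simp: E_iff[OF d] b_def act_simps H.sub_mem N.M.diff_self bracket_in_ideal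
          DerI_simps[OF d])
  qed
  then have b: "linear_map K (quot L H) (M\<lparr>carrier := MH\<rparr>) b"
    using linear_map_diff[OF \<mu>.linear_map_axioms \<nu>.linear_map_axioms]
    by (intro MH.linear_into_sub) (simp_all add: b_def)
  have "curv_cocycle d \<mu> = Q.coboundary b \<oplus>\<^bsub>C2\<^esub> curv_cocycle d \<nu>"
  proof (rule extensionalityI)
    show "curv_cocycle d \<mu> \<in> extensional (carrier (quot L H) \<times> carrier (quot L H))"
      by (simp add: curv_cocycle_def)
    show "Q.coboundary b \<oplus>\<^bsub>C2\<^esub> curv_cocycle d \<nu> \<in>
        extensional (carrier (quot L H) \<times> carrier (quot L H))"
      by (simp add: Q.cocycles2_sel)
  next
    fix p assume "p \<in> carrier (quot L H) \<times> carrier (quot L H)"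
    then obtain X Y where XY: "p = (X, Y)" "X \<in> carrier (quot L H)" "Y \<in> carrier (quot L H)" by auto
    have "curv d \<mu> X Y = Q.coboundary b (X, Y) \<oplus>\<^bsub>M\<^esub> curv d \<nu> X Y"
      unfolding coboundary_invariants[OF b XY(2,3)] using XY
      by (simp add: b_def curv_def act_simps \<mu>.linear_simps \<nu>.linear_simps lin_sec.linear_closed
          br_closed defect_mem DerI_simps[OF d] N.M.diff_simps N.M.a_ac)
    then show "curv_cocycle d \<mu> p = (Q.coboundary b \<oplus>\<^bsub>C2\<^esub> curv_cocycle d \<nu>) p"
      using XY by (simp add: curv_cocycle_def Q.cocycles2_sel invariants_sel)
  qed
  moreover have "Q.coboundary b \<in> B2"
    unfolding Q.coboundaries2_eq using b[folded invariants_eq] by blast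
  ultimately show ?thesis
    using curv_cocycle_cocycle[OF d \<mu>] curv_cocycle_cocycle[OF d \<nu>]
    by (subst Q.B2.coset_eq_iff) auto
qed

section \<open>The extension I/s_d(H) and its class\<close>

abbreviation "quotE d \<equiv> quot (E d) (der_graph H d)"

text \<open>A name for the projection that \<open>tr_hat\<close> hands to
  \<open>extension_class\<close>.\<close>

definition projE :: "('m \<times> 'l) set \<Rightarrow> 'l set" where
  "projE Y = the_elem ((\<lambda>(m, x). H +>\<^bsub>L\<^esub> x) ` Y)"

lemma projE:
  assumes d: "d \<in> carrier DerI"
  shows "linear_map K (quotE d) (quot L H) projE"
    and "(m, x) \<in> carrier (E d) \<Longrightarrow> projE (der_graph H d +>\<^bsub>E d\<^esub> (m, x)) = H +>\<^bsub>L\<^esub> x"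
proof -
  interpret Gr: subspace K "E d" "der_graph H d" by (rule subspace_graph[OF d])
  have lin: "linear_map K (E d) (quot L H) (\<lambda>(m, x). H +>\<^bsub>L\<^esub> x)"
    using linear_map_comp[OF linear_E_snd[OF d] H.linear_map_coset] by (simp add: case_prod_unfold)
  have van: "(\<lambda>(m, x). H +>\<^bsub>L\<^esub> x) u = \<zero>\<^bsub>quot L H\<^esub>" if u: "u \<in> der_graph H d" for u
  proof -
    obtain z where "z \<in> H" "u = (d z, z)" using u by (auto simp: der_graph_def)
    then show ?thesis by (simp add: H.quot_zero H.coset_eq_self_iff H.sub_mem)
  qed
  show "linear_map K (quotE d) (quot L H) projE"
    unfolding projE_def using Gr.linear_induced_map[OF lin van] .
  show "(m, x) \<in> carrier (E d) \<Longrightarrow> projE (der_graph H d +>\<^bsub>E d\<^esub> (m, x)) = H +>\<^bsub>L\<^esub> x"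
    unfolding projE_def using Gr.induced_map_coset[OF lin van, of "(m, x)"] by simp
qed

text \<open>Invariance of the class of \<open>d\<close> is exactly what provides, for each
  \<open>x\<close>, an \<open>m\<close> with (m, x) in \<open>E d\<close>.\<close>

lemma projE_surj:
  assumes d: "d \<in> invariant_ders"
  shows "projE ` carrier (quotE d) = carrier (quot L H)"
proof (intro equalityI subsetI)
  have dI: "d \<in> carrier DerI" using d by (rule invariant_dersD)
  interpret Gr: subspace K "E d" "der_graph H d" by (rule subspace_graph[OF dI])
  interpret p: linear_map K "quotE d" "quot L H" projE by (rule projE[OF dI])
  fix X
  show "X \<in> carrier (quot L H)" if "X \<in> projE ` carrier (quotE d)" using that p.linear_closed by auto
  assume "X \<in> carrier (quot L H)"
  then obtain x where x: "x \<in> carrier L" "X = H +>\<^bsub>L\<^esub> x" by (rule H.quot_cases)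
  then obtain m where "m \<in> carrier M" "\<forall>z\<in>H. act x (d z) \<ominus>\<^bsub>M\<^esub> d (x \<otimes>\<^bsub>L\<^esub> z) = act z m"
    using d by (auto simp: invariant_ders_def)
  then have mx: "(m, x) \<in> carrier (E d)" using x by (simp add: E_iff[OF dI])
  then show "X \<in> projE ` carrier (quotE d)"
    using projE(2)[OF dI mx] x Gr.quotI[OF mx] by force
qed

text \<open>The index set of the image whose only element \<open>extension_class\<close> takes for
  this extension.\<close>

definition sections :: "('l \<Rightarrow> 'm) \<Rightarrow> ('l set \<Rightarrow> ('m \<times> 'l) set) set" where
  "sections d = {s. linear_map K (quot L H) (quotE d) s \<and>
     (\<forall>X\<in>carrier (quot L H). projE (s X) = X)}"

lemma sections_nonempty:
  assumes "d \<in> invariant_ders"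
  shows "sections d \<noteq> {}"
  using ex_linear_section[OF K.field_axioms projE(1)[OF invariant_dersD[OF assms]] projE_surj[OF assms]]
  by (simp add: sections_def)

text \<open>Every class over \<open>X\<close> has exactly one representative whose second component is \<open>lin_sec X\<close>.\<close>

lemma section_lifting:
  assumes d: "d \<in> carrier DerI" and s: "s \<in> sections d"
  shows "\<exists>\<mu>. lifting d \<mu> \<and>
    (\<forall>X\<in>carrier (quot L H). s X = der_graph H d +>\<^bsub>E d\<^esub> (\<mu> X, lin_sec X))"
proof -
  interpret Gr: subspace K "E d" "der_graph H d" by (rule subspace_graph[OF d])
  interpret s: linear_map K "quot L H" "quotE d" s using s by (simp add: sections_def)
  have ex: "\<exists>m. (m, lin_sec X) \<in> carrier (E d) \<and> s X = der_graph H d +>\<^bsub>E d\<^esub> (m, lin_sec X)"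
    if X: "X \<in> carrier (quot L H)" for X
  proof -
    obtain u where u: "u \<in> carrier (E d)" "s X = der_graph H d +>\<^bsub>E d\<^esub> u"
      using Gr.quot_cases[OF s.linear_closed[OF X]] .
    obtain m x where mx: "u = (m, x)" by (cases u)
    have L: "m \<in> carrier M" "x \<in> carrier L" "lin_sec X \<in> carrier L"
      using u X by (auto simp: mx E_iff[OF d] lin_sec.linear_closed)
    have Xx: "X = H +>\<^bsub>L\<^esub> x"
      using s X projE(2)[OF d] u by (auto simp: sections_def mx)
    \<comment> \<open>Subtracting the graph element over \<open>h\<close> moves the second component
      from \<open>x\<close> to \<open>lin_sec X\<close> within the class.\<close>
    define h where "h = x \<ominus>\<^bsub>L\<^esub> lin_sec X"
    have h: "h \<in> H" using diff_lin_sec[OF L(2)] by (simp add: h_def Xx)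
    then have g: "(d h, h) \<in> der_graph H d" by (simp add: graph_iff)
    have u': "(m \<ominus>\<^bsub>M\<^esub> d h, lin_sec X) = u \<ominus>\<^bsub>E d\<^esub> (d h, h)"
      using L u E_diff[OF d _ Gr.sub_mem[OF g]]
      by (simp add: mx h_def L.M.diff_simps L.M.a_ac)
    then have "(m \<ominus>\<^bsub>M\<^esub> d h, lin_sec X) \<in> carrier (E d)"
      using u Gr.sub_mem[OF g] by simp
    moreover have "u = (d h, h) \<oplus>\<^bsub>E d\<^esub> (m \<ominus>\<^bsub>M\<^esub> d h, lin_sec X)"
      unfolding u' using u Gr.sub_mem[OF g] by (simp add: Gr.V.M.diff_simps Gr.V.M.a_ac)
    ultimately show ?thesis
      using u g by (metis Gr.coset_eq_iff)
  qed
  \<comment> \<open>Two representatives with equal second component differ by the graph element over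
    0, which is zero since d 0 = 0.\<close>
  have uniq: "m = n" if m: "(m, x) \<in> carrier (E d)" and n: "(n, x) \<in> carrier (E d)"
    and eq: "der_graph H d +>\<^bsub>E d\<^esub> (m, x) = der_graph H d +>\<^bsub>E d\<^esub> (n, x)" for m n x
  proof -
    obtain g where g: "g \<in> der_graph H d" "(m, x) = g \<oplus>\<^bsub>E d\<^esub> (n, x)"
      using eq Gr.coset_eq_iff[OF m n] by blast
    then obtain h where h: "h \<in> H" "g = (d h, h)" by (auto simp: der_graph_def)
    have x: "x \<in> carrier L" "n \<in> carrier M" using that by (auto simp: E_iff[OF d])
    have "x = h \<oplus>\<^bsub>L\<^esub> x" "m = d h \<oplus>\<^bsub>M\<^esub> n" using g h by (auto simp: E_sel)
    moreover have "h = \<zero>\<^bsub>L\<^esub>"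
      using \<open>x = h \<oplus>\<^bsub>L\<^esub> x\<close> x h(1) H.sub_mem L.M.add.r_cancel_one' by blast
    ultimately show ?thesis using x by (simp add: DerI_simps[OF d])
  qed
  obtain \<mu> where \<mu>: "\<And>X. X \<in> carrier (quot L H) \<Longrightarrow> (\<mu> X, lin_sec X) \<in> carrier (E d)"
    "\<And>X. X \<in> carrier (quot L H) \<Longrightarrow> s X = der_graph H d +>\<^bsub>E d\<^esub> (\<mu> X, lin_sec X)"
    using bchoice[of "carrier (quot L H)"
        "\<lambda>X m. (m, lin_sec X) \<in> carrier (E d) \<and> s X = der_graph H d +>\<^bsub>E d\<^esub> (m, lin_sec X)"] ex
    by blast
  \<comment> \<open>By uniqueness: as \<open>s\<close> and \<open>lin_sec\<close> are linear, both
    sides of each equation are first components of representatives of one class with the same second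
    component.\<close>
  have "linear_map K (quot L H) M \<mu>"
  proof (rule linear_mapI)
    fix X Y assume X: "X \<in> carrier (quot L H)" and Y: "Y \<in> carrier (quot L H)"
    have XY: "X \<oplus>\<^bsub>quot L H\<^esub> Y \<in> carrier (quot L H)" using X Y by simp
    have e: "(\<mu> X, lin_sec X) \<oplus>\<^bsub>E d\<^esub> (\<mu> Y, lin_sec Y) =
        (\<mu> X \<oplus>\<^bsub>M\<^esub> \<mu> Y, lin_sec (X \<oplus>\<^bsub>quot L H\<^esub> Y))"
      using X Y by (simp add: E_sel lin_sec.linear_add)
    have "(\<mu> X \<oplus>\<^bsub>M\<^esub> \<mu> Y, lin_sec (X \<oplus>\<^bsub>quot L H\<^esub> Y)) \<in> carrier (E d)"
      unfolding e[symmetric] using \<mu>(1) X Y by (intro Gr.V.M.a_closed)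
    moreover have "der_graph H d +>\<^bsub>E d\<^esub> (\<mu> (X \<oplus>\<^bsub>quot L H\<^esub> Y), lin_sec (X \<oplus>\<^bsub>quot L H\<^esub> Y)) =
        der_graph H d +>\<^bsub>E d\<^esub> (\<mu> X \<oplus>\<^bsub>M\<^esub> \<mu> Y, lin_sec (X \<oplus>\<^bsub>quot L H\<^esub> Y))"
      using s.linear_add[OF X Y] \<mu>(2)[OF XY] \<mu>(2)[OF X] \<mu>(2)[OF Y]
        Gr.quot_add[OF \<mu>(1)[OF X] \<mu>(1)[OF Y]] by (simp add: e)
    ultimately show "\<mu> (X \<oplus>\<^bsub>quot L H\<^esub> Y) = \<mu> X \<oplus>\<^bsub>M\<^esub> \<mu> Y"
      using uniq[OF \<mu>(1)[OF XY]] by blast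
  next
    fix a X assume a: "a \<in> carrier K" and X: "X \<in> carrier (quot L H)"
    have aX: "a \<odot>\<^bsub>quot L H\<^esub> X \<in> carrier (quot L H)" by (rule Module.module.smult_closed[OF H.module_quot a X])
    have e: "a \<odot>\<^bsub>E d\<^esub> (\<mu> X, lin_sec X) = (a \<odot>\<^bsub>M\<^esub> \<mu> X, lin_sec (a \<odot>\<^bsub>quot L H\<^esub> X))"
      using a X by (simp add: E_sel lin_sec.linear_smult)
    have "(a \<odot>\<^bsub>M\<^esub> \<mu> X, lin_sec (a \<odot>\<^bsub>quot L H\<^esub> X)) \<in> carrier (E d)"
      unfolding e[symmetric] using \<mu>(1) a X by (intro Gr.V.smult_closed)
    moreover have "der_graph H d +>\<^bsub>E d\<^esub> (\<mu> (a \<odot>\<^bsub>quot L H\<^esub> X), lin_sec (a \<odot>\<^bsub>quot L H\<^esub> X)) =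
        der_graph H d +>\<^bsub>E d\<^esub> (a \<odot>\<^bsub>M\<^esub> \<mu> X, lin_sec (a \<odot>\<^bsub>quot L H\<^esub> X))"
      using s.linear_smult[OF a X] \<mu>(2)[OF aX] \<mu>(2)[OF X] Gr.quot_smult[OF a \<mu>(1)[OF X]]
      by (simp add: e)
    ultimately show "\<mu> (a \<odot>\<^bsub>quot L H\<^esub> X) = a \<odot>\<^bsub>M\<^esub> \<mu> X"
      using uniq[OF \<mu>(1)[OF aX]] by blast
  qed (use \<mu>(1) in \<open>auto simp: H.module_quot N.module_axioms E_iff[OF d]\<close>)
  then show ?thesis using \<mu> by (auto simp: lifting_def)
qed

lemma lifting_exists:
  assumes "d \<in> invariant_ders"
  shows "\<exists>\<mu>. lifting d \<mu>"
  using sections_nonempty[OF assms] section_lifting[OF invariant_dersD[OF assms]] by fast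

text \<open>[s X, s Y] - s [X, Y] is represented by a pair over \<open>defect X Y\<close>. Removing
  the graph element over it leaves \<open>(curv d \<mu> X Y, \<zero>)\<close>, which comes from an
  invariant element; injectivity of the inclusion then evaluates \<open>inv_into\<close>.\<close>

lemma extension_cocycle_section:
  assumes d: "d \<in> carrier DerI" and \<mu>: "lifting d \<mu>" and s: "s \<in> sections d"
    and s\<mu>: "\<And>X. X \<in> carrier (quot L H) \<Longrightarrow> s X = der_graph H d +>\<^bsub>E d\<^esub> (\<mu> X, lin_sec X)"
  shows "extension_cocycle (quot L H) (invariants H M act) (quotE d)
     (\<lambda>m. der_graph H d +>\<^bsub>E d\<^esub> (m, \<zero>\<^bsub>L\<^esub>)) s = curv_cocycle d \<mu>"
proof -
  interpret Gr: subspace K "E d" "der_graph H d" by (rule subspace_graph[OF d])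
  define i where "i = (\<lambda>m. der_graph H d +>\<^bsub>E d\<^esub> (m, \<zero>\<^bsub>L\<^esub>))"
  have mem: "(\<mu> X, lin_sec X) \<in> carrier (E d)" if "X \<in> carrier (quot L H)" for X
    using \<mu> that by (simp add: lifting_def)
  \<comment> \<open>The graph meets M x 0 only in zero, again because d 0 = 0.\<close>
  have inj: "inj_on i MH"
  proof (rule inj_onI)
    fix m n assume m: "m \<in> MH" and n: "n \<in> MH" and "i m = i n"
    then obtain g where g: "g \<in> der_graph H d" "(m, \<zero>\<^bsub>L\<^esub>) = g \<oplus>\<^bsub>E d\<^esub> (n, \<zero>\<^bsub>L\<^esub>)"
      using E_zero_iff[OF d] by (auto simp: i_def Gr.coset_eq_iff)
    then obtain h where h: "h \<in> H" "g = (d h, h)" by (auto simp: der_graph_def)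
    have "\<zero>\<^bsub>L\<^esub> = h" "m = d h \<oplus>\<^bsub>M\<^esub> n" using g h H.sub_mem by (auto simp: E_sel)
    then show "m = n" using n by (auto simp: DerI_simps[OF d])
  qed
  have mult: "(der_graph H d +>\<^bsub>E d\<^esub> u) \<otimes>\<^bsub>quotE d\<^esub> (der_graph H d +>\<^bsub>E d\<^esub> v) =
      der_graph H d +>\<^bsub>E d\<^esub> (u \<otimes>\<^bsub>E d\<^esub> v)" if "u \<in> carrier (E d)" "v \<in> carrier (E d)" for u v
  proof (rule Gr.quot_mult[OF that])
    fix u v assume "u \<in> carrier (E d)" "v \<in> carrier (E d)"
    then show "u \<otimes>\<^bsub>E d\<^esub> v \<in> carrier (E d)"
      by (cases u; cases v) (simp add: E_sel E_bracket[OF d])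
  next
    fix g u v assume g: "g \<in> der_graph H d" "u \<in> carrier (E d)" "v \<in> carrier (E d)"
    have "g \<in> carrier (E d)" using g(1) by (rule Gr.sub_mem)
    with g show "(g \<oplus>\<^bsub>E d\<^esub> u) \<otimes>\<^bsub>E d\<^esub> v = g \<otimes>\<^bsub>E d\<^esub> v \<oplus>\<^bsub>E d\<^esub> u \<otimes>\<^bsub>E d\<^esub> v"
      "u \<otimes>\<^bsub>E d\<^esub> (g \<oplus>\<^bsub>E d\<^esub> v) = u \<otimes>\<^bsub>E d\<^esub> g \<oplus>\<^bsub>E d\<^esub> u \<otimes>\<^bsub>E d\<^esub> v"
      by (cases u; cases v; cases g; simp add: E_sel E_iff[OF d] act_simps bracket_simps
          N.M.diff_simps N.M.a_ac)+
  next
    fix g u assume g: "g \<in> der_graph H d" "u \<in> carrier (E d)"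
    obtain h where h: "h \<in> H" "g = (d h, h)" using g by (auto simp: der_graph_def)
    obtain m x where u: "u = (m, x)" "m \<in> carrier M" "x \<in> carrier L"
      using g E_iff[OF d] by (cases u) auto
    have hm: "act h m = act x (d h) \<ominus>\<^bsub>M\<^esub> d (x \<otimes>\<^bsub>L\<^esub> h)" using g(2) h(1) u by (simp add: E_act[OF d])
    have hx: "h \<otimes>\<^bsub>L\<^esub> x = \<zero>\<^bsub>L\<^esub> \<ominus>\<^bsub>L\<^esub> (x \<otimes>\<^bsub>L\<^esub> h)"
      using bracket_antisym[of x h] u h H.sub_mem by (simp add: L.M.neg_eq_diff bracket_closed)
    have dhx: "d (h \<otimes>\<^bsub>L\<^esub> x) = \<zero>\<^bsub>M\<^esub> \<ominus>\<^bsub>M\<^esub> d (x \<otimes>\<^bsub>L\<^esub> h)"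
      unfolding hx using u h by (simp add: DerI_simps[OF d] bracket_in_ideal H.sub_zero)
    \<comment> \<open>The condition defining \<open>E d\<close> lets the graph absorb brackets from
      one side; antisymmetry in L, through \<open>dhx\<close>, gives the other side.\<close>
    have "act h m \<ominus>\<^bsub>M\<^esub> act x (d h) = d (h \<otimes>\<^bsub>L\<^esub> x)" "act x (d h) \<ominus>\<^bsub>M\<^esub> act h m = d (x \<otimes>\<^bsub>L\<^esub> h)"
      unfolding dhx hm using u h
      by (simp_all add: act_simps DerI_simps[OF d] bracket_in_ideal H.sub_mem N.M.diff_simps N.M.a_ac)
    then show "g \<otimes>\<^bsub>E d\<^esub> u \<in> der_graph H d" "u \<otimes>\<^bsub>E d\<^esub> g \<in> der_graph H d"
      using u h by (simp_all add: E_sel graph_iff bracket_in_ideal bracket_in_ideal_left)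
  qed
  have val: "inv_into MH i (s X \<otimes>\<^bsub>quotE d\<^esub> s Y \<ominus>\<^bsub>quotE d\<^esub> s (br X Y)) = curv d \<mu> X Y"
    if XY: "X \<in> carrier (quot L H)" "Y \<in> carrier (quot L H)" for X Y
  proof -
    let ?A = "act (lin_sec X) (\<mu> Y) \<ominus>\<^bsub>M\<^esub> act (lin_sec Y) (\<mu> X)"
    note b = E_bracket[OF d mem[OF XY(1)] mem[OF XY(2)]] and c = mem[OF br_closed[OF XY]]
    have "s X \<otimes>\<^bsub>quotE d\<^esub> s Y \<ominus>\<^bsub>quotE d\<^esub> s (br X Y) =
        der_graph H d +>\<^bsub>E d\<^esub> ((?A, lin_sec X \<otimes>\<^bsub>L\<^esub> lin_sec Y) \<ominus>\<^bsub>E d\<^esub> (\<mu> (br X Y), lin_sec (br X Y)))"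
      using b c XY by (simp add: s\<mu> br_closed mult mem E_sel Gr.quot_diff)
    also have "\<dots> = der_graph H d +>\<^bsub>E d\<^esub> (?A \<ominus>\<^bsub>M\<^esub> \<mu> (br X Y), defect X Y)"
      by (simp add: E_diff[OF d b c] defect_def)
    also have "\<dots> = i (curv d \<mu> X Y)"
      unfolding i_def
    proof (subst Gr.coset_eq_iff)
      show m1: "(?A \<ominus>\<^bsub>M\<^esub> \<mu> (br X Y), defect X Y) \<in> carrier (E d)"
        using Gr.V.M.minus_closed[OF b c] by (simp add: E_diff[OF d b c] defect_def)
      show "(curv d \<mu> X Y, \<zero>\<^bsub>L\<^esub>) \<in> carrier (E d)" by (rule curv_E[OF d \<mu> XY])
      have "(?A \<ominus>\<^bsub>M\<^esub> \<mu> (br X Y), defect X Y) =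
          (d (defect X Y), defect X Y) \<oplus>\<^bsub>E d\<^esub> (curv d \<mu> X Y, \<zero>\<^bsub>L\<^esub>)"
      proof -
        have "?A \<ominus>\<^bsub>M\<^esub> \<mu> (br X Y) \<in> carrier M" using m1 by (simp add: E_iff[OF d])
        then show ?thesis
          using defect_mem[OF XY] H.sub_mem
          by (simp add: E_sel curv_def DerI_simps[OF d] N.M.add_diff_right N.M.diff_eq_iff N.M.eq_diff_iff N.M.a_comm)
      qed
      then show "\<exists>u\<in>der_graph H d. (?A \<ominus>\<^bsub>M\<^esub> \<mu> (br X Y), defect X Y) = u \<oplus>\<^bsub>E d\<^esub> (curv d \<mu> X Y, \<zero>\<^bsub>L\<^esub>)"
        using defect_mem[OF XY] by (intro bexI[of _ "(d (defect X Y), defect X Y)"]) (simp_all add: graph_iff)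
    qed
    finally show ?thesis using inv_into_f_f[OF inj curv_MH[OF d \<mu> XY]] by simp
  qed
  then show ?thesis
    by (auto simp: extension_cocycle_def curv_cocycle_def invariants_eq fun_eq_iff simp flip: i_def)
qed

text \<open>The set under \<open>the_elem\<close> is nonempty, since invariance of \<open>d\<close>
  yields a section, and has only one element, since every section comes from a lifting and all
  liftings give cohomologous cocycles. Hence any convenient lifting computes the class.\<close>

lemma tr_hat_eq:
  assumes d: "d \<in> invariant_ders" and \<mu>: "lifting d \<mu>"
  shows "tr_hat K L H M act d = B2 +>\<^bsub>C2\<^esub> curv_cocycle d \<mu>"
proof -
  have dI: "d \<in> carrier DerI" using d by (rule invariant_dersD)
  let ?F = "\<lambda>s. B2 +>\<^bsub>C2\<^esub> extension_cocycle (quot L H) (invariants H M act) (quotE d)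
     (\<lambda>m. der_graph H d +>\<^bsub>E d\<^esub> (m, \<zero>\<^bsub>L\<^esub>)) s"
  have F: "?F s = B2 +>\<^bsub>C2\<^esub> curv_cocycle d \<mu>" if s: "s \<in> sections d" for s
  proof -
    obtain \<nu> where \<nu>: "lifting d \<nu>"
      "\<And>X. X \<in> carrier (quot L H) \<Longrightarrow> s X = der_graph H d +>\<^bsub>E d\<^esub> (\<nu> X, lin_sec X)"
      using section_lifting[OF dI s] by blast
    then show ?thesis
      using extension_cocycle_section[OF dI \<nu>(1) s \<nu>(2)] curv_cocycle_cohomologous[OF dI \<nu>(1) \<mu>]
      by simp
  qed
  have "tr_hat K L H M act d = the_elem (?F ` sections d)"
    by (simp add: tr_hat_def extension_class_def sections_def projE_def)
  also have "?F ` sections d = {B2 +>\<^bsub>C2\<^esub> curv_cocycle d \<mu>}"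
    using sections_nonempty[OF d] F by (auto simp: image_iff)
  finally show ?thesis by simp
qed

section \<open>Linearity of the transgression\<close>

lemma curv_cocycle_add:
  assumes d: "d \<in> invariant_ders" and e: "e \<in> invariant_ders" and \<mu>: "lifting d \<mu>" and \<nu>: "lifting e \<nu>"
  shows "lifting (d \<oplus>\<^bsub>DerI\<^esub> e) (\<lambda>X. \<mu> X \<oplus>\<^bsub>M\<^esub> \<nu> X)"
    and "curv_cocycle (d \<oplus>\<^bsub>DerI\<^esub> e) (\<lambda>X. \<mu> X \<oplus>\<^bsub>M\<^esub> \<nu> X) = curv_cocycle d \<mu> \<oplus>\<^bsub>C2\<^esub> curv_cocycle e \<nu>"
proof -
  note dI = invariant_dersD[OF d] and eI = invariant_dersD[OF e]
    and deI = invariant_dersD[OF D.sub_add[OF d e]]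
  interpret \<mu>: linear_map K "quot L H" M \<mu> using \<mu> by (simp add: lifting_def)
  interpret \<nu>: linear_map K "quot L H" M \<nu> using \<nu> by (simp add: lifting_def)
  have "(\<mu> X \<oplus>\<^bsub>M\<^esub> \<nu> X, lin_sec X) \<in> carrier (E (d \<oplus>\<^bsub>DerI\<^esub> e))" if X: "X \<in> carrier (quot L H)" for X
  proof -
    have "(\<mu> X, lin_sec X) \<in> carrier (E d)" "(\<nu> X, lin_sec X) \<in> carrier (E e)"
      using \<mu> \<nu> X by (simp_all add: lifting_def)
    then show ?thesis
      unfolding E_iff[OF deI]
      by (simp add: E_iff[OF dI] E_iff[OF eI] I.Der_sel act_simps H.sub_mem
          bracket_in_ideal DerI_simps[OF dI] DerI_simps[OF eI] N.M.diff_simps N.M.a_ac)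
  qed
  then show "lifting (d \<oplus>\<^bsub>DerI\<^esub> e) (\<lambda>X. \<mu> X \<oplus>\<^bsub>M\<^esub> \<nu> X)"
    using linear_map_add[OF \<mu>.linear_map_axioms \<nu>.linear_map_axioms] by (simp add: lifting_def)
  have "curv (d \<oplus>\<^bsub>DerI\<^esub> e) (\<lambda>X. \<mu> X \<oplus>\<^bsub>M\<^esub> \<nu> X) X Y = curv d \<mu> X Y \<oplus>\<^bsub>M\<^esub> curv e \<nu> X Y"
    if "X \<in> carrier (quot L H)" "Y \<in> carrier (quot L H)" for X Y
    using that
    by (simp add: curv_def I.Der_sel act_simps defect_mem br_closed lin_sec.linear_closed
        \<mu>.linear_closed \<nu>.linear_closed DerI_simps[OF dI] DerI_simps[OF eI] N.M.diff_simps N.M.a_ac)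
  then show "curv_cocycle (d \<oplus>\<^bsub>DerI\<^esub> e) (\<lambda>X. \<mu> X \<oplus>\<^bsub>M\<^esub> \<nu> X) = curv_cocycle d \<mu> \<oplus>\<^bsub>C2\<^esub> curv_cocycle e \<nu>"
    by (auto simp: curv_cocycle_def Q.cocycles2_sel invariants_sel fun_eq_iff)
qed

lemma curv_cocycle_smult:
  assumes a: "a \<in> carrier K" and d: "d \<in> invariant_ders" and \<mu>: "lifting d \<mu>"
  shows "lifting (a \<odot>\<^bsub>DerI\<^esub> d) (\<lambda>X. a \<odot>\<^bsub>M\<^esub> \<mu> X)"
    and "curv_cocycle (a \<odot>\<^bsub>DerI\<^esub> d) (\<lambda>X. a \<odot>\<^bsub>M\<^esub> \<mu> X) = a \<odot>\<^bsub>C2\<^esub> curv_cocycle d \<mu>"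
proof -
  note dI = invariant_dersD[OF d] and adI = invariant_dersD[OF D.sub_smult[OF a d]]
  interpret \<mu>: linear_map K "quot L H" M \<mu> using \<mu> by (simp add: lifting_def)
  have "(a \<odot>\<^bsub>M\<^esub> \<mu> X, lin_sec X) \<in> carrier (E (a \<odot>\<^bsub>DerI\<^esub> d))" if X: "X \<in> carrier (quot L H)" for X
  proof -
    have "(\<mu> X, lin_sec X) \<in> carrier (E d)" using \<mu> X by (simp add: lifting_def)
    then show ?thesis
      unfolding E_iff[OF adI]
      using a by (simp add: E_iff[OF dI] I.Der_sel act_simps H.sub_mem
          bracket_in_ideal DerI_simps[OF dI] N.smult_diff)
  qed
  then show "lifting (a \<odot>\<^bsub>DerI\<^esub> d) (\<lambda>X. a \<odot>\<^bsub>M\<^esub> \<mu> X)"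
    using linear_map_smult[OF \<mu>.linear_map_axioms a] by (simp add: lifting_def)
  have "curv (a \<odot>\<^bsub>DerI\<^esub> d) (\<lambda>X. a \<odot>\<^bsub>M\<^esub> \<mu> X) X Y = a \<odot>\<^bsub>M\<^esub> curv d \<mu> X Y"
    if "X \<in> carrier (quot L H)" "Y \<in> carrier (quot L H)" for X Y
    using that a
    by (simp add: curv_def I.Der_sel act_simps defect_mem br_closed lin_sec.linear_closed
        \<mu>.linear_closed DerI_simps[OF dI] N.smult_diff)
  then show "curv_cocycle (a \<odot>\<^bsub>DerI\<^esub> d) (\<lambda>X. a \<odot>\<^bsub>M\<^esub> \<mu> X) = a \<odot>\<^bsub>C2\<^esub> curv_cocycle d \<mu>"
    by (auto simp: curv_cocycle_def Q.cocycles2_sel invariants_sel fun_eq_iff)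
qed

text \<open>Liftings of two derivations add up to a lifting of the sum, and \<open>tr_hat_eq\<close>
  allows the class to be computed with that particular lifting; likewise for scalar
  multiples.\<close>

lemma linear_tr_hat: "linear_map K (DerI\<lparr>carrier := invariant_ders\<rparr>) H2Q (tr_hat K L H M act)"
proof (rule linear_mapI)
  show "Module.module K H2Q" unfolding H2_def by (rule Q.B2.module_quot)
next
  fix d assume "d \<in> carrier (DerI\<lparr>carrier := invariant_ders\<rparr>)"
  then have d: "d \<in> invariant_ders" by simp
  obtain \<mu> where \<mu>: "lifting d \<mu>" using lifting_exists[OF d] by blast
  show "tr_hat K L H M act d \<in> carrier H2Q"
    unfolding tr_hat_eq[OF d \<mu>] H2_def
    by (intro Q.B2.quotI curv_cocycle_cocycle invariant_dersD[OF d] \<mu>)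
next
  fix d e assume "d \<in> carrier (DerI\<lparr>carrier := invariant_ders\<rparr>)"
    "e \<in> carrier (DerI\<lparr>carrier := invariant_ders\<rparr>)"
  then have d: "d \<in> invariant_ders" and e: "e \<in> invariant_ders" by simp_all
  obtain \<mu> where \<mu>: "lifting d \<mu>" using lifting_exists[OF d] by blast
  obtain \<nu> where \<nu>: "lifting e \<nu>" using lifting_exists[OF e] by blast
  have "tr_hat K L H M act (d \<oplus>\<^bsub>DerI\<^esub> e) = tr_hat K L H M act d \<oplus>\<^bsub>H2Q\<^esub> tr_hat K L H M act e"
    by (simp add: tr_hat_eq[OF d \<mu>] tr_hat_eq[OF e \<nu>]
        tr_hat_eq[OF D.sub_add[OF d e] curv_cocycle_add(1)[OF d e \<mu> \<nu>]]
        curv_cocycle_add(2)[OF d e \<mu> \<nu>] H2_def Q.B2.quot_add curv_cocycle_cocycle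
        invariant_dersD d e \<mu> \<nu>)
  then show "tr_hat K L H M act (d \<oplus>\<^bsub>DerI\<lparr>carrier := invariant_ders\<rparr>\<^esub> e) =
      tr_hat K L H M act d \<oplus>\<^bsub>H2Q\<^esub> tr_hat K L H M act e" by simp
next
  fix a d assume a: "a \<in> carrier K" and "d \<in> carrier (DerI\<lparr>carrier := invariant_ders\<rparr>)"
  then have d: "d \<in> invariant_ders" by simp
  obtain \<mu> where \<mu>: "lifting d \<mu>" using lifting_exists[OF d] by blast
  have "tr_hat K L H M act (a \<odot>\<^bsub>DerI\<^esub> d) = a \<odot>\<^bsub>H2Q\<^esub> tr_hat K L H M act d"
    by (simp add: tr_hat_eq[OF d \<mu>] a
        tr_hat_eq[OF D.sub_smult[OF a d] curv_cocycle_smult(1)[OF a d \<mu>]]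
        curv_cocycle_smult(2)[OF a d \<mu>] H2_def Q.B2.quot_smult curv_cocycle_cocycle
        invariant_dersD d \<mu>)
  then show "tr_hat K L H M act (a \<odot>\<^bsub>DerI\<lparr>carrier := invariant_ders\<rparr>\<^esub> d) =
      a \<odot>\<^bsub>H2Q\<^esub> tr_hat K L H M act d" by simp
qed (simp add: D.module_sub)

section \<open>Exactness at the invariants of H^1(H, M)\<close>

lemma lin_sec_decomp:
  assumes x: "x \<in> carrier L"
  defines "X \<equiv> H +>\<^bsub>L\<^esub> x"
  obtains h where "h \<in> H" "x = lin_sec X \<oplus>\<^bsub>L\<^esub> h" "x \<ominus>\<^bsub>L\<^esub> lin_sec X = h"
proof
  have "lin_sec X \<in> carrier L" unfolding X_def by (intro lin_sec.linear_closed H.quotI x)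
  then show "x = lin_sec X \<oplus>\<^bsub>L\<^esub> (x \<ominus>\<^bsub>L\<^esub> lin_sec X)"
    using x by (simp add: L.M.diff_simps L.M.a_ac)
  show "x \<ominus>\<^bsub>L\<^esub> lin_sec X \<in> H" unfolding X_def by (rule diff_lin_sec[OF x])
qed simp

lemma tr_hat_res:
  assumes d: "d \<in> carrier DerG"
  shows "tr_hat K L H M act (restrict d H) = \<zero>\<^bsub>H2Q\<^esub>"
proof -
  note rI = res_Der[OF d]
  define \<mu> where "\<mu> = (\<lambda>X. d (lin_sec X))"
  have "(\<mu> X, lin_sec X) \<in> carrier (E (restrict d H))" if "X \<in> carrier (quot L H)" for X
    using that lin_sec.linear_closed[OF that]
    by (auto simp: E_iff[OF invariant_dersD[OF rI]] \<mu>_def DerG_simps[OF d] bracket_in_ideal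
        H.sub_mem act_simps N.M.diff_simps N.M.a_ac)
  moreover have "linear_map K (quot L H) M \<mu>"
    unfolding \<mu>_def by (rule linear_map_comp[OF lin_sec.linear_map_axioms G.DerD(2)[OF d]])
  ultimately have \<mu>: "lifting (restrict d H) \<mu>" by (simp add: lifting_def)
  have "curv (restrict d H) \<mu> X Y = \<zero>\<^bsub>M\<^esub>"
    if XY: "X \<in> carrier (quot L H)" "Y \<in> carrier (quot L H)" for X Y
  proof -
    \<comment> \<open>By the derivation law on L the first term equals the two action terms of
      \<open>curv\<close>, and the second is the value of \<mu> at [X, Y].\<close>
    have "restrict d H (defect X Y) = d (lin_sec X \<otimes>\<^bsub>L\<^esub> lin_sec Y) \<ominus>\<^bsub>M\<^esub> d (lin_sec (br X Y))"
      using defect_mem[OF XY] XY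
      by (simp add: defect_def DerG_simps(3)[OF d] lin_sec.linear_closed bracket_closed br_closed)
    then show ?thesis
      using XY
      by (simp add: curv_def \<mu>_def DerG_simps[OF d] lin_sec.linear_closed br_closed act_simps
          N.M.diff_simps N.M.a_ac)
  qed
  then have "curv_cocycle (restrict d H) \<mu> = \<zero>\<^bsub>C2\<^esub>"
    by (auto simp: curv_cocycle_def Q.cocycles2_sel invariants_sel fun_eq_iff)
  then show ?thesis
    by (simp add: tr_hat_eq[OF rI \<mu>] H2_def Q.B2.quot_zero Q.B2.coset_eq_self_iff Q.B2.sub_zero)
qed

lemma flat_lifting_exists:
  assumes d: "d \<in> invariant_ders" and z: "tr_hat K L H M act d = \<zero>\<^bsub>H2Q\<^esub>"
  shows "\<exists>\<nu>. lifting d \<nu> \<and> (\<forall>X\<in>carrier (quot L H). \<forall>Y\<in>carrier (quot L H). curv d \<nu> X Y = \<zero>\<^bsub>M\<^esub>)"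
proof -
  note dI = invariant_dersD[OF d]
  obtain \<mu> where \<mu>: "lifting d \<mu>" using lifting_exists[OF d] by blast
  interpret \<mu>: linear_map K "quot L H" M \<mu> using \<mu> by (simp add: lifting_def)
  have "curv_cocycle d \<mu> \<in> B2"
    using z curv_cocycle_cocycle[OF dI \<mu>]
    by (simp add: tr_hat_eq[OF d \<mu>] H2_def Q.B2.quot_zero Q.B2.coset_eq_self_iff)
  then obtain b where "linear_map K (quot L H) (invariants H M act) b" "curv_cocycle d \<mu> = Q.coboundary b"
    unfolding Q.coboundaries2_eq by blast
  then have b: "linear_map K (quot L H) (M\<lparr>carrier := MH\<rparr>) b" "curv_cocycle d \<mu> = Q.coboundary b"
    by (simp_all only: invariants_eq)
  interpret b: linear_map K "quot L H" "M\<lparr>carrier := MH\<rparr>" b by fact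
  interpret bM: linear_map K "quot L H" M b
    using linear_map_comp[OF b(1) MH.linear_inclusion] .
  have bH: "b X \<in> MH" if "X \<in> carrier (quot L H)" for X using b.linear_closed[OF that] by simp
  \<comment> \<open>As \<open>b\<close> takes values in M^H, subtracting it keeps the lifting
    property, and it lowers the cocycle by the coboundary of \<open>b\<close>.\<close>
  define \<nu> where "\<nu> = (\<lambda>X. \<mu> X \<ominus>\<^bsub>M\<^esub> b X)"
  have "(\<nu> X, lin_sec X) \<in> carrier (E d)" if X: "X \<in> carrier (quot L H)" for X
  proof -
    have "(\<mu> X, lin_sec X) \<in> carrier (E d)" using \<mu> X by (simp add: lifting_def)
    then show ?thesis
      using bH[OF X]
      by (auto simp: E_iff[OF dI] \<nu>_def act_simps H.sub_mem bracket_in_ideal DerI_simps[OF dI]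
          N.M.diff_zero)
  qed
  moreover have "linear_map K (quot L H) M \<nu>"
    unfolding \<nu>_def by (intro linear_map_diff \<mu>.linear_map_axioms bM.linear_map_axioms)
  moreover have "curv d \<nu> X Y = \<zero>\<^bsub>M\<^esub>" if XY: "X \<in> carrier (quot L H)" "Y \<in> carrier (quot L H)" for X Y
  proof -
    have "curv d \<mu> X Y = Q.coboundary b (X, Y)"
      using fun_cong[OF b(2), of "(X, Y)"] XY by (simp add: curv_cocycle_def)
    also have "\<dots> = act (lin_sec X) (b Y) \<ominus>\<^bsub>M\<^esub> act (lin_sec Y) (b X) \<ominus>\<^bsub>M\<^esub> b (br X Y)"
      by (rule coboundary_invariants[OF b(1) XY])
    finally have c: "curv d \<mu> X Y = act (lin_sec X) (b Y) \<ominus>\<^bsub>M\<^esub> act (lin_sec Y) (b X) \<ominus>\<^bsub>M\<^esub> b (br X Y)" .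
    have "curv d \<nu> X Y = curv d \<mu> X Y \<ominus>\<^bsub>M\<^esub>
        (act (lin_sec X) (b Y) \<ominus>\<^bsub>M\<^esub> act (lin_sec Y) (b X) \<ominus>\<^bsub>M\<^esub> b (br X Y))"
      using XY by (simp add: curv_def \<nu>_def act_simps \<mu>.linear_closed bM.linear_closed br_closed
          lin_sec.linear_closed defect_mem DerI_simps[OF dI] N.M.diff_simps N.M.a_ac)
    also have "\<dots> = \<zero>\<^bsub>M\<^esub>"
      unfolding c using XY
      by (simp add: act_closed bM.linear_closed br_closed lin_sec.linear_closed N.M.diff_self)
    finally show ?thesis .
  qed
  ultimately show ?thesis by (auto simp: lifting_def)
qed

lemma flat_lifting_extends:
  assumes d: "d \<in> carrier DerI" and \<mu>: "lifting d \<mu>"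
    and flat: "\<And>X Y. \<lbrakk>X \<in> carrier (quot L H); Y \<in> carrier (quot L H)\<rbrakk> \<Longrightarrow> curv d \<mu> X Y = \<zero>\<^bsub>M\<^esub>"
  shows "\<exists>D\<in>carrier DerG. restrict D H = d"
proof -
  interpret \<mu>: linear_map K "quot L H" M \<mu> using \<mu> by (simp add: lifting_def)
  define D where "D = (\<lambda>x. \<mu> (H +>\<^bsub>L\<^esub> x) \<oplus>\<^bsub>M\<^esub> d (x \<ominus>\<^bsub>L\<^esub> lin_sec (H +>\<^bsub>L\<^esub> x)))"
  have "linear_map K L (L\<lparr>carrier := H\<rparr>) (\<lambda>x. x \<ominus>\<^bsub>L\<^esub> lin_sec (H +>\<^bsub>L\<^esub> x))"
    by (intro H.linear_into_sub linear_map_diff diff_lin_sec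
        linear_map_comp[OF H.linear_map_coset lin_sec.linear_map_axioms]
        linear_mapI[where f = "\<lambda>x. x"] L.module_axioms) auto
  note e = linear_map_comp[OF this I.DerD(2)[OF d]]
  have lin: "linear_map K L M D"
    unfolding D_def
    by (intro linear_map_add linear_map_comp[OF H.linear_map_coset \<mu>.linear_map_axioms] e)
  have der: "D (x \<otimes>\<^bsub>L\<^esub> y) = act x (D y) \<ominus>\<^bsub>M\<^esub> act y (D x)"
    if x: "x \<in> carrier L" and y: "y \<in> carrier L" for x y
  proof -
    define X Y where XY: "X = H +>\<^bsub>L\<^esub> x" "Y = H +>\<^bsub>L\<^esub> y"
    have Q: "X \<in> carrier (quot L H)" "Y \<in> carrier (quot L H)" using x y by (simp_all add: XY H.quotI)
    obtain z where z: "z \<in> H" "x = lin_sec X \<oplus>\<^bsub>L\<^esub> z" "x \<ominus>\<^bsub>L\<^esub> lin_sec X = z"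
      using lin_sec_decomp[OF x] unfolding XY .
    obtain w where w: "w \<in> H" "y = lin_sec Y \<oplus>\<^bsub>L\<^esub> w" "y \<ominus>\<^bsub>L\<^esub> lin_sec Y = w"
      using lin_sec_decomp[OF y] unfolding XY .
    define a b where ab: "a = lin_sec X" "b = lin_sec Y"
    have L: "a \<in> carrier L" "b \<in> carrier L" "z \<in> carrier L" "w \<in> carrier L" "lin_sec (br X Y) \<in> carrier L"
      using Q z w by (simp_all add: ab lin_sec.linear_closed H.sub_mem br_closed)
    have m: "\<mu> X \<in> carrier M" "\<mu> Y \<in> carrier M" "\<mu> (br X Y) \<in> carrier M" "d z \<in> carrier M" "d w \<in> carrier M"
      using Q z w by (simp_all add: \<mu>.linear_closed br_closed DerI_simps[OF d])
    have H': "a \<otimes>\<^bsub>L\<^esub> w \<in> H" "b \<otimes>\<^bsub>L\<^esub> z \<in> H" "z \<otimes>\<^bsub>L\<^esub> w \<in> H" "defect X Y \<in> H"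
      using L z w Q by (simp_all add: bracket_in_ideal defect_mem)
    have Dx: "D x = \<mu> X \<oplus>\<^bsub>M\<^esub> d z" and Dy: "D y = \<mu> Y \<oplus>\<^bsub>M\<^esub> d w"
      using z w by (simp_all add: D_def XY)
    have zb: "z \<otimes>\<^bsub>L\<^esub> b = \<ominus>\<^bsub>L\<^esub> (b \<otimes>\<^bsub>L\<^esub> z)" using L by (intro bracket_antisym)
    \<comment> \<open>All four terms on the right lie in H, so \<open>d\<close> can be applied to
      them one by one.\<close>
    have "x \<otimes>\<^bsub>L\<^esub> y \<ominus>\<^bsub>L\<^esub> lin_sec (br X Y) =
        defect X Y \<oplus>\<^bsub>L\<^esub> a \<otimes>\<^bsub>L\<^esub> w \<oplus>\<^bsub>L\<^esub> z \<otimes>\<^bsub>L\<^esub> w \<ominus>\<^bsub>L\<^esub> b \<otimes>\<^bsub>L\<^esub> z"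
      unfolding z(2) w(2) using L
      by (simp add: defect_def bracket_simps zb L.M.diff_simps L.M.a_ac flip: ab)
    then have "D (x \<otimes>\<^bsub>L\<^esub> y) = \<mu> (br X Y) \<oplus>\<^bsub>M\<^esub>
        (d (defect X Y) \<oplus>\<^bsub>M\<^esub> d (a \<otimes>\<^bsub>L\<^esub> w) \<oplus>\<^bsub>M\<^esub> d (z \<otimes>\<^bsub>L\<^esub> w) \<ominus>\<^bsub>M\<^esub> d (b \<otimes>\<^bsub>L\<^esub> z))"
      using H' x y by (simp add: D_def XY quot_bracket DerI_simps(2,3)[OF d] H.sub_add)
    moreover have "\<mu> (br X Y) = act a (\<mu> Y) \<ominus>\<^bsub>M\<^esub> act b (\<mu> X) \<ominus>\<^bsub>M\<^esub> d (defect X Y)"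
      using flat[OF Q] L m H'
      by (simp add: curv_def act_closed DerI_simps(1)[OF d] N.M.diff_simps N.M.a_ac flip: ab)
    \<comment> \<open>The lifting condition at X and Y, tested on \<open>w\<close> and
      \<open>z\<close>, gives \<open>d\<close> on the mixed brackets. Flatness has just supplied
      \<mu> at [X, Y], and the derivation law of \<open>d\<close> on H will supply d [z, w].\<close>
    moreover have "d (a \<otimes>\<^bsub>L\<^esub> w) = act a (d w) \<ominus>\<^bsub>M\<^esub> act w (\<mu> X)" "d (b \<otimes>\<^bsub>L\<^esub> z) = act b (d z) \<ominus>\<^bsub>M\<^esub> act z (\<mu> Y)"
    proof -
      have "(\<mu> X, a) \<in> carrier (E d)" "(\<mu> Y, b) \<in> carrier (E d)"
        using \<mu> Q by (simp_all add: lifting_def ab)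
      from E_act[OF d this(1) w(1)] E_act[OF d this(2) z(1)]
      show "d (a \<otimes>\<^bsub>L\<^esub> w) = act a (d w) \<ominus>\<^bsub>M\<^esub> act w (\<mu> X)" "d (b \<otimes>\<^bsub>L\<^esub> z) = act b (d z) \<ominus>\<^bsub>M\<^esub> act z (\<mu> Y)"
        using L m H' by (simp_all add: act_closed DerI_simps(1)[OF d] N.M.diff_simps N.M.a_ac)
    qed
    moreover have "act x (D y) \<ominus>\<^bsub>M\<^esub> act y (D x) =
        act (a \<oplus>\<^bsub>L\<^esub> z) (\<mu> Y \<oplus>\<^bsub>M\<^esub> d w) \<ominus>\<^bsub>M\<^esub> act (b \<oplus>\<^bsub>L\<^esub> w) (\<mu> X \<oplus>\<^bsub>M\<^esub> d z)"
      by (simp only: Dx Dy ab z(2)[symmetric] w(2)[symmetric])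
    ultimately show ?thesis
      using L m H' z(1) w(1)
      by (simp add: act_simps DerI_simps(1,5)[OF d] N.M.diff_simps N.M.a_ac)
  qed
  have "restrict D (carrier L) \<in> carrier DerG" by (rule G.DerI[OF lin der])
  moreover have "restrict (restrict D (carrier L)) H = d"
  proof (rule extensionalityI[of _ H])
    show "d \<in> extensional H" using I.DerD(1)[OF d] by simp
    fix z assume z: "z \<in> H"
    \<comment> \<open>Both \<mu> and \<open>lin_sec\<close> vanish at this coset, which leaves only
      \<open>d z\<close>.\<close>
    have "H +>\<^bsub>L\<^esub> z = \<zero>\<^bsub>quot L H\<^esub>"
      using z by (simp add: H.coset_eq_self_iff H.quot_zero H.sub_mem)
    then show "restrict (restrict D (carrier L)) H z = d z"
      using z by (simp add: H.sub_mem D_def \<mu>.map_zero lin_sec.map_zero L.M.diff_zero DerI_simps(1)[OF d])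
  qed (rule restrict_extensional)
  ultimately show ?thesis by blast
qed

text \<open>The same \<open>m\<close> gives an inner derivation of L whose restriction is
  \<open>d\<close>, so \<open>tr_hat_res\<close> applies. Together with linearity this makes
  \<open>tr\<close> well defined on classes.\<close>

lemma tr_hat_inner: "d \<in> InnI \<Longrightarrow> tr_hat K L H M act d = \<zero>\<^bsub>H2Q\<^esub>"
proof -
  assume "d \<in> InnI"
  then obtain m where m: "m \<in> carrier M" "d = (\<lambda>z\<in>H. act z m)" by (auto simp: Inn_def)
  then show ?thesis using tr_hat_res[OF G.inner_Der[OF m(1)]] by (simp only: res_inner)
qed

lemma linear_tr: "linear_map K H1I H2Q (tr K L H M act)"
  unfolding H1_invariants_eq tr_def using DI.linear_induced_map[OF linear_tr_hat tr_hat_inner] .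

lemma tr_coset:
  "d \<in> invariant_ders \<Longrightarrow>
    tr K L H M act (InnI +>\<^bsub>DerI\<lparr>carrier := invariant_ders\<rparr>\<^esub> d) = tr_hat K L H M act d"
  unfolding tr_def using DI.induced_map_coset[OF linear_tr_hat tr_hat_inner] by simp

lemma image_res: "res K L H M act ` carrier H1G = a_kernel H1I H2Q (tr K L H M act)"
proof (intro equalityI subsetI)
  fix c assume "c \<in> res K L H M act ` carrier H1G"
  then obtain d where d: "d \<in> carrier DerG"
    "c = InnI +>\<^bsub>DerI\<lparr>carrier := invariant_ders\<rparr>\<^esub> restrict d H"
    by (auto simp: H1_def G.Inn.quot_carrier res_coset)
  then show "c \<in> a_kernel H1I H2Q (tr K L H M act)"
    using res_Der[OF d(1)] DI.quotI[of "restrict d H"]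
    by (simp add: a_kernel_eq tr_coset tr_hat_res H1_invariants_eq)
next
  fix c assume c: "c \<in> a_kernel H1I H2Q (tr K L H M act)"
  then obtain d where d: "d \<in> invariant_ders" "c = InnI +>\<^bsub>DerI\<lparr>carrier := invariant_ders\<rparr>\<^esub> d"
    by (auto simp: a_kernel_eq H1_invariants_eq DI.quot_carrier)
  then have "tr_hat K L H M act d = \<zero>\<^bsub>H2Q\<^esub>" using c by (simp add: a_kernel_eq tr_coset)
  then obtain D where "D \<in> carrier DerG" "restrict D H = d"
    using flat_lifting_exists[OF d(1)] flat_lifting_extends[OF invariant_dersD[OF d(1)]] by blast
  then show "c \<in> res K L H M act ` carrier H1G"
    using d(2) res_coset[of D] G.Inn.quotI[of D] by (force simp: H1_def)
qed

end

theorem corollary5p8: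
  fixes K :: "('k, 'r) ring_scheme" and L :: "('k, 'l) module" and H :: "'l set"
    and M :: "('k, 'm) module" and act :: "'l \<Rightarrow> 'm \<Rightarrow> 'm"
  assumes "Ring.field K"
    and "lie_algebra K L"
    and "lie_ideal K L H"
    and "lie_module K L M act"
  shows "linear_map K (H1 K (quot L H) (invariants H M act) (quot_act act)) (H1 K L M act)
           (infl K L H M act) \<and>
    linear_map K (H1 K L M act) (H1_invariants K L H M act) (res K L H M act) \<and>
    linear_map K (H1_invariants K L H M act)
           (H2 K (quot L H) (invariants H M act) (quot_act act)) (tr K L H M act) \<and>
    a_kernel (H1 K (quot L H) (invariants H M act) (quot_act act)) (H1 K L M act)
           (infl K L H M act) = {\<zero>\<^bsub>H1 K (quot L H) (invariants H M act) (quot_act act)\<^esub>} \<and>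
    infl K L H M act ` carrier (H1 K (quot L H) (invariants H M act) (quot_act act)) =
         a_kernel (H1 K L M act) (H1_invariants K L H M act) (res K L H M act) \<and>
    res K L H M act ` carrier (H1 K L M act) =
         a_kernel (H1_invariants K L H M act)
           (H2 K (quot L H) (invariants H M act) (quot_act act)) (tr K L H M act)"
proof -
  interpret lie_ideal_module K L H M act
    using assms by (simp add: lie_ideal_module_def)
  show ?thesis
    by (intro conjI linear_infl linear_res linear_tr kernel_infl image_infl image_res)
qed

end
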